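(* For each fixed positive integer $k$, as $n\to\infty$, $$|(\mathrm{Ex}\,(k+1)C)_n| = \left(1+e^{-\Omega(n)}\right)\,|(\mathrm{apex}^k\,\mathcal{F})_n| .$$
   Context: Graphs are finite and simple. A set $B$ of vertices of a graph $G$ is a blocker if the graph $G-B$ obtained by deleting the vertices in $B$ has no cycles. $\mathcal{F}$ denotes the class of forests; $\mathrm{apex}^k\,\mathcal{F}$ denotes the class of graphs with a blocker of size at most $k$; $\mathrm{Ex}\,(k+1)C$ denotes the class of graphs which do not have $k+1$ pairwise vertex-disjoint cycles. For a class $\mathcal{A}$ of graphs, $\mathcal{A}_n$ denotes the set of graphs in $\mathcal{A}$ on the vertex set $\{1,\ldots,n\}$ (so labelled graphs are counted). Here $e^{-\Omega(n)}$ denotes a nonnegative quantity which is at most $e^{-cn}$ for all sufficiently large $n$, for some constant $c>0$ (which may depend on $k$). *)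

theory Defs
  imports Complex_Main
begin

text \<open>A graph is a pair of a vertex set and a set of edges, an edge being a 2-element
  set of vertices.\<close>

type_synonym 'a graph = "'a set \<times> 'a set set"

abbreviation verts :: "'a graph \<Rightarrow> 'a set" where
  "verts G \<equiv> fst G"

abbreviation edges :: "'a graph \<Rightarrow> 'a set set" where
  "edges G \<equiv> snd G"

definition simple_graph :: "'a graph \<Rightarrow> bool" where
  "simple_graph G \<longleftrightarrow> finite (verts G) \<and> (\<forall>e\<in>edges G. e \<subseteq> verts G \<and> card e = 2)"

text \<open>A cycle is given by the list of its vertices in cyclic order, without repeating
  the first vertex at the end.\<close>

definition is_cycle :: "'a graph \<Rightarrow> 'a list \<Rightarrow> bool" where
  "is_cycle G xs \<longleftrightarrow> 3 \<le> length xs \<and> distinct xs \<and> set xs \<subseteq> verts G \<and>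
     (\<forall>i<length xs. {xs ! i, xs ! (Suc i mod length xs)} \<in> edges G)"

definition delete_verts :: "'a graph \<Rightarrow> 'a set \<Rightarrow> 'a graph" where
  "delete_verts G B = (verts G - B, {e \<in> edges G. e \<inter> B = {}})"

definition forests :: "'a graph set" where
  "forests = {G. simple_graph G \<and> \<not> (\<exists>xs. is_cycle G xs)}"

definition blocker :: "'a graph \<Rightarrow> 'a set \<Rightarrow> bool" where
  "blocker G B \<longleftrightarrow> B \<subseteq> verts G \<and> delete_verts G B \<in> forests"

definition apex_forests :: "nat \<Rightarrow> 'a graph set" where
  "apex_forests k = {G. simple_graph G \<and> (\<exists>B. blocker G B \<and> card B \<le> k)}"

definition has_disjoint_cycles :: "nat \<Rightarrow> 'a graph \<Rightarrow> bool" where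
  "has_disjoint_cycles m G \<longleftrightarrow>
     (\<exists>C :: nat \<Rightarrow> 'a list. (\<forall>i<m. is_cycle G (C i)) \<and>
        (\<forall>i<m. \<forall>j<m. i \<noteq> j \<longrightarrow> set (C i) \<inter> set (C j) = {}))"

definition ex_disjoint_cycles :: "nat \<Rightarrow> 'a graph set" where
  "ex_disjoint_cycles m = {G. simple_graph G \<and> \<not> has_disjoint_cycles m G}"

definition labelled :: "nat graph set \<Rightarrow> nat \<Rightarrow> nat graph set" where
  "labelled A n = {G \<in> A. verts G = {1..n}}"

text \<open>The sequences that may be denoted by \<open>e\<close> to the power \<open>-\<Omega>(n)\<close>.\<close>

definition exp_minus_Omega :: "(nat \<Rightarrow> real) \<Rightarrow> bool" where
  "exp_minus_Omega f \<longleftrightarrow> (\<forall>n. 0 \<le> f n) \<and>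
     (\<exists>c>0. \<forall>\<^sub>F n in sequentially. f n \<le> exp (- c * real n))"

text \<open>The cardinalities in the theorem are those of finite sets.\<close>

lemma finite_labelled:
  assumes "\<And>G. G \<in> A \<Longrightarrow> simple_graph G"
  shows "finite (labelled A n)"
proof (rule finite_subset)
  show "labelled A n \<subseteq> {{1..n}} \<times> Pow (Pow {1..n})"
    using assms by (fastforce simp: labelled_def simple_graph_def)
qed simp

end

theory Submission
  imports Defs "HOL-Library.FuncSet"
begin

text \<open>A graph without \<open>k + 1\<close> disjoint cycles has a bounded blocker (Erdos and Posa). A vertex of it that
  can be prevented from forming cycles with the remaining forest by deleting \<open>k\<close> forest vertices is
  called minor. At most \<open>k\<close> vertices are not minor, since cycles through \<open>k + 1\<close> of them could be chosen
  disjoint. So the vertex set splits into a set \<open>B\<close> of at most \<open>k\<close> vertices, a bounded set \<open>W\<close>, and a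
  forest \<open>F\<close> that stays a forest when any single \<open>w \<in> W\<close> is added. A forest is encoded by its parent
  function, and since \<open>w\<close> is joined at most once to each tree, there are at most \<open>n ^ n * exp (o(n))\<close>
  choices for \<open>F\<close> together with the edges at \<open>W\<close>, while \<open>B\<close> allows \<open>2 ^ (k * n)\<close> choices. There are at
  least \<open>2 ^ (k * n) * n ^ n * exp (- o(n))\<close> graphs with a blocker of size \<open>k\<close>. It remains to save an
  exponential factor when \<open>B\<close> is not a blocker. This is clear when \<open>card B < k\<close>. Otherwise fix a cycle
  avoiding \<open>B\<close>. If there is a linear matching of \<open>F\<close> off the cycle, then for most choices of the edges at
  \<open>B\<close> there are \<open>k\<close> further triangles made of a vertex of \<open>B\<close> and a matching edge, which is
  impossible. If there is none, then \<open>F\<close> has a path of linear length, or all its edges are covered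
  by few vertices, and such forests are exponentially rare.\<close>

section \<open>Cycles and degree sums\<close>

text \<open>The obstacle is the attachment of \<open>W\<close>: on trees of sizes s1, s2, ... it
  allows up to the product of the (1 + si) ^ \<open>card W\<close> choices, which is exponential
  when most trees are small. Such forests have many roots and are rare among parent functions.
  Giving each root a constant weight \<open>K\<close> with (1 + x) ^ w \<le> \<open>K\<close> * exp
  (\<eta> * x) absorbs the product, up to exp (\<eta> * N), into a sum over all parent functions
  equal to (N + \<open>K\<close>) ^ N, which is N ^ N up to a constant factor. Since \<eta> may be
  arbitrarily small, it is taken to be half of the rate saved elsewhere. Long paths matter because
  the fixed cycle must be short for a matching to avoid it, and a long cycle that meets only
  boundedly many vertices of \<open>W\<close> contains a long forest path. A chain of t vertices
  with prescribed parents costs the birthday factor exp (- t * (t - 1) / (2 * N)). A cover by N / 64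
  vertices leaves the other vertices so few possible parents that the 2 ^ N choices of the cover are
  outweighed. The pairs \<open>B\<close>, \<open>W\<close> are polynomially many, and the lower
  bound rests on Cayley's count m ^ (m - 2) of trees with m = n - k.\<close>

text \<open>A vertex set contains a cycle iff it contains a core, so that cores stand in for cycles. The
  degree sum \<open>vol\<close> is twice the number of edges.\<close>

definition nb :: "'a set set \<Rightarrow> 'a set \<Rightarrow> 'a \<Rightarrow> 'a set" where
  "nb E X x = {y \<in> X. y \<noteq> x \<and> {x, y} \<in> E}"

definition core :: "'a set set \<Rightarrow> 'a set \<Rightarrow> bool" where
  "core E Y \<longleftrightarrow> finite Y \<and> Y \<noteq> {} \<and> (\<forall>y\<in>Y. 2 \<le> card (nb E Y y))"

definition acyc :: "'a set set \<Rightarrow> 'a set \<Rightarrow> bool" where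
  "acyc E X \<longleftrightarrow> (\<forall>Y\<subseteq>X. \<not> core E Y)"

definition vol :: "'a set set \<Rightarrow> 'a set \<Rightarrow> nat" where
  "vol E X = (\<Sum>x\<in>X. card (nb E X x))"

definition pack :: "'a set set \<Rightarrow> 'a set \<Rightarrow> nat \<Rightarrow> bool" where
  "pack E X m \<longleftrightarrow> (\<exists>C :: nat \<Rightarrow> 'a set. (\<forall>i<m. C i \<subseteq> X \<and> core E (C i)) \<and>
     (\<forall>i<m. \<forall>j<m. i \<noteq> j \<longrightarrow> C i \<inter> C j = {}))"

lemma nb_subset: "nb E X x \<subseteq> X"
  by (auto simp: nb_def)

lemma finite_nb [simp]: "finite X \<Longrightarrow> finite (nb E X x)"
  by (simp add: nb_def)

lemma nb_mono: "X \<subseteq> Y \<Longrightarrow> E \<subseteq> E' \<Longrightarrow> nb E X x \<subseteq> nb E' Y x"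
  by (auto simp: nb_def)

lemma card_nb_mono: "finite Y \<Longrightarrow> X \<subseteq> Y \<Longrightarrow> E \<subseteq> E' \<Longrightarrow> card (nb E X x) \<le> card (nb E' Y x)"
  by (intro card_mono nb_mono finite_nb)

lemma card_nb_disjoint_Un:
  assumes "finite X" "finite Y" "X \<inter> Y = {}"
  shows "card (nb E (X \<union> Y) x) = card (nb E X x) + card (nb E Y x)"
proof -
  have "nb E (X \<union> Y) x = nb E X x \<union> nb E Y x" by (auto simp: nb_def)
  then show ?thesis
    using assms by (simp add: card_Un_disjoint nb_def disjoint_iff)
qed

lemma coreD: "core E Y \<Longrightarrow> finite Y" "core E Y \<Longrightarrow> Y \<noteq> {}"
  "core E Y \<Longrightarrow> y \<in> Y \<Longrightarrow> 2 \<le> card (nb E Y y)"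
  by (auto simp: core_def)

lemma coreI:
  assumes "finite Y" "Y \<noteq> {}"
    "\<And>y. y \<in> Y \<Longrightarrow> \<exists>a b. a \<in> Y \<and> b \<in> Y \<and> a \<noteq> b \<and> a \<noteq> y \<and> b \<noteq> y \<and> {y, a} \<in> E \<and> {y, b} \<in> E"
  shows "core E Y"
  unfolding core_def
proof (intro conjI ballI)
  fix y assume "y \<in> Y"
  then obtain a b where "a \<in> nb E Y y" "b \<in> nb E Y y" "a \<noteq> b"
    using assms(3) by (force simp: nb_def)
  then have "card {a, b} \<le> card (nb E Y y)"
    using assms(1) by (intro card_mono) auto
  then show "2 \<le> card (nb E Y y)" using \<open>a \<noteq> b\<close> by simp
qed (use assms in auto)

lemma core_edge_mono: "core E Y \<Longrightarrow> E \<subseteq> E' \<Longrightarrow> core E' Y"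
  using card_nb_mono[OF _ order_refl, of Y E E'] unfolding core_def by (meson le_trans)

lemma core_triangle:
  assumes "{x, y} \<in> E" "{y, z} \<in> E" "{x, z} \<in> E" "x \<noteq> y" "y \<noteq> z" "x \<noteq> z"
  shows "core E {x, y, z}"
proof (rule coreI)
  fix v assume "v \<in> {x, y, z}"
  then consider "v = x" | "v = y" | "v = z" by blast
  then show "\<exists>p q. p \<in> {x, y, z} \<and> q \<in> {x, y, z} \<and> p \<noteq> q \<and> p \<noteq> v \<and> q \<noteq> v \<and> {v, p} \<in> E \<and> {v, q} \<in> E"
  proof cases
    case 1 then show ?thesis using assms by (intro exI[of _ y] exI[of _ z]) auto
  next
    case 2 then show ?thesis using assms by (intro exI[of _ x] exI[of _ z]) (auto simp: insert_commute)
  next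
    case 3 then show ?thesis using assms by (intro exI[of _ x] exI[of _ y]) (auto simp: insert_commute)
  qed
qed auto

lemma acyc_mono: "acyc E X \<Longrightarrow> X' \<subseteq> X \<Longrightarrow> acyc E X'"
  by (auto simp: acyc_def)

lemma not_core_empty [simp]: "\<not> core E {}"
  by (simp add: core_def)

lemma nb_sing [simp]: "nb E {v} v = {}"
  by (auto simp: nb_def)

lemma not_core_sing [simp]: "\<not> core E {v}"
  by (simp add: core_def)

lemma packE:
  assumes "pack E X m"
  obtains C where "\<And>i. i < m \<Longrightarrow> C i \<subseteq> X" "\<And>i. i < m \<Longrightarrow> core E (C i)"
    "\<And>i j. i < m \<Longrightarrow> j < m \<Longrightarrow> i \<noteq> j \<Longrightarrow> C i \<inter> C j = {}"
proof -
  from assms obtain C where "\<forall>i<m. C i \<subseteq> X \<and> core E (C i)"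
    "\<forall>i<m. \<forall>j<m. i \<noteq> j \<longrightarrow> C i \<inter> C j = {}"
    unfolding pack_def by (elim exE conjE)
  then show ?thesis by (intro that[of C]) simp_all
qed

lemma packI:
  assumes "\<And>i. i < m \<Longrightarrow> C i \<subseteq> X" "\<And>i. i < m \<Longrightarrow> core E (C i)"
    "\<And>i j. i < m \<Longrightarrow> j < m \<Longrightarrow> i \<noteq> j \<Longrightarrow> C i \<inter> C j = {}"
  shows "pack E X m"
  unfolding pack_def using assms by (intro exI[of _ C]) simp

lemma pack_mono:
  assumes "pack E X m" "E \<subseteq> E'" "X \<subseteq> X'"
  shows "pack E' X' m"
proof -
  obtain C where C: "\<And>i. i < m \<Longrightarrow> C i \<subseteq> X" "\<And>i. i < m \<Longrightarrow> core E (C i)"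
    "\<And>i j. i < m \<Longrightarrow> j < m \<Longrightarrow> i \<noteq> j \<Longrightarrow> C i \<inter> C j = {}"
    by (rule packE[OF assms(1)], rule that)
  show ?thesis
  proof (rule packI[of _ C])
    fix i assume "i < m"
    then show "C i \<subseteq> X'" "core E' (C i)" using C assms(3) core_edge_mono[OF _ assms(2)] by blast+
  qed (fact C(3))
qed

lemma pack_le:
  assumes "pack E X m" "m' \<le> m"
  shows "pack E X m'"
proof -
  obtain C where C: "\<And>i. i < m \<Longrightarrow> C i \<subseteq> X" "\<And>i. i < m \<Longrightarrow> core E (C i)"
    "\<And>i j. i < m \<Longrightarrow> j < m \<Longrightarrow> i \<noteq> j \<Longrightarrow> C i \<inter> C j = {}"
    by (rule packE[OF assms(1)], rule that)
  show ?thesis using assms(2) by (intro packI[of _ C] C) auto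
qed

lemma pack_Suc:
  assumes "pack E X m" "core E Y" "X \<inter> Y = {}"
  shows "pack E (X \<union> Y) (Suc m)"
proof -
  obtain C where C: "\<And>i. i < m \<Longrightarrow> C i \<subseteq> X" "\<And>i. i < m \<Longrightarrow> core E (C i)"
    "\<And>i j. i < m \<Longrightarrow> j < m \<Longrightarrow> i \<noteq> j \<Longrightarrow> C i \<inter> C j = {}"
    by (rule packE[OF assms(1)], rule that)
  show ?thesis
  proof (rule packI[of _ "C(m := Y)"])
    fix i j assume "i < Suc m" "j < Suc m" "i \<noteq> j"
    then show "(C(m := Y)) i \<inter> (C(m := Y)) j = {}"
      using C(1)[of i] C(1)[of j] C(3)[of i j] assms(3) by (auto simp: less_Suc_eq)
  next
    fix i assume "i < Suc m"
    then show "(C(m := Y)) i \<subseteq> X \<union> Y" "core E ((C(m := Y)) i)"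
      using C(1)[of i] C(2)[of i] assms(2) by (auto simp: less_Suc_eq)
  qed
qed

lemma pack_family:
  assumes "finite I" "\<And>i. i \<in> I \<Longrightarrow> C i \<subseteq> X" "\<And>i. i \<in> I \<Longrightarrow> core E (C i)"
    "\<And>i j. i \<in> I \<Longrightarrow> j \<in> I \<Longrightarrow> i \<noteq> j \<Longrightarrow> C i \<inter> C j = {}"
  shows "pack E X (card I)"
proof -
  obtain h where h: "bij_betw h {0..<card I} I"
    using ex_bij_betw_nat_finite[OF assms(1)] by blast
  have in_I: "h i \<in> I" if "i < card I" for i
    using h that by (auto simp: bij_betw_def)
  have "h i \<noteq> h j" if "i < card I" "j < card I" "i \<noteq> j" for i j
    using h that by (auto simp: bij_betw_def inj_on_def)
  then show ?thesis
    using in_I assms by (intro packI[of _ "C \<circ> h"]) auto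
qed

lemma pack_zero [simp]: "pack E X 0"
  by (simp add: pack_def)

text \<open>Every edge at \<open>x\<close> enters the degree sum once at each of its two
  ends.\<close>

lemma vol_insert:
  assumes "finite X" "x \<notin> X"
  shows "vol E (insert x X) = vol E X + 2 * card (nb E X x)"
proof -
  have 1: "nb E (insert x X) x = nb E X x" by (auto simp: nb_def)
  have 2: "card (nb E (insert x X) y) = card (nb E X y) + (if y \<in> nb E X x then 1 else 0)" if "y \<in> X" for y
  proof (cases "y \<in> nb E X x")
    case True
    then have "nb E (insert x X) y = insert x (nb E X y)"
      using assms that by (auto simp: nb_def insert_commute)
    moreover have "x \<notin> nb E X y" using assms by (auto simp: nb_def)
    ultimately show ?thesis using assms True by simp
  next
    case False
    then have "nb E (insert x X) y = nb E X y"
      using assms that by (auto simp: nb_def insert_commute)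
    then show ?thesis using False by simp
  qed
  have "(\<Sum>y\<in>X. if y \<in> nb E X x then 1 else 0) = card (X \<inter> nb E X x)"
    using assms by (simp add: sum.If_cases Int_def)
  also have "X \<inter> nb E X x = nb E X x" by (auto simp: nb_def)
  finally show ?thesis
    using assms 1 2 by (simp add: vol_def sum.distrib)
qed

lemma vol_remove:
  assumes "finite X" "x \<in> X"
  shows "vol E X = vol E (X - {x}) + 2 * card (nb E X x)"
proof -
  have "nb E (X - {x}) x = nb E X x" by (auto simp: nb_def)
  then show ?thesis
    using vol_insert[of "X - {x}" x E] assms by (simp add: insert_absorb)
qed

lemma vol_diff:
  assumes "finite X" "T \<subseteq> X"
  shows "vol E X \<le> vol E (X - T) + 2 * (\<Sum>t\<in>T. card (nb E X t))"
proof -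
  have "finite T" using assms finite_subset by blast
  then show ?thesis using assms(2)
  proof (induction T rule: finite_induct)
    case (insert t T)
    have "vol E (X - T) = vol E (X - T - {t}) + 2 * card (nb E (X - T) t)"
      using insert assms by (intro vol_remove) auto
    moreover have "card (nb E (X - T) t) \<le> card (nb E X t)"
      using assms by (intro card_nb_mono) auto
    moreover have "X - insert t T = X - T - {t}" by auto
    ultimately show ?case using insert by simp
  qed simp
qed

text \<open>Deleting a vertex of degree at most 1 keeps the average degree at least 2. A single
  vertex has volume 0, so the deletion must stop earlier, at a core.\<close>

lemma core_of_vol:
  assumes "finite X" "X \<noteq> {}" "2 * card X \<le> vol E X"
  shows "\<exists>Y\<subseteq>X. core E Y"
  using assms
proof (induction "card X" arbitrary: X)
  case 0
  then show ?case by simp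
next
  case (Suc n)
  show ?case
  proof (cases "core E X")
    case False
    then obtain x where x: "x \<in> X" "card (nb E X x) < 2"
      using Suc.prems unfolding core_def by force
    have v: "vol E X = vol E (X - {x}) + 2 * card (nb E X x)"
      using Suc.prems x by (intro vol_remove) auto
    have "X - {x} \<noteq> {}"
    proof
      assume "X - {x} = {}"
      then have "X = {x}" using x by auto
      moreover have "vol E {x} = 0" by (auto simp: vol_def nb_def)
      ultimately show False using Suc.prems by simp
    qed
    moreover have "card (X - {x}) = n" using Suc x by (simp add: card_Diff_singleton)
    ultimately have "\<exists>Y\<subseteq>X - {x}. core E Y"
      using Suc v x by (intro Suc.hyps(1)) auto
    then show ?thesis by auto
  qed auto
qed

text \<open>The usual edge bound for forests. Parity of the degree sum turns the strict inequality
  into a gap of 2.\<close>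

lemma vol_acyc:
  assumes "finite X" "X \<noteq> {}" "acyc E X"
  shows "vol E X + 2 \<le> 2 * card X"
proof -
  have "even (vol E X)" using assms(1)
    by (induction X rule: finite_induct) (simp add: vol_def, simp add: vol_insert)
  moreover have "vol E X < 2 * card X"
    using core_of_vol[OF assms(1,2), of E] assms(3) unfolding acyc_def not_less[symmetric] by blast
  ultimately show ?thesis by presburger
qed

lemma vol_core: "core E Y \<Longrightarrow> 2 * card Y \<le> vol E Y"
  using sum_mono[of Y "\<lambda>_. 2" "\<lambda>y. card (nb E Y y)"] by (simp add: core_def vol_def)

text \<open>A tree has two leaves.\<close>

lemma acyc_all_but_one:
  assumes "finite Z" "acyc E Z" "v \<in> Z" "\<And>z. z \<in> Z - {v} \<Longrightarrow> 2 \<le> card (nb E Z z)"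
  shows "Z = {v}"
proof -
  have "2 * card (Z - {v}) \<le> (\<Sum>z\<in>Z - {v}. card (nb E Z z))"
    using sum_mono[of "Z - {v}" "\<lambda>_. 2" "\<lambda>z. card (nb E Z z)"] assms by simp
  moreover have "vol E Z = card (nb E Z v) + (\<Sum>z\<in>Z - {v}. card (nb E Z z))"
    using assms by (simp add: vol_def sum.remove)
  moreover have "vol E Z + 2 \<le> 2 * card Z" using assms by (intro vol_acyc) auto
  moreover have "card Z = Suc (card (Z - {v}))" using assms by (metis card.remove)
  \<comment> \<open>The other vertices already use up the whole volume of a forest, so
    \<open>v\<close> is isolated and the rest, if nonempty, would be a core.\<close>
  ultimately have "card (nb E Z v) = 0" by simp
  then have nb: "nb E Z v = {}" using assms by simp
  have "nb E (Z - {v}) z = nb E Z z" if "z \<in> Z" for z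
    using nb that assms by (auto simp: nb_def insert_commute)
  then have "Z - {v} = {} \<or> core E (Z - {v})"
    using assms by (auto simp: core_def)
  then show ?thesis using assms by (auto simp: acyc_def)
qed

text \<open>Here \<open>v\<close> is a cut vertex. If a core meets one side, its part on that side
  together with \<open>v\<close> has degree at least 2 everywhere except perhaps at
  \<open>v\<close>, which is impossible in a forest with more than one vertex.\<close>

lemma acyc_glue:
  assumes "acyc E (insert v X1)" "acyc E (insert v X2)"
    "\<And>x y. x \<in> X1 \<Longrightarrow> y \<in> X2 \<Longrightarrow> {x, y} \<notin> E" "X1 \<inter> X2 = {}" "v \<notin> X1" "v \<notin> X2"
  shows "acyc E (insert v (X1 \<union> X2))"
  unfolding acyc_def
proof (intro allI impI notI)
  fix Y assume Y: "Y \<subseteq> insert v (X1 \<union> X2)" "core E Y"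
  have part: "Y \<inter> X = {}"
    if "acyc E (insert v X)" "v \<notin> X" "\<And>x y. x \<in> Y \<inter> X \<Longrightarrow> y \<in> Y \<Longrightarrow> {x, y} \<in> E \<Longrightarrow> y \<in> insert v X" for X
  proof (rule ccontr)
    assume ne: "Y \<inter> X \<noteq> {}"
    define Z where "Z = Y \<inter> insert v X"
    have nbZ: "nb E Z z = nb E Y z" if "z \<in> Y \<inter> X" for z
      using that \<open>\<And>x y. x \<in> Y \<inter> X \<Longrightarrow> y \<in> Y \<Longrightarrow> {x, y} \<in> E \<Longrightarrow> y \<in> insert v X\<close>
      by (auto simp: nb_def Z_def)
    have fin: "finite Z" "acyc E Z" using Y that(1) by (auto simp: Z_def coreD intro: acyc_mono)
    show False
    proof (cases "v \<in> Y")
      case True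
      have "Z = {v}"
      proof (rule acyc_all_but_one[OF fin])
        fix z assume "z \<in> Z - {v}"
        then have "z \<in> Y \<inter> X" by (auto simp: Z_def)
        then show "2 \<le> card (nb E Z z)" using nbZ Y coreD(3) by fastforce
      qed (use True in \<open>auto simp: Z_def\<close>)
      then show False using ne that(2) by (auto simp: Z_def)
    next
      case False
      then have "Z = Y \<inter> X" by (auto simp: Z_def)
      then have "core E Z" using nbZ Y ne fin by (auto simp: core_def)
      then show False using fin by (auto simp: acyc_def)
    qed
  qed
  have "Y \<inter> X1 = {}" using assms Y by (intro part) blast+
  moreover have "Y \<inter> X2 = {}" using assms Y
    by (intro part) (auto simp: insert_commute, metis insert_commute insert_iff Un_iff subsetD)
  ultimately have "Y \<subseteq> {v}" using Y by auto
  then show False using Y by (metis not_core_empty not_core_sing subset_singletonD)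
qed

section \<open>Translation between cycles as lists and cores\<close>

lemma core_of_is_cycle:
  assumes "is_cycle G xs"
  shows "core (edges G) (set xs)"
proof (rule coreI)
  let ?n = "length xs"
  have n: "3 \<le> ?n" and d: "distinct xs"
    and e: "\<And>i. i < ?n \<Longrightarrow> {xs ! i, xs ! (Suc i mod ?n)} \<in> edges G"
    using assms by (auto simp: is_cycle_def)
  show "set xs \<noteq> {}" using n by auto
  fix y assume "y \<in> set xs"
  then obtain i where i: "i < ?n" "y = xs ! i" by (auto simp: in_set_conv_nth)
  \<comment> \<open>\<open>p\<close> and \<open>q\<close> are the cyclic predecessor and successor
    of position \<open>i\<close>; they differ because the length is at least 3.\<close>
  define p where "p = (if i = 0 then ?n - 1 else i - 1)"
  define q where "q = Suc i mod ?n"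
  have q: "q = (if Suc i = ?n then 0 else Suc i)" using n i by (auto simp: q_def mod_less)
  moreover have "q < ?n" using n i q by (auto split: if_splits)
  ultimately have q: "q < ?n" "q = (if Suc i = ?n then 0 else Suc i)" by blast+
  have p: "p < ?n" "Suc p mod ?n = i" using n i by (auto simp: p_def)
  have "p \<noteq> q" "p \<noteq> i" "q \<noteq> i" using n i q by (auto simp: p_def split: if_splits)
  then have "xs ! p \<noteq> xs ! q" "xs ! p \<noteq> y" "xs ! q \<noteq> y"
    using d p q i by (auto simp: nth_eq_iff_index_eq)
  moreover have "{y, xs ! p} \<in> edges G" using e[OF p(1)] p i by (simp add: insert_commute)
  moreover have "{y, xs ! q} \<in> edges G" using e[OF i(1)] i by (simp add: q_def)
  moreover have "xs ! p \<in> set xs" "xs ! q \<in> set xs" using p q by auto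
  ultimately show "\<exists>a b. a \<in> set xs \<and> b \<in> set xs \<and> a \<noteq> b \<and> a \<noteq> y \<and> b \<noteq> y \<and>
      {y, a} \<in> edges G \<and> {y, b} \<in> edges G"
    by blast
qed auto

text \<open>All neighbours in the core of the first vertex of a longest path lie on that path. One
  of them is not the second vertex, and the edge to it closes a cycle.\<close>

lemma is_cycle_of_core:
  assumes "core E Y" "Y \<subseteq> V"
  shows "\<exists>xs. is_cycle (V, E) xs \<and> set xs \<subseteq> Y"
proof -
  define P where "P xs \<longleftrightarrow> xs \<noteq> [] \<and> distinct xs \<and> set xs \<subseteq> Y \<and>
    (\<forall>i. Suc i < length xs \<longrightarrow> {xs ! i, xs ! Suc i} \<in> E)" for xs
  have fin: "finite Y" using assms coreD by auto
  obtain y where "y \<in> Y" using assms coreD by blast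
  then have "P [y]" by (auto simp: P_def)
  moreover have "\<forall>xs. P xs \<longrightarrow> length xs < Suc (card Y)"
    using fin by (auto simp: P_def less_Suc_eq_le intro: order_trans[OF _ card_mono] simp flip: distinct_card)
  ultimately obtain xs where xs: "P xs" "\<And>ys. P ys \<Longrightarrow> length ys \<le> length xs"
    using ex_has_greatest_nat[of P "[y]" length "Suc (card Y)"] by blast
  let ?x = "xs ! 0"
  have x: "?x \<in> Y" using xs(1) by (auto simp: P_def)
  have in_xs: "z \<in> set xs" if "z \<in> nb E Y ?x" for z
  proof (rule ccontr)
    assume "z \<notin> set xs"
    have "P (z # xs)"
      unfolding P_def
    proof (intro conjI allI impI)
      fix i assume "Suc i < length (z # xs)"
      then show "{(z # xs) ! i, (z # xs) ! Suc i} \<in> E"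
        using xs(1) that by (cases i) (auto simp: P_def nb_def insert_commute)
    qed (use xs(1) that \<open>z \<notin> set xs\<close> in \<open>auto simp: P_def nb_def\<close>)
    then show False using xs(2) by fastforce
  qed
  have "\<not> nb E Y ?x \<subseteq> {xs ! 1}"
    using coreD(3)[OF assms(1) x] by (metis One_nat_def card.empty card.insert card_mono empty_iff
        finite.emptyI finite.insertI not_less_eq_eq numeral_2_eq_2)
  then obtain z where z: "z \<in> nb E Y ?x" "z \<noteq> xs ! 1" by auto
  obtain j where j: "j < length xs" "z = xs ! j" using in_xs[OF z(1)] by (auto simp: in_set_conv_nth)
  have "j \<noteq> 0"
  proof
    assume "j = 0"
    then show False using z j by (simp add: nb_def)
  qed
  then have j2: "2 \<le> j" using z j by (cases j; cases "j - 1") auto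
  define ys where "ys = take (Suc j) xs"
  have len: "length ys = Suc j" using j by (simp add: ys_def)
  have "is_cycle (V, E) ys"
    unfolding is_cycle_def
  proof (intro conjI allI impI)
    show "3 \<le> length ys" using len j2 by simp
    show "distinct ys" using xs(1) by (auto simp: P_def ys_def)
    show "set ys \<subseteq> verts (V, E)" using xs(1) assms(2) set_take_subset[of "Suc j" xs] by (auto simp:
        P_def ys_def)
    fix i assume i: "i < length ys"
    show "{ys ! i, ys ! (Suc i mod length ys)} \<in> edges (V, E)"
    proof (cases "i = j")
      case True
      then show ?thesis using z j len j2 by (auto simp: ys_def nb_def insert_commute)
    next
      case False
      then have "Suc i < length ys" using i len by simp
      then show ?thesis using xs(1) j len by (auto simp: ys_def P_def)
    qed
  qed
  moreover have "set ys \<subseteq> Y" using xs(1) set_take_subset[of "Suc j" xs] by (auto simp: P_def ys_def)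
  ultimately show ?thesis by blast
qed

lemma has_disjoint_cycles_iff: "has_disjoint_cycles m G \<longleftrightarrow> pack (edges G) (verts G) m"
proof
  assume "has_disjoint_cycles m G"
  then obtain C where "\<forall>i<m. is_cycle G (C i)"
    "\<forall>i<m. \<forall>j<m. i \<noteq> j \<longrightarrow> set (C i) \<inter> set (C j) = {}"
    by (auto simp: has_disjoint_cycles_def)
  moreover have "set (C i) \<subseteq> verts G" if "is_cycle G (C i)" for i
    using that by (simp add: is_cycle_def)
  ultimately show "pack (edges G) (verts G) m"
    unfolding pack_def by (intro exI[of _ "\<lambda>i. set (C i)"]) (simp add: core_of_is_cycle)
next
  assume "pack (edges G) (verts G) m"
  then obtain C where C: "\<And>i. i < m \<Longrightarrow> C i \<subseteq> verts G" "\<And>i. i < m \<Longrightarrow> core (edges G) (C i)"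
    "\<And>i j. i < m \<Longrightarrow> j < m \<Longrightarrow> i \<noteq> j \<Longrightarrow> C i \<inter> C j = {}"
    by - (rule packE, assumption, rule that)
  define D where "D i = (SOME xs. is_cycle G xs \<and> set xs \<subseteq> C i)" for i
  have D: "is_cycle G (D i) \<and> set (D i) \<subseteq> C i" if "i < m" for i
  proof -
    have "\<exists>xs. is_cycle G xs \<and> set xs \<subseteq> C i"
      using C(1,2)[OF that] is_cycle_of_core[of "edges G" "C i" "verts G"] by simp
    from someI_ex[OF this] show ?thesis by (simp add: D_def)
  qed
  have "set (D i) \<inter> set (D j) = {}" if "i < m" "j < m" "i \<noteq> j" for i j
    using D[OF that(1)] D[OF that(2)] C(3)[OF that] by blast
  with D show "has_disjoint_cycles m G"
    unfolding has_disjoint_cycles_def by blast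
qed

lemma forest_iff: "simple_graph G \<Longrightarrow> G \<in> forests \<longleftrightarrow> acyc (edges G) (verts G)"
proof -
  assume "simple_graph G"
  moreover have "(\<exists>xs. is_cycle G xs) \<longleftrightarrow> (\<exists>Y\<subseteq>verts G. core (edges G) Y)"
  proof
    assume "\<exists>xs. is_cycle G xs"
    then obtain xs where "is_cycle G xs" by blast
    then show "\<exists>Y\<subseteq>verts G. core (edges G) Y"
      using core_of_is_cycle[of G xs] by (auto simp: is_cycle_def)
  next
    assume "\<exists>Y\<subseteq>verts G. core (edges G) Y"
    then obtain Y where "Y \<subseteq> verts G" "core (edges G) Y" by blast
    then show "\<exists>xs. is_cycle G xs"
      using is_cycle_of_core[of "edges G" Y "verts G"] by auto
  qed
  ultimately show ?thesis by (auto simp: forests_def acyc_def)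
qed

lemma core_delete_verts: "Y \<inter> B = {} \<Longrightarrow> core (edges (delete_verts G B)) Y \<longleftrightarrow> core (edges G) Y"
proof -
  assume "Y \<inter> B = {}"
  then have "nb (edges (delete_verts G B)) Y y = nb (edges G) Y y" if "y \<in> Y" for y
    using that by (auto simp: nb_def delete_verts_def)
  then show ?thesis by (simp add: core_def)
qed

lemma blocker_iff:
  assumes "simple_graph G"
  shows "blocker G B \<longleftrightarrow> B \<subseteq> verts G \<and> acyc (edges G) (verts G - B)"
proof -
  have "simple_graph (delete_verts G B)"
    using assms by (auto simp: simple_graph_def delete_verts_def)
  moreover have "acyc (edges (delete_verts G B)) (verts (delete_verts G B)) \<longleftrightarrow> acyc (edges G) (verts G - B)"
  proof -
    have "core (edges (delete_verts G B)) Y \<longleftrightarrow> core (edges G) Y" if "Y \<subseteq> verts G - B" for Y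
      using that by (intro core_delete_verts) blast
    moreover have "verts (delete_verts G B) = verts G - B" by (simp add: delete_verts_def)
    ultimately show ?thesis unfolding acyc_def by simp
  qed
  ultimately show ?thesis by (simp add: blocker_def forest_iff)
qed

section \<open>Disjoint cycles in graphs of maximum degree four\<close>

lemma exists_min_core:
  assumes "core E Y"
  shows "\<exists>Z\<subseteq>Y. core E Z \<and> (\<forall>W. W \<subset> Z \<longrightarrow> \<not> core E W)"
proof -
  have "finite Y" using assms by (rule coreD)
  then show ?thesis using assms
  proof (induction Y rule: finite_psubset_induct)
    case (psubset Y)
    show ?case
    proof (cases "\<exists>W. W \<subset> Y \<and> core E W")
      case True
      then obtain W where W: "W \<subset> Y" "core E W" by (elim exE conjE)
      from psubset.IH[OF this] obtain Z where "Z \<subseteq> W" "core E Z" "\<forall>W. W \<subset> Z \<longrightarrow> \<not> core E W"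
        by (elim exE conjE)
      then show ?thesis using W(1) by (intro exI[of _ Z]) simp
    next
      case False
      then show ?thesis using psubset.prems by (intro exI[of _ Y]) simp
    qed
  qed
qed

text \<open>A minimal core is a cycle. Removing a vertex of minimum degree d leaves a forest, which
  bounds the volume by 2 * \<open>card Y\<close> + 2 * d - 4, while it is at least d *
  \<open>card Y\<close>. This forces d = 2, and then the volume leaves no room for a larger
  degree.\<close>

lemma min_core_degree:
  assumes "core E Y" "\<And>W. W \<subset> Y \<Longrightarrow> \<not> core E W" "y \<in> Y"
  shows "card (nb E Y y) = 2"
proof -
  have fin: "finite Y" using assms coreD by blast
  define d where "d = Min ((\<lambda>y. card (nb E Y y)) ` Y)"
  have "d \<in> (\<lambda>y. card (nb E Y y)) ` Y" unfolding d_def using fin assms(3) by (intro Min_in) auto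
  then obtain x where x: "x \<in> Y" "card (nb E Y x) = d" by auto
  have min: "d \<le> card (nb E Y z)" if "z \<in> Y" for z
    unfolding d_def using fin that by (intro Min_le) auto
  have d2: "2 \<le> d" using coreD(3)[OF assms(1) x(1)] x by simp
  have "card (insert x (nb E Y x)) \<le> card Y"
    using fin x by (intro card_mono) (auto simp: nb_def)
  then have g: "Suc d \<le> card Y" using x fin by (simp add: nb_def)
  have "acyc E (Y - {x})" using assms(2) x by (auto simp: acyc_def)
  moreover have "card (Y - {x}) = card Y - 1" using x fin by simp
  moreover have "Y - {x} \<noteq> {}"
    using g d2 \<open>card (Y - {x}) = card Y - 1\<close> by (intro notI) simp
  ultimately have "vol E (Y - {x}) + 2 \<le> 2 * (card Y - 1)" using vol_acyc[of "Y - {x}" E] fin by simp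
  then have v: "vol E Y + 4 \<le> 2 * card Y + 2 * d" using vol_remove[OF fin x(1), of E] x g by simp
  have "card Y * d \<le> vol E Y" using sum_mono[of Y "\<lambda>_. d" "\<lambda>z. card (nb E Y z)"] min by (simp add: vol_def)
  with v have "int (card Y) * int d + 4 \<le> 2 * int (card Y) + 2 * int d"
    by (metis (mono_tags, opaque_lifting) add_le_mono1 le_trans of_nat_add of_nat_le_iff of_nat_mult
        of_nat_numeral)
  then have "(int (card Y) - 2) * (int d - 2) \<le> 0" by (simp add: algebra_simps)
  moreover have "int (card Y) - 2 > 0" using g d2 by simp
  ultimately have "\<not> int d - 2 > 0" using mult_pos_pos[of "int (card Y) - 2" "int d - 2"] by linarith
  then have "d = 2" using d2 by simp
  with v have "vol E Y \<le> (\<Sum>z\<in>Y. 2)" by simp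
  show ?thesis
  proof (rule ccontr)
    assume "card (nb E Y y) \<noteq> 2"
    then have "2 < card (nb E Y y)" using min[OF assms(3)] \<open>d = 2\<close> by simp
    then have "(\<Sum>z\<in>Y. 2) < vol E Y"
      unfolding vol_def using fin min \<open>d = 2\<close> assms(3) by (intro sum_strict_mono_ex1) auto
    with \<open>vol E Y \<le> (\<Sum>z\<in>Y. 2)\<close> show False by simp
  qed
qed

lemma sum_nb_swap:
  assumes "finite A" "finite B"
  shows "(\<Sum>a\<in>A. card (nb E B a)) = (\<Sum>b\<in>B. card (nb E A b))"
proof -
  have c: "card (nb E B' a) = (\<Sum>b\<in>B'. if b \<noteq> a \<and> {a, b} \<in> E then 1 else 0)" if "finite B'" for a B'
    using that by (simp add: nb_def sum.If_cases Int_def)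
  show ?thesis
    using assms by (simp add: c, subst sum.swap) (auto simp: insert_commute intro!: sum.cong)
qed

lemma vol_Un:
  assumes "finite Y" "finite R" "Y \<inter> R = {}"
  shows "vol E (Y \<union> R) = vol E Y + 2 * (\<Sum>r\<in>R. card (nb E Y r)) + vol E R"
  using assms sum_nb_swap[of Y R E]
  by (simp add: vol_def sum.union_disjoint card_nb_disjoint_Un sum.distrib)

text \<open>At most 6 vertices are \<open>a\<close>, \<open>b\<close> or their neighbours, so with 7
  vertices some \<open>x\<close> is none of these, and \<open>D\<close> is \<open>x\<close> with its
  two neighbours. Three vertices and at most four edges are lost, so that a detour between
  \<open>a\<close> and \<open>b\<close> with at most two inner vertices creates a core smaller than
  \<open>Y\<close>.\<close>

lemma remove_three:
  assumes "core E Y" "\<And>y. y \<in> Y \<Longrightarrow> card (nb E Y y) = 2" "7 \<le> card Y" "a \<in> Y" "b \<in> Y"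
  shows "\<exists>D\<subseteq>Y. a \<notin> D \<and> b \<notin> D \<and> card D = 3 \<and> 2 * card Y \<le> vol E (Y - D) + 8"
proof -
  have fin: "finite Y" using assms coreD by blast
  let ?bad = "{a, b} \<union> nb E Y a \<union> nb E Y b"
  have "card ?bad \<le> card {a, b} + card (nb E Y a) + card (nb E Y b)"
    by (meson add_le_mono1 card_Un_le le_trans)
  also have "\<dots> \<le> 6" using assms(2,4,5) card_insert_le_m1[of 2 "{b}" a] by simp
  finally have "card ?bad < card Y" using assms(3) by simp
  then have "\<not> Y \<subseteq> ?bad" using fin by (metis card_mono finite.insertI finite.emptyI finite_UnI
      finite_nb not_less)
  then obtain x where x: "x \<in> Y" "x \<notin> ?bad" by blast
  obtain x1 x2 where nbx: "nb E Y x = {x1, x2}" "x1 \<noteq> x2"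
    using assms(2)[OF x(1)] by (auto simp: card_2_iff)
  then have x12: "x1 \<in> Y" "x2 \<in> Y" "x1 \<noteq> x" "x2 \<noteq> x" "{x, x1} \<in> E" "{x, x2} \<in> E" by (auto simp: nb_def)
  have ab: "x1 \<noteq> a" "x1 \<noteq> b" "x2 \<noteq> a" "x2 \<noteq> b"
    using x x12 by (auto simp: nb_def insert_commute)
  have one: "card (nb E Z w) \<le> 1" if "Z \<subseteq> Y - {x}" "w \<in> {x1, x2}" for w Z
  proof -
    have "nb E Z w \<subseteq> nb E Y w - {x}" using that by (auto simp: nb_def)
    then have "card (nb E Z w) \<le> card (nb E Y w - {x})" using fin by (intro card_mono) auto
    also have "\<dots> = 1" using that x x12 assms(2)[of w] fin by (subst card_Diff_singleton) (auto simp: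
        nb_def insert_commute)
    finally show ?thesis .
  qed
  let ?D = "{x, x1, x2}"
  have "vol E Y = vol E (Y - {x}) + 2 * 2" using vol_remove[OF fin x(1), of E] assms(2)[OF x(1)] by simp
  moreover have "vol E (Y - {x}) \<le> vol E (Y - {x} - {x1}) + 2 * 1"
    using vol_remove[of "Y - {x}" x1 E] fin x12 one[of "Y - {x}" x1] by simp
  moreover have "vol E (Y - {x} - {x1}) \<le> vol E (Y - {x} - {x1} - {x2}) + 2 * 1"
    using vol_remove[of "Y - {x} - {x1}" x2 E] fin x12 nbx one[of "Y - {x} - {x1}" x2] by auto
  moreover have "Y - {x} - {x1} - {x2} = Y - ?D" by auto
  moreover have "2 * card Y \<le> vol E Y" using assms(1) by (rule vol_core)
  ultimately have "2 * card Y \<le> vol E (Y - ?D) + 8" by simp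
  then show ?thesis using x x12 ab nbx by (intro exI[of _ ?D]) auto
qed

text \<open>A shortest cycle \<open>Y\<close> of length at least 7 has no ears with at most two inner vertices, so its
  neighbours form an independent set and each of them sends at least two edges away from \<open>Y\<close>.\<close>

lemma shortest_core_vol:
  assumes fin: "finite X" and deg: "\<And>x. x \<in> X \<Longrightarrow> 3 \<le> card (nb E X x)" "\<And>x. x \<in> X \<Longrightarrow> card (nb E X x) \<le> 4"
    and Y: "Y \<subseteq> X" "core E Y" and short: "\<And>Z. Z \<subseteq> X \<Longrightarrow> core E Z \<Longrightarrow> card Y \<le> card Z"
    and g: "7 \<le> card Y"
  shows "vol E X + 10 * card (X - Y) \<le> 5 * vol E (X - Y) + 2 * card X"
proof -
  have finY: "finite Y" using Y coreD by blast
  have degY: "card (nb E Y y) = 2" if "y \<in> Y" for y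
  proof (rule min_core_degree[OF Y(2) _ that])
    fix W assume "W \<subset> Y"
    then have "card W < card Y" using finY by (simp add: psubset_card_mono)
    then show "\<not> core E W" using short[of W] \<open>W \<subset> Y\<close> Y(1) by auto
  qed
  define R where "R = X - Y"
  define N where "N = {r \<in> R. nb E Y r \<noteq> {}}"
  have finR: "finite R" "finite N" using fin by (auto simp: R_def N_def)
  have no_core: "vol E Z < 2 * card Z" if Z: "Z \<subseteq> X" "Z \<noteq> {}" "card Z < card Y" for Z
  proof (rule ccontr)
    assume "\<not> vol E Z < 2 * card Z"
    then obtain W where W: "W \<subseteq> Z" "core E W"
      using core_of_vol[of Z E] Z(1,2) fin finite_subset by (metis not_less)
    then have "card W \<le> card Z" using Z(1) fin by (meson card_mono finite_subset)
    then show False using short[of W] W Z by auto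
  qed
  \<comment> \<open>Two neighbours on \<open>Y\<close> would make \<open>r\<close> an ear with one
    inner vertex, replacing three vertices of \<open>Y\<close>.\<close>
  have le1: "card (nb E Y r) \<le> 1" if r: "r \<in> R" for r
  proof (rule ccontr)
    assume "\<not> card (nb E Y r) \<le> 1"
    then obtain a b where ab: "a \<in> nb E Y r" "b \<in> nb E Y r" "a \<noteq> b"
      by (metis One_nat_def card_le_Suc0_iff_eq finY finite_nb)
    then obtain D where D: "D \<subseteq> Y" "a \<notin> D" "b \<notin> D" "card D = 3" "2 * card Y \<le> vol E (Y - D) + 8"
      using remove_three[OF Y(2) degY g, of a b] by (auto simp: nb_def)
    let ?Z = "insert r (Y - D)"
    have "card {a, b} \<le> card (nb E (Y - D) r)"
      using ab D finY by (intro card_mono) (auto simp: nb_def)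
    then have "vol E ?Z \<ge> vol E (Y - D) + 4"
      using vol_insert[of "Y - D" r E] finY r ab(3) by (simp add: R_def)
    moreover have "card ?Z = card Y - 2"
      using r D finY g card_Diff_subset[of D Y] finite_subset[OF D(1) finY] by (simp add: R_def)
    moreover have "?Z \<subseteq> X" using r Y(1) by (auto simp: R_def)
    ultimately show False using no_core[of ?Z] D(5) g by simp
  qed
  \<comment> \<open>An edge inside \<open>N\<close> would give an ear with two inner vertices, still
    one vertex shorter than what it replaces.\<close>
  have indep: "{r, s} \<notin> E" if rs: "r \<in> N" "s \<in> N" "r \<noteq> s" for r s
  proof
    assume e: "{r, s} \<in> E"
    obtain a b where ab: "a \<in> nb E Y r" "b \<in> nb E Y s" using rs by (auto simp: N_def)
    then obtain D where D: "D \<subseteq> Y" "a \<notin> D" "b \<notin> D" "card D = 3" "2 * card Y \<le> vol E (Y - D) + 8"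
      using remove_three[OF Y(2) degY g, of a b] by (auto simp: nb_def)
    have rsY: "r \<notin> Y" "s \<notin> Y" "r \<in> X" "s \<in> X" using rs by (auto simp: N_def R_def)
    let ?Z = "insert s (insert r (Y - D))"
    have "card {a} \<le> card (nb E (Y - D) r)"
      using ab D finY by (intro card_mono) (auto simp: nb_def)
    moreover have "vol E (insert r (Y - D)) = vol E (Y - D) + 2 * card (nb E (Y - D) r)"
      using finY rsY by (intro vol_insert) auto
    moreover have "card {r, b} \<le> card (nb E (insert r (Y - D)) s)"
      using ab D finY e rs by (intro card_mono) (auto simp: nb_def insert_commute)
    moreover have "card {r, b} = 2" using ab rsY by (auto simp: nb_def card_insert_if)
    moreover have "vol E ?Z = vol E (insert r (Y - D)) + 2 * card (nb E (insert r (Y - D)) s)"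
      using finY rsY rs by (intro vol_insert) auto
    ultimately have "vol E ?Z \<ge> vol E (Y - D) + 6" by simp
    moreover have "card ?Z = card Y - 1"
      using rsY rs D finY g card_Diff_subset[of D Y] finite_subset[OF D(1) finY] by simp
    moreover have "?Z \<subseteq> X" using rsY Y(1) by auto
    ultimately show False using no_core[of ?Z] D(5) g by simp
  qed
  define S where "S = R - N"
  have RNS: "R = N \<union> S" "N \<inter> S = {}" "finite S" using finR by (auto simp: S_def N_def)
  have XYR: "X = Y \<union> R" "Y \<inter> R = {}" using Y by (auto simp: R_def)
  have degR: "card (nb E X r) = card (nb E Y r) + card (nb E R r)" for r
    using card_nb_disjoint_Un[of Y R E r] finY finR XYR by simp
  have nbN: "card (nb E Y r) = (if r \<in> N then 1 else 0)" if "r \<in> R" for r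
    using le1[OF that] that finY
    by (auto simp: N_def le_Suc_eq card_eq_0_iff)
  have nu: "(\<Sum>r\<in>R. card (nb E Y r)) = card N"
    using finR nbN by (simp add: sum.If_cases N_def Int_def)
  \<comment> \<open>Double counting between \<open>N\<close> and \<open>S\<close>: of the at least 3
    neighbours of a vertex of \<open>N\<close> at most one lies in \<open>Y\<close> and none in
    \<open>N\<close>, and a vertex of \<open>S\<close> has at most 4 neighbours.\<close>
  have "2 * card N = (\<Sum>r\<in>N. 2)" by simp
  also have "\<dots> \<le> (\<Sum>r\<in>N. card (nb E S r))"
  proof (rule sum_mono)
    fix r assume r: "r \<in> N"
    then have "r \<in> R" by (simp add: N_def)
    have "nb E N r = {}" using indep[OF r] by (auto simp: nb_def)
    then have "card (nb E R r) = card (nb E S r)" using card_nb_disjoint_Un[of N S E r] RNS finR by simp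
    then show "2 \<le> card (nb E S r)" using deg(1)[of r] degR[of r] le1[OF \<open>r \<in> R\<close>] \<open>r \<in> R\<close> by (simp add: R_def)
  qed
  also have "\<dots> = (\<Sum>s\<in>S. card (nb E N s))" using RNS finR by (intro sum_nb_swap) auto
  also have "\<dots> \<le> (\<Sum>s\<in>S. 4)"
  proof (rule sum_mono)
    fix s assume "s \<in> S"
    then have "s \<in> X" by (auto simp: S_def R_def)
    moreover have "card (nb E N s) \<le> card (nb E X s)" using fin by (intro card_nb_mono) (auto simp: N_def R_def)
    ultimately show "card (nb E N s) \<le> 4" using deg(2)[of s] by simp
  qed
  finally have NS: "card N \<le> 2 * card S" by simp
  have "3 * card R = (\<Sum>r\<in>R. 3)" by simp
  also have "\<dots> \<le> (\<Sum>r\<in>R. card (nb E Y r) + card (nb E R r))"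
    using deg(1) degR by (intro sum_mono) (auto simp: R_def)
  also have "\<dots> = card N + vol E R" using nu by (simp add: sum.distrib vol_def)
  finally have volR: "3 * card R \<le> card N + vol E R" .
  \<comment> \<open>Let s = \<open>vol E R\<close> - 2 * \<open>card R\<close>. Then s \<ge>
    \<open>card S\<close> and 2 * \<open>card S\<close> \<ge> \<open>card N\<close>, so the surplus
    of \<open>X\<close>, which is 2 * \<open>card N\<close> + s, is at most 5 * s.\<close>
  have "card R = card N + card S" using RNS finR by (simp add: card_Un_disjoint)
  moreover have "vol E X = vol E Y + 2 * card N + vol E R"
    using vol_Un[of Y R E] finY finR XYR nu by simp
  moreover have "vol E Y = 2 * card Y" using degY by (simp add: vol_def)
  moreover have "card X = card Y + card R" using XYR finY finR by (simp add: card_Un_disjoint)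
  ultimately show ?thesis using volR NS by (simp add: R_def)
qed

text \<open>Deleting a cycle with at most 6 vertices from a graph with maximum degree 4 lowers
  \<open>vol E X - 2 * card X\<close> by at most 36, and deleting a longer shortest cycle leaves at least a fifth
  of it.\<close>

fun surplus :: "nat \<Rightarrow> nat" where
  "surplus 0 = 0"
| "surplus (Suc k) = 5 * surplus k + 36"

lemma pack_remove_core:
  assumes "core E Y" "Y \<subseteq> X" "pack E (X - Y) k"
  shows "pack E X (Suc k)"
proof -
  have "pack E ((X - Y) \<union> Y) (Suc k)" using assms by (intro pack_Suc) auto
  moreover have "(X - Y) \<union> Y = X" using assms(2) by auto
  ultimately show ?thesis by simp
qed

text \<open>Undoes the suppression of the degree-2 vertex \<open>v\<close>: in the map
  \<open>h\<close> a neighbour reached over the new edge between \<open>a\<close> and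
  \<open>b\<close> is replaced by \<open>v\<close>.\<close>

lemma core_suppress:
  assumes "core (insert {a, b} E) C" "C \<subseteq> X - {v}" "nb E X v = {a, b}" "a \<noteq> b" "v \<in> X" "a \<in> C" "b \<in>
      C" "finite C"
  shows "core E (insert v C)"
proof (rule coreI)
  fix y assume "y \<in> insert v C"
  have v: "{v, a} \<in> E" "{v, b} \<in> E" "a \<noteq> v" "b \<noteq> v" using assms(3) by (auto simp: nb_def)
  show "\<exists>p q. p \<in> insert v C \<and> q \<in> insert v C \<and> p \<noteq> q \<and> p \<noteq> y \<and> q \<noteq> y \<and> {y, p} \<in> E \<and> {y, q} \<in> E"
  proof (cases "y = v")
    case True
    then show ?thesis using v assms by (intro exI[of _ a] exI[of _ b]) auto
  next
    case False
    then have y: "y \<in> C" using \<open>y \<in> insert v C\<close> by simp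
    then have "2 \<le> card (nb (insert {a, b} E) C y)" using assms(1) by (simp add: core_def)
    then obtain p q where pq: "p \<in> nb (insert {a, b} E) C y" "q \<in> nb (insert {a, b} E) C y" "p \<noteq> q"
      by (metis assms(8) card_le_Suc0_iff_eq finite_nb not_less_eq_eq numeral_2_eq_2)
    have vC: "v \<notin> C" using assms(2) by auto
    define h where "h z = (if {y, z} = {a, b} then v else z)" for z
    have h: "h z \<in> insert v C \<and> h z \<noteq> y \<and> {y, h z} \<in> E" if "z \<in> nb (insert {a, b} E) C y" for z
      using that y vC v by (auto simp: h_def nb_def doubleton_eq_iff insert_commute)
    moreover have "h p \<noteq> h q"
      using pq vC by (auto simp: h_def nb_def doubleton_eq_iff)
    ultimately show ?thesis using pq by blast
  qed
qed (use assms in auto)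

text \<open>Deleting a vertex of degree at most 1 or suppressing one of degree 2 does not lower the
  surplus and does not raise degrees. Once all degrees are at least 3, a shortest core is removed
  and the induction on \<open>k\<close> applies.\<close>

lemma pack_of_surplus:
  assumes "finite X" "\<And>x. x \<in> X \<Longrightarrow> card (nb E X x) \<le> 4" "2 * card X + surplus k \<le> vol E X"
  shows "pack E X k"
  using assms
proof (induction k arbitrary: E X)
  case 0
  then show ?case by simp
next
  case (Suc k)
  show ?case using Suc.prems
  proof (induction "card X" arbitrary: E X rule: less_induct)
    case less
    note fin = less.prems(1) and deg4 = less.prems(2) and vol = less.prems(3)
    have "vol E X > 0" using vol by simp
    then have ne: "X \<noteq> {}" by (auto simp: vol_def)
    have sub_deg: "card (nb E X' x) \<le> 4" if "X' \<subseteq> X" "x \<in> X'" for X' x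
      using card_nb_mono[OF fin that(1) order_refl, of E x] deg4[of x] that by auto
    have rem: "pack E X (Suc k)" if Y: "core E Y" "Y \<subseteq> X" and v: "2 * card (X - Y) + surplus k \<le> vol
        E (X - Y)" for Y
      using Suc.IH[of "X - Y" E] fin sub_deg[of "X - Y"] v Y by (intro pack_remove_core[of E Y]) auto
    have small: "pack E X (Suc k)" if Y: "core E Y" "Y \<subseteq> X" "card Y \<le> 6" for Y
    proof (rule rem[OF Y(1,2)])
      have "(\<Sum>t\<in>Y. card (nb E X t)) \<le> (\<Sum>t\<in>Y. 4)" using Y deg4 by (intro sum_mono) auto
      \<comment> \<open>A deleted vertex costs at most 8 in volume and gives back 2 in the term 2 *
        \<open>card X\<close>; six of them cost the 36 of \<open>surplus\<close>.\<close>
      then have "vol E X \<le> vol E (X - Y) + 8 * card Y" using vol_diff[OF fin Y(2), of E] by simp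
      moreover have "card X = card (X - Y) + card Y"
        using Y fin by (metis card_Diff_subset card_mono coreD(1) le_add_diff_inverse2)
      ultimately show "2 * card (X - Y) + surplus k \<le> vol E (X - Y)" using vol Y(3) by simp
    qed
    consider (low) x where "x \<in> X" "card (nb E X x) \<le> 1" | (two) v where "v \<in> X" "card (nb E X v) = 2"
      | (high) "\<And>x. x \<in> X \<Longrightarrow> 3 \<le> card (nb E X x)"
    proof (cases "\<forall>x\<in>X. 3 \<le> card (nb E X x)")
      case False
      then obtain x where "x \<in> X" "card (nb E X x) \<le> 1 \<or> card (nb E X x) = 2" by force
      then show ?thesis using low two by blast
    qed (use high in blast)
    then show ?case
    proof cases
      case low
      have "vol E X = vol E (X - {x}) + 2 * card (nb E X x)" using fin low by (intro vol_remove)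
      moreover have "card X = Suc (card (X - {x}))" using fin low by (metis card.remove)
      ultimately have "pack E (X - {x}) (Suc k)"
        using low vol fin sub_deg[of "X - {x}"] by (intro less.hyps) auto
      then show ?thesis by (rule pack_mono) auto
    next
      case two
      then obtain a b where nbv: "nb E X v = {a, b}" "a \<noteq> b" by (auto simp: card_2_iff)
      then have ab: "a \<in> X" "b \<in> X" "a \<noteq> v" "b \<noteq> v" "{v, a} \<in> E" "{v, b} \<in> E" by (auto simp: nb_def)
      have cardX: "card X = Suc (card (X - {v}))" using fin two by (metis card.remove)
      show ?thesis
      proof (cases "{a, b} \<in> E")
        case True
        have "core E {v, a, b}" using True ab nbv by (intro core_triangle) auto
        moreover have "card {v, a, b} \<le> 6" by (simp add: card_insert_if)
        ultimately show ?thesis using ab two by (intro small[of "{v, a, b}"]) auto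
      next
        case False
        let ?E = "insert {a, b} E" and ?X = "X - {v}"
        have other: "nb ?E ?X x = nb E X x" if "x \<in> ?X" "x \<noteq> a" "x \<noteq> b" for x
        proof -
          have "x \<notin> nb E X v" using that nbv by auto
          then have "{x, v} \<notin> E" using that by (auto simp: nb_def insert_commute)
          then show ?thesis using that by (auto simp: nb_def doubleton_eq_iff)
        qed
        have nba: "nb ?E ?X a = insert b (nb E X a - {v})" using ab nbv by (auto simp: nb_def doubleton_eq_iff)
        have nbb: "nb ?E ?X b = insert a (nb E X b - {v})" using ab nbv by (auto simp: nb_def
            doubleton_eq_iff insert_commute)
        have "b \<notin> nb E X a" "a \<notin> nb E X b" "v \<in> nb E X a" "v \<in> nb E X b"
          using False ab two by (auto simp: nb_def insert_commute)
        then have "card (nb ?E ?X a) = card (nb E X a)" "card (nb ?E ?X b) = card (nb E X b)"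
          using fin unfolding nba nbb by (simp_all add: card_Suc_Diff1 del: card_Diff_insert
              card_Diff_singleton)
        with other have same: "card (nb ?E ?X x) = card (nb E X x)" if "x \<in> ?X" for x using that by metis
        then have "vol ?E ?X = (\<Sum>x\<in>?X. card (nb E X x))" by (simp add: vol_def)
        then have "vol E X = vol ?E ?X + 2" using two fin by (simp add: vol_def sum.remove)
        then have "pack ?E ?X (Suc k)"
          using vol cardX fin same deg4 by (intro less.hyps) auto
        then obtain C where C: "\<And>i. i < Suc k \<Longrightarrow> C i \<subseteq> ?X" "\<And>i. i < Suc k \<Longrightarrow> core ?E (C i)"
          "\<And>i j. i < Suc k \<Longrightarrow> j < Suc k \<Longrightarrow> i \<noteq> j \<Longrightarrow> C i \<inter> C j = {}"
          by - (rule packE, assumption, rule that)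
        \<comment> \<open>Only a core containing both \<open>a\<close> and \<open>b\<close> can use
          the new edge. Disjointness allows at most one such core, so \<open>v\<close> is put back
          at most once.\<close>
        define C' where "C' i = (if a \<in> C i \<and> b \<in> C i then insert v (C i) else C i)" for i
        show ?thesis
        proof (rule packI[of _ C'])
          fix i assume i: "i < Suc k"
          show "C' i \<subseteq> X" using C(1)[OF i] two by (auto simp: C'_def)
          show "core E (C' i)"
          proof (cases "a \<in> C i \<and> b \<in> C i")
            case True
            then show ?thesis using C(1,2)[OF i] coreD(1)[OF C(2)[OF i]] nbv two
              by (auto simp: C'_def intro!: core_suppress[of a b E _ X])
          next
            case False
            then have "nb ?E (C i) y = nb E (C i) y" if "y \<in> C i" for y
              using that by (auto simp: nb_def doubleton_eq_iff)
            then show ?thesis using C(2)[OF i] False by (simp add: C'_def core_def if_not_P)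
          qed
        next
          fix i j assume ij: "i < Suc k" "j < Suc k" "i \<noteq> j"
          then have "C i \<inter> C j = {}" "v \<notin> C i" "v \<notin> C j" using C(1)[of i] C(1)[of j] C(3) by auto
          then show "C' i \<inter> C' j = {}" by (auto simp: C'_def)
        qed
      qed
    next
      case high
      have "core E X" using fin ne high by (force simp: core_def)
      then have "\<exists>Y. Y \<subseteq> X \<and> core E Y" by blast
      then obtain Y where Y: "Y \<subseteq> X" "core E Y" "\<And>Z. Z \<subseteq> X \<and> core E Z \<Longrightarrow> card Y \<le> card Z"
        using ex_has_least_nat[of "\<lambda>Y. Y \<subseteq> X \<and> core E Y" _ card] by metis
      show ?thesis
      proof (cases "card Y \<le> 6")
        case True
        then show ?thesis using small Y by blast
      next
        case False
        have "vol E X + 10 * card (X - Y) \<le> 5 * vol E (X - Y) + 2 * card X"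
          using fin high deg4 Y False by (intro shortest_core_vol) auto
        then show ?thesis using vol by (intro rem[OF Y(2,1)]) simp
      qed
    qed
  qed
qed

section \<open>Blockers\<close>

text \<open>Simonovits' argument. In a maximal subgraph \<open>H\<close> with all degrees in \<open>{0, 2, 3, 4}\<close> few vertices
  have degree at least 3, and by maximality every cycle avoiding them is a component of \<open>H\<close>.\<close>

theorem Erdos_Posa:
  assumes fin: "finite V" and np: "\<not> pack E V (Suc k)"
  shows "\<exists>Q\<subseteq>V. card Q \<le> surplus (Suc k) + k \<and> acyc E (V - Q)"
proof -
  define P where "P H \<longleftrightarrow> H \<subseteq> {e \<in> E. e \<subseteq> V} \<and>
    (\<forall>x\<in>V. card (nb H V x) \<le> 4 \<and> card (nb H V x) \<noteq> 1)" for H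
  have "finite {H. P H}"
    by (rule finite_subset[of _ "Pow (Pow V)"]) (use fin in \<open>auto simp: P_def\<close>)
  moreover have "P {}" by (simp add: P_def nb_def)
  ultimately obtain H where H: "P H" "\<And>H'. P H' \<Longrightarrow> H \<subseteq> H' \<Longrightarrow> H' = H"
    using finite_has_maximal[of "{H. P H}"] by (metis empty_iff mem_Collect_eq)
  have HE: "H \<subseteq> E" using H(1) by (auto simp: P_def)
  have deg: "card (nb H V x) \<le> 4" "card (nb H V x) \<noteq> 1" if "x \<in> V" for x
    using H(1) that by (auto simp: P_def)
  define U where "U = {x \<in> V. 3 \<le> card (nb H V x)}"
  define VH where "VH = {x \<in> V. 2 \<le> card (nb H V x)}"
  have finU: "finite U" "finite VH" "U \<subseteq> VH" "U \<subseteq> V" "VH \<subseteq> V" using fin by (auto simp: U_def VH_def)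
  have nbVH: "nb H VH x = nb H V x" if "x \<in> VH" for x
  proof
    show "nb H V x \<subseteq> nb H VH x"
    proof
      fix y assume y: "y \<in> nb H V x"
      then have "y \<in> V" "x \<in> nb H V y" using that finU by (auto simp: nb_def insert_commute)
      then have "card (nb H V y) \<noteq> 0" using fin by auto
      then have "2 \<le> card (nb H V y)" using deg[OF \<open>y \<in> V\<close>] by linarith
      then show "y \<in> nb H VH x" using y by (auto simp: nb_def VH_def)
    qed
  qed (use finU in \<open>auto simp: nb_def\<close>)
  \<comment> \<open>Each vertex of \<open>U\<close> exceeds degree 2 and so adds at least 1 to the
    surplus of \<open>H\<close> on its non-isolated vertices \<open>VH\<close>.\<close>
  have "2 * card VH + card U = (\<Sum>x\<in>VH. 2) + (\<Sum>x\<in>VH. if x \<in> U then 1 else 0)"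
    using finU by (simp add: sum.If_cases Int_absorb1)
  also have "\<dots> = (\<Sum>x\<in>VH. 2 + (if x \<in> U then 1 else 0))" by (rule sum.distrib[symmetric])
  also have "\<dots> \<le> vol H VH"
    unfolding vol_def
  proof (rule sum_mono)
    fix x assume "x \<in> VH"
    then show "2 + (if x \<in> U then 1 else 0) \<le> card (nb H VH x)"
      unfolding nbVH[OF \<open>x \<in> VH\<close>] by (simp add: U_def VH_def)
  qed
  finally have volH: "2 * card VH + card U \<le> vol H VH" .
  have "card U < surplus (Suc k)"
  proof (rule ccontr)
    assume "\<not> card U < surplus (Suc k)"
    moreover have "card (nb H VH x) \<le> 4" if "x \<in> VH" for x
      unfolding nbVH[OF that] using that finU by (intro deg(1)) blast
    moreover have "2 * card VH + surplus (Suc k) \<le> vol H VH"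
      using volH calculation(1) by linarith
    ultimately have "pack H VH (Suc k)"
      using finU(2) pack_of_surplus by blast
    then have "pack E V (Suc k)" using HE finU(5) by (rule pack_mono)
    with np show False by contradiction
  qed
  \<comment> \<open>Off \<open>U\<close> the \<open>H\<close>-degree is at most 2, and a core
    already uses two edges at each vertex. A core of \<open>H\<close> avoiding \<open>U\<close> is
    thus a union of components of \<open>H\<close>.\<close>
  have closed: "nb H Z z = nb H V z" if Z: "core H Z" "Z \<subseteq> V - U" "z \<in> Z" for Z z
  proof (rule card_seteq)
    show "nb H Z z \<subseteq> nb H V z" using Z by (intro nb_mono) auto
    have "z \<in> V" "z \<notin> U" using Z by auto
    then have "card (nb H V z) \<le> 2" by (simp add: U_def)
    also have "\<dots> \<le> card (nb H Z z)" using coreD(3) Z by metis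
    finally show "card (nb H V z) \<le> card (nb H Z z)" .
  qed (use fin in simp)
  \<comment> \<open>Adding the edges of \<open>E\<close> inside \<open>Z\<close> raises
    \<open>H\<close>-degrees that are at most 2 by at most 2, so the result is still admissible and
    maximality of \<open>H\<close> means that nothing was added.\<close>
  have inH: "core H Z" if Z: "core E Z" "Z \<subseteq> V - U" "\<And>W. W \<subset> Z \<Longrightarrow> \<not> core E W" for Z
  proof -
    define H' where "H' = H \<union> {e \<in> E. e \<subseteq> Z}"
    have out: "nb H' V x = nb H V x" if "x \<notin> Z" for x
      using that by (auto simp: H'_def nb_def)
    have in_Z: "2 \<le> card (nb H' V x) \<and> card (nb H' V x) \<le> 4" if "x \<in> Z" for x
    proof -
      have "nb H' V x = nb H V x \<union> nb E Z x"
        using that Z(2) by (auto simp: H'_def nb_def)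
      moreover have "card (nb E Z x) = 2" using min_core_degree[OF Z(1,3) that] .
      moreover have "card (nb H V x \<union> nb E Z x) \<le> card (nb H V x) + card (nb E Z x)"
        by (rule card_Un_le)
      moreover have "card (nb E Z x) \<le> card (nb H V x \<union> nb E Z x)"
        using fin coreD(1)[OF Z(1)] by (intro card_mono) auto
      moreover have "x \<in> V" "x \<notin> U" using that Z by auto
      then have "card (nb H V x) \<le> 2" by (simp add: U_def)
      ultimately show ?thesis by simp
    qed
    have "card (nb H' V x) \<le> 4 \<and> card (nb H' V x) \<noteq> 1" if "x \<in> V" for x
      using deg[OF that] in_Z[of x] out[of x] by (cases "x \<in> Z") simp_all
    moreover have "H' \<subseteq> {e \<in> E. e \<subseteq> V}" using H(1) Z by (auto simp: P_def H'_def)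
    ultimately have "P H'" by (simp add: P_def)
    then have "H' = H" using H(2) by (simp add: H'_def)
    then have "{e \<in> E. e \<subseteq> Z} \<subseteq> H" by (auto simp: H'_def)
    then have "nb E Z z \<subseteq> nb H Z z" if "z \<in> Z" for z using that by (auto simp: nb_def)
    then have "card (nb E Z z) \<le> card (nb H Z z)" if "z \<in> Z" for z
      using that coreD(1)[OF Z(1)] by (intro card_mono) auto
    then show ?thesis using Z(1) unfolding core_def by (meson le_trans)
  qed
  have "pack H (V - U) 0" by simp
  moreover have "\<forall>m. pack H (V - U) m \<longrightarrow> m \<le> k"
  proof (intro allI impI, rule ccontr)
    fix m assume "pack H (V - U) m" "\<not> m \<le> k"
    then have "pack H (V - U) (Suc k)" using pack_le[of H "V - U" m "Suc k"] by simp
    then have "pack E V (Suc k)" using pack_mono[OF _ HE, of "V - U" "Suc k" V] by simp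
    with np show False by contradiction
  qed
  ultimately obtain m where m: "pack H (V - U) m" "\<And>m'. pack H (V - U) m' \<Longrightarrow> m' \<le> m" "m \<le> k"
    using Nat.ex_has_greatest_nat[of "pack H (V - U)" 0 k] by blast
  obtain C where C: "\<And>i. i < m \<Longrightarrow> C i \<subseteq> V - U" "\<And>i. i < m \<Longrightarrow> core H (C i)"
    "\<And>i j. i < m \<Longrightarrow> j < m \<Longrightarrow> i \<noteq> j \<Longrightarrow> C i \<inter> C j = {}"
    by (rule packE[OF m(1)], rule that)
  define z where "z i = (SOME z. z \<in> C i)" for i
  have z: "z i \<in> C i" if "i < m" for i
    using coreD(2)[OF C(2)[OF that]] by (simp add: z_def some_in_eq)
  define Q where "Q = U \<union> z ` {..<m}"
  have "card Q \<le> surplus (Suc k) + k"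
  proof -
    have "card Q \<le> card U + card (z ` {..<m})" unfolding Q_def by (rule card_Un_le)
    moreover have "card (z ` {..<m}) \<le> m" using card_image_le[of "{..<m}" z] by simp
    ultimately show ?thesis using \<open>card U < surplus (Suc k)\<close> m(3) by linarith
  qed
  moreover have "z i \<in> V" if "i < m" for i using C(1)[OF that] z[OF that] by auto
  then have "Q \<subseteq> V" using finU(4) by (auto simp: Q_def)
  moreover have "acyc E (V - Q)"
    unfolding acyc_def
  proof (intro allI impI notI)
    fix Y assume Y: "Y \<subseteq> V - Q" "core E Y"
    from exists_min_core[OF Y(2)] obtain Z where "Z \<subseteq> Y" "core E Z" "\<forall>W. W \<subset> Z \<longrightarrow> \<not> core E W"
      by (elim exE conjE)
    with Y(1) have Z: "Z \<subseteq> V - Q" "core E Z" "\<And>W. W \<subset> Z \<Longrightarrow> \<not> core E W"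
      by simp_all
    have ZU: "Z \<subseteq> V - U" using Z(1) by (auto simp: Q_def)
    have HZ: "core H Z" using inH[OF Z(2) ZU Z(3)] .
    have "pack H (V - U) (Suc m)"
    proof (cases "\<exists>i<m. Z \<inter> C i \<noteq> {}")
      case False
      show ?thesis
      proof (rule packI[of _ "C(m := Z)"])
        fix i assume "i < Suc m"
        then show "(C(m := Z)) i \<subseteq> V - U" "core H ((C(m := Z)) i)"
          using C(1,2)[of i] ZU HZ by (auto simp: less_Suc_eq)
      next
        fix i j assume "i < Suc m" "j < Suc m" "i \<noteq> j"
        then show "(C(m := Z)) i \<inter> (C(m := Z)) j = {}"
          using C(3)[of i j] False by (auto simp: less_Suc_eq)
      qed
    next
      case True
      \<comment> \<open>\<open>Z\<close> and \<open>C i\<close> are both closed in \<open>H\<close>.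
        As \<open>z i\<close> lies outside \<open>Z\<close>, the core \<open>C i\<close> splits into
        two cores, contradicting the maximality of \<open>m\<close>.\<close>
      then obtain i where i: "i < m" "Z \<inter> C i \<noteq> {}" by blast
      have nbi: "nb H V y \<subseteq> C i" if "y \<in> C i" for y
        using closed[OF C(2,1)[OF i(1)] that] nb_subset by metis
      have nbZ: "nb H V y \<subseteq> Z" if "y \<in> Z" for y
        using closed[OF HZ ZU that] nb_subset by metis
      have two: "2 \<le> card (nb H V y)" if "y \<in> C i" for y
        using closed[OF C(2,1)[OF i(1)] that] coreD(3)[OF C(2)[OF i(1)] that] by simp
      have VC: "C i \<subseteq> V" using C(1)[OF i(1)] by auto
      have *: "core H A" if A: "A \<subseteq> C i" "A \<noteq> {}" "\<And>y. y \<in> A \<Longrightarrow> nb H V y \<subseteq> A" for A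
      proof -
        have "nb H A y = nb H V y" if "y \<in> A" for y
          using A(3)[OF that] A(1) VC by (auto simp: nb_def)
        then show ?thesis
          using A two VC fin finite_subset unfolding core_def by (metis subset_iff)
      qed
      have c1: "core H (Z \<inter> C i)" using nbi nbZ i by (intro *) blast+
      have c2: "core H (C i - Z)"
      proof (rule *)
        show "C i - Z \<noteq> {}" using z[OF i(1)] Z(1) i(1) by (auto simp: Q_def)
        fix y assume y: "y \<in> C i - Z"
        show "nb H V y \<subseteq> C i - Z"
        proof
          fix w assume w: "w \<in> nb H V y"
          have "w \<notin> Z"
          proof
            assume "w \<in> Z"
            moreover have "y \<in> nb H V w" using w y VC by (auto simp: nb_def insert_commute)
            ultimately show False using nbZ[of w] y by auto
          qed
          then show "w \<in> C i - Z" using nbi[of y] y w by auto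
        qed
      qed auto
      define C' where "C' j = (if j = i then C i - Z else if j = m then Z \<inter> C i else C j)" for j
      show ?thesis
      proof (rule packI[of _ C'])
        fix j assume "j < Suc m"
        then show "C' j \<subseteq> V - U" "core H (C' j)"
          using C(1)[of j] C(2)[of j] ZU c1 c2 i(1) by (auto simp: C'_def less_Suc_eq)
      next
        fix j l assume "j < Suc m" "l < Suc m" "j \<noteq> l"
        then show "C' j \<inter> C' l = {}"
          using C(3)[of j l] C(3)[of i l] C(3)[of j i] i(1) by (auto simp: C'_def less_Suc_eq)
      qed
    qed
    then show False using m(2)[of "Suc m"] by simp
  qed
  ultimately show ?thesis by blast
qed

section \<open>Rooted forests, and the split into major and minor blocker vertices\<close>

text \<open>\<open>f\<close> is the parent map, with \<open>None\<close> at roots. The injective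
  rank \<open>rk\<close>, smaller at parents, excludes directed cycles and orders all of
  \<open>F\<close> linearly, so that an extremal vertex can be chosen later.\<close>

definition rooted :: "'a set set \<Rightarrow> 'a set \<Rightarrow> ('a \<Rightarrow> 'a option) \<Rightarrow> ('a \<Rightarrow> 'a) \<Rightarrow> ('a \<Rightarrow> nat) \<Rightarrow> bool" where
  "rooted E F f rt rk \<longleftrightarrow> inj_on rk F \<and>
     (\<forall>x\<in>F. rk x < card F \<and> rt x \<in> F \<and> f (rt x) = None \<and> (f x = None \<longrightarrow> rt x = x) \<and>
       (\<forall>y. f x = Some y \<longrightarrow> y \<in> F \<and> y \<noteq> x \<and> {x, y} \<in> E \<and> rk y < rk x \<and> rt y = rt x)) \<and>
     (\<forall>x\<in>F. \<forall>y\<in>F. x \<noteq> y \<longrightarrow> {x, y} \<in> E \<longrightarrow> f x = Some y \<or> f y = Some x)"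

lemma rootedD:
  assumes "rooted E F f rt rk"
  shows "inj_on rk F" "\<And>x. x \<in> F \<Longrightarrow> rk x < card F" "\<And>x. x \<in> F \<Longrightarrow> rt x \<in> F"
    "\<And>x. x \<in> F \<Longrightarrow> f (rt x) = None" "\<And>x. x \<in> F \<Longrightarrow> f x = None \<Longrightarrow> rt x = x"
    "\<And>x y. x \<in> F \<Longrightarrow> f x = Some y \<Longrightarrow> y \<in> F" "\<And>x y. x \<in> F \<Longrightarrow> f x = Some y \<Longrightarrow> y \<noteq> x"
    "\<And>x y. x \<in> F \<Longrightarrow> f x = Some y \<Longrightarrow> {x, y} \<in> E"
    "\<And>x y. x \<in> F \<Longrightarrow> f x = Some y \<Longrightarrow> rk y < rk x"
    "\<And>x y. x \<in> F \<Longrightarrow> f x = Some y \<Longrightarrow> rt y = rt x"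
    "\<And>x y. x \<in> F \<Longrightarrow> y \<in> F \<Longrightarrow> x \<noteq> y \<Longrightarrow> {x, y} \<in> E \<Longrightarrow> f x = Some y \<or> f y = Some x"
  using assms unfolding rooted_def by blast+

text \<open>A forest is not a core, so it has a vertex of degree at most 1. This vertex comes last
  in the ranking, as a child of its only neighbour or as a new root.\<close>

lemma exists_rooted:
  assumes "finite F" "acyc E F"
  shows "\<exists>f rt rk. rooted E F f rt rk"
  using assms
proof (induction "card F" arbitrary: F)
  case 0
  then show ?case by (auto simp: rooted_def)
next
  case (Suc n)
  have "\<not> core E F" using Suc.prems by (auto simp: acyc_def)
  moreover have "F \<noteq> {}" using Suc.hyps by auto
  ultimately obtain x where x: "x \<in> F" "card (nb E F x) \<le> 1"
    using Suc.prems(1) by (force simp: core_def)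
  define F0 where "F0 = F - {x}"
  have F0: "F = insert x F0" "x \<notin> F0" "card F0 = n" "finite F0"
    using x Suc by (auto simp: F0_def)
  obtain f rt rk where r: "rooted E F0 f rt rk"
    using Suc.hyps(1)[of F0] F0 Suc.prems acyc_mono by blast
  define p where "p = (if nb E F x = {} then None else Some (the_elem (nb E F x)))"
  have p: "nb E F x = set_option p"
  proof (cases "nb E F x = {}")
    case False
    then have "card (nb E F x) = 1" using x(2) Suc.prems(1) card_0_eq[of "nb E F x"] by (metis
        One_nat_def finite_nb le_Suc_eq le_zero_eq)
    then obtain y where "nb E F x = {y}" by (rule card_1_singletonE)
    then show ?thesis by (simp add: p_def)
  qed (simp add: p_def)
  have pS: "y \<in> F0" "{x, y} \<in> E" if "p = Some y" for y
  proof -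
    have "y \<in> nb E F x" using p that by simp
    then show "y \<in> F0" "{x, y} \<in> E" by (auto simp: nb_def F0_def)
  qed
  have only: "p = Some y" if "y \<in> F0" "{x, y} \<in> E" for y
  proof -
    have "y \<in> nb E F x" using that F0 by (auto simp: nb_def)
    then show ?thesis using p by simp
  qed
  define f' where "f' = f(x := p)"
  define rt' where "rt' = rt(x := (case p of None \<Rightarrow> x | Some y \<Rightarrow> rt y))"
  define rk' where "rk' = rk(x := n)"
  note R = rootedD[OF r, unfolded F0(3)]
  have "rooted E F f' rt' rk'"
    unfolding rooted_def
  proof (intro conjI ballI allI impI)
    have "inj_on rk' F0" using R(1) F0(2) by (subst inj_on_cong[of _ _ rk]) (auto simp: rk'_def)
    moreover have "rk' x \<notin> rk' ` F0" 
    proof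
      assume "rk' x \<in> rk' ` F0"
      then obtain y where "y \<in> F0" "n = rk y" using F0(2) by (auto simp: rk'_def)
      then show False using R(2)[of y] by simp
    qed
    ultimately show "inj_on rk' F" using F0(1,2) by simp
    fix y assume y: "y \<in> F"
    show "rk' y < card F" using y R(2) F0 by (auto simp: rk'_def less_Suc_eq)
    show "rt' y \<in> F"
      using y R(3)[of y] R(3) F0 pS by (auto simp: rt'_def split: option.splits)
    show "f' (rt' y) = None"
    proof (cases "y = x")
      case True
      show ?thesis
      proof (cases p)
        case None
        then show ?thesis using True by (simp add: f'_def rt'_def)
      next
        case (Some w)
        then have "w \<in> F0" using pS by blast
        then have "rt w \<in> F0" "f (rt w) = None" using R(3,4) by blast+
        then show ?thesis using Some True F0(2) by (auto simp: f'_def rt'_def)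
      qed
    next
      case False
      then have "y \<in> F0" using y F0 by auto
      then have "rt y \<noteq> x" using R(3) F0 by auto
      then show ?thesis using False R(4)[OF \<open>y \<in> F0\<close>] by (simp add: f'_def rt'_def)
    qed
    show "rt' y = y" if "f' y = None"
      using that y R(5)[of y] F0 by (auto simp: f'_def rt'_def split: if_splits)
    fix z
    have "z \<in> F \<and> z \<noteq> y \<and> {y, z} \<in> E \<and> rk' z < rk' y \<and> rt' z = rt' y" if z: "f' y = Some z"
    proof (cases "y = x")
      case True
      then have "p = Some z" using z by (simp add: f'_def)
      then show ?thesis using True pS[of z] R(2)[of z] F0 by (auto simp: rk'_def rt'_def)
    next
      case False
      then have y0: "y \<in> F0" "f y = Some z" using y z F0 by (auto simp: f'_def)
      then have "z \<in> F0" using R(6) by blast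
      then show ?thesis using R(7-10)[OF y0] False F0 by (auto simp: rk'_def rt'_def)
    qed
    then show "f' y = Some z \<Longrightarrow> z \<in> F" "f' y = Some z \<Longrightarrow> z \<noteq> y" "f' y = Some z \<Longrightarrow> {y, z} \<in> E"
      "f' y = Some z \<Longrightarrow> rk' z < rk' y" "f' y = Some z \<Longrightarrow> rt' z = rt' y" by blast+
    assume z: "z \<in> F" "y \<noteq> z" "{y, z} \<in> E"
    show "f' y = Some z \<or> f' z = Some y"
      using y z R(11)[of y z] only[of y] only[of z] F0 by (auto simp: f'_def insert_commute)
  qed
  then show ?case by blast
qed

text \<open>The cycles are chosen as low as possible in the rooted forest, which makes each of them spoil
  at most one vertex for the others.\<close>

lemma disjoint_flowers:
  assumes "finite F" "acyc E F" "finite J" "J \<inter> F = {}"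
    "\<And>v S. v \<in> J \<Longrightarrow> S \<subseteq> F \<Longrightarrow> card S < card J \<Longrightarrow> \<not> acyc E (insert v (F - S))"
  shows "\<exists>C. (\<forall>v\<in>J. C v \<subseteq> insert v F \<and> core E (C v)) \<and> (\<forall>v\<in>J. \<forall>u\<in>J. v \<noteq> u \<longrightarrow> C v \<inter> C u = {})"
  using assms
proof (induction "card J" arbitrary: J F)
  case 0
  then show ?case by simp
next
  case (Suc n)
  note fin = Suc.prems(1,3) and kill = Suc.prems(5)
  have JF: "v \<notin> F" if "v \<in> J" for v using Suc.prems(4) that by auto
  obtain f rt rk where r: "rooted E F f rt rk" using exists_rooted[OF Suc.prems(1,2)] by blast
  have par: "y \<in> F" "rk y < rk x" if "x \<in> F" "f x = Some y" for x y
    using rootedD(6,9)[OF r that] by auto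
  have edge: "f x = Some y \<or> f y = Some x" if "x \<in> F" "y \<in> F" "x \<noteq> y" "{x, y} \<in> E" for x y
    using rootedD(11)[OF r that] .
  define U where "U r = {x \<in> F. r \<le> rk x}" for r
  define bad where "bad r \<longleftrightarrow> (\<exists>v\<in>J. \<not> acyc E (insert v (U r)))" for r
  have "bad 0"
  proof -
    obtain v where "v \<in> J" using Suc.hyps(2) by (metis card.empty equals0I nat.distinct(1))
    then show ?thesis using kill[of v "{}"] Suc.hyps(2) by (auto simp: bad_def U_def)
  qed
  moreover have "\<forall>r. bad r \<longrightarrow> r \<le> card F"
  proof (intro allI impI, rule ccontr)
    fix r' assume "bad r'" "\<not> r' \<le> card F"
    then have "U r' = {}" using rootedD(2)[OF r] by (fastforce simp: U_def)
    then have "acyc E (insert v (U r'))" for v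
      by (metis acyc_def not_core_empty not_core_sing subset_singletonD)
    with \<open>bad r'\<close> show False by (auto simp: bad_def)
  qed
  \<comment> \<open>The largest threshold at which some vertex of \<open>J\<close> still forms a
    core with the forest vertices of rank at least \<open>q\<close>; the vertex \<open>s\<close> of
    rank \<open>q\<close> is then indispensable.\<close>
  ultimately obtain q where q: "bad q" "\<And>q'. bad q' \<Longrightarrow> q' \<le> q"
    using Nat.ex_has_greatest_nat[of bad 0 "card F"] by blast
  obtain v where v: "v \<in> J" "\<not> acyc E (insert v (U q))" using q(1) by (auto simp: bad_def)
  have above: "acyc E (insert u (U (Suc q)))" if "u \<in> J" for u
    using q(2)[of "Suc q"] that by (auto simp: bad_def)
  have "\<exists>s\<in>F. rk s = q"
  proof (rule ccontr)
    assume "\<not> (\<exists>s\<in>F. rk s = q)"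
    then have "U q = U (Suc q)" by (auto simp: U_def Suc_le_eq order_less_le)
    then show False using v above by simp
  qed
  then obtain s where s: "s \<in> F" "rk s = q" by blast
  define R where "R = {(x, y). x \<in> F \<and> f x = Some y}"
  define D where "D = {x \<in> F. (x, s) \<in> R\<^sup>*}"
  have rkD: "x = s \<or> q < rk x" if "(x, s) \<in> R\<^sup>*" for x
    using that
  proof (induction rule: converse_rtrancl_induct)
    case (step y z)
    then show ?case using par s by (force simp: R_def)
  qed simp
  have D: "D \<subseteq> U q" "D - {s} \<subseteq> U (Suc q)" "s \<in> D" "D \<subseteq> F"
    using rkD s by (force simp: D_def U_def Suc_le_eq)+
  have down: "y \<in> D" if "f y = Some x" "x \<in> D" "y \<in> F" for x y
    using that by (auto simp: D_def R_def intro: converse_rtrancl_into_rtrancl)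
  have up: "y \<in> D" if xy: "f x = Some y" "x \<in> D" "x \<noteq> s" for x y
  proof -
    have "(x, s) \<in> R\<^sup>*" using xy by (simp add: D_def)
    then obtain z where "(x, z) \<in> R" "(z, s) \<in> R\<^sup>*" using xy(3) by (metis converse_rtranclE)
    then show ?thesis using xy(1) par by (auto simp: R_def D_def)
  qed
  have "\<not> acyc E (insert v D)"
  proof
    assume a: "acyc E (insert v D)"
    \<comment> \<open>Within \<open>U q\<close> no edge leaves \<open>D\<close>: the only edge out
      of the subtree goes to the parent of \<open>s\<close>, whose rank is below \<open>q\<close>.
      Hence a core through \<open>v\<close> already fits into \<open>insert v D\<close>.\<close>
    have "acyc E (insert v (D \<union> (U q - D)))"
    proof (rule acyc_glue[OF a])
      have "U q - D \<subseteq> U (Suc q)"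
      proof
        fix x assume "x \<in> U q - D"
        then have "rk x \<noteq> rk s \<and> x \<in> F \<and> q \<le> rk x"
          using rootedD(1)[OF r] s D by (auto simp: U_def inj_on_def)
        then show "x \<in> U (Suc q)" using s by (auto simp: U_def)
      qed
      then show "acyc E (insert v (U q - D))" using above[OF v(1)] by (auto intro: acyc_mono)
      fix x y assume xy: "x \<in> D" "y \<in> U q - D"
      show "{x, y} \<notin> E"
      proof
        assume "{x, y} \<in> E"
        then have "f x = Some y \<or> f y = Some x" using xy D by (intro edge) (auto simp: U_def)
        moreover have "f x \<noteq> Some y" if "x = s"
          using par(2)[of s y] that xy s by (auto simp: U_def)
        ultimately show False using up[of x y] down[of y x] xy by (auto simp: U_def)
      qed
    qed (use JF[OF v(1)] D in \<open>auto simp: U_def\<close>)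
    moreover have "D \<union> (U q - D) = U q" using D by auto
    ultimately show False using v by simp
  qed
  then obtain Y where Y: "Y \<subseteq> insert v D" "core E Y" by (auto simp: acyc_def)
  define J' where "J' = J - {v}"
  define F' where "F' = F - D"
  have cJ: "card J' = n" "finite J'" using Suc.hyps(2) v fin by (auto simp: J'_def)
  have "\<exists>C. (\<forall>u\<in>J'. C u \<subseteq> insert u F' \<and> core E (C u)) \<and> (\<forall>u\<in>J'. \<forall>w\<in>J'. u \<noteq> w \<longrightarrow> C u \<inter> C w = {})"
  proof (rule Suc.hyps(1))
    fix u S assume u: "u \<in> J'" and S: "S \<subseteq> F'" "card S < card J'"
    show "\<not> acyc E (insert u (F' - S))"
    proof
      assume a: "acyc E (insert u (F' - S))"
      have uJ: "u \<in> J" using u by (simp add: J'_def)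
      \<comment> \<open>For the other vertices \<open>u\<close> the part \<open>D - {s}\<close> is
        harmless by the choice of \<open>q\<close>. Losing all of \<open>D\<close> therefore amounts
        to deleting only \<open>s\<close>, which is paid for by \<open>J'\<close> being smaller by
        one.\<close>
      have "acyc E (insert u ((D - {s}) \<union> (F' - S)))"
      proof (rule acyc_glue[OF _ a])
        show "acyc E (insert u (D - {s}))" using above[OF uJ] D by (auto intro: acyc_mono)
        fix x y assume xy: "x \<in> D - {s}" "y \<in> F' - S"
        show "{x, y} \<notin> E"
          using edge[of x y] up[of x y] down[of y x] xy D by (auto simp: F'_def)
      qed (use JF[OF uJ] D in \<open>auto simp: F'_def\<close>)
      moreover have "(D - {s}) \<union> (F' - S) = F - insert s S" using D S by (auto simp: F'_def)
      moreover have "card (insert s S) < card J"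
        using S cJ Suc.hyps(2) card_insert_le_m1[of "Suc (card S)" S s] by simp
      moreover have "insert s S \<subseteq> F" using S s by (auto simp: F'_def)
      ultimately show False using kill[OF uJ] by metis
    qed
  qed (use cJ fin Suc.prems in \<open>auto simp: J'_def F'_def intro: acyc_mono\<close>)
  then obtain C where C: "\<And>u. u \<in> J' \<Longrightarrow> C u \<subseteq> insert u F' \<and> core E (C u)"
    "\<And>u w. u \<in> J' \<Longrightarrow> w \<in> J' \<Longrightarrow> u \<noteq> w \<Longrightarrow> C u \<inter> C w = {}" by metis
  have YC: "Y \<inter> C u = {}" if "u \<in> J'" for u
  proof -
    have "u \<in> J" "u \<noteq> v" using that by (auto simp: J'_def)
    moreover have "C u \<subseteq> insert u (F - D)" using C(1)[OF that] by (simp add: F'_def)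
    ultimately show ?thesis using Y(1) JF[of u] JF[OF v(1)] D(4) by blast
  qed
  show ?case
  proof (intro exI[of _ "C(v := Y)"] conjI ballI impI)
    fix u assume u: "u \<in> J"
    show "(C(v := Y)) u \<subseteq> insert u F" "core E ((C(v := Y)) u)"
      using u C(1)[of u] Y D by (auto simp: J'_def F'_def)
    fix w assume "w \<in> J" "u \<noteq> w"
    then show "(C(v := Y)) u \<inter> (C(v := Y)) w = {}"
      using u C(2)[of u w] YC[of u] YC[of w] by (auto simp: J'_def)
  qed
qed

text \<open>Each blocker vertex contributes at most itself and \<open>k\<close> deleted forest
  vertices.\<close>

definition minor_bound :: "nat \<Rightarrow> nat" where
  "minor_bound k = (surplus (Suc k) + k) * Suc k"

lemma decomposition:
  assumes fin: "finite V" and np: "\<not> pack E V (Suc k)"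
  shows "\<exists>B W. B \<subseteq> V \<and> W \<subseteq> V \<and> B \<inter> W = {} \<and> card B \<le> k \<and> card W \<le> minor_bound k \<and>
    acyc E (V - B - W) \<and> (\<forall>w\<in>W. acyc E (insert w (V - B - W)))"
proof -
  obtain Q where Q: "Q \<subseteq> V" "card Q \<le> surplus (Suc k) + k" "acyc E (V - Q)"
    using Erdos_Posa[OF assms] by blast
  have finQ: "finite Q" using Q fin finite_subset by blast
  define F where "F = V - Q"
  define B where "B = {v \<in> Q. \<forall>S\<subseteq>F. card S \<le> k \<longrightarrow> \<not> acyc E (insert v (F - S))}"
  have "card B \<le> k"
  proof (rule ccontr)
    assume "\<not> card B \<le> k"
    then obtain J where J: "J \<subseteq> B" "card J = Suc k" "finite J"
      by (meson not_less_eq_eq obtain_subset_with_card_n)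
    have "\<exists>C. (\<forall>v\<in>J. C v \<subseteq> insert v F \<and> core E (C v)) \<and> (\<forall>v\<in>J. \<forall>u\<in>J. v \<noteq> u \<longrightarrow> C v \<inter> C u = {})"
      using J fin Q by (intro disjoint_flowers) (auto simp: F_def B_def)
    then obtain C where C: "\<And>v. v \<in> J \<Longrightarrow> C v \<subseteq> insert v F \<and> core E (C v)"
      "\<And>v u. v \<in> J \<Longrightarrow> u \<in> J \<Longrightarrow> v \<noteq> u \<Longrightarrow> C v \<inter> C u = {}" by metis
    have "pack E V (card J)"
    proof (rule pack_family[of _ C])
      fix v assume v: "v \<in> J"
      then have "v \<in> V" using J Q by (auto simp: B_def)
      then show "C v \<subseteq> V" using C(1)[OF v] by (auto simp: F_def)
    qed (use C J in auto)
    then show False using np J by simp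
  qed
  have "\<forall>v\<in>Q - B. \<exists>S. S \<subseteq> F \<and> card S \<le> k \<and> acyc E (insert v (F - S))" by (auto simp: B_def)
  then obtain S where S: "\<And>v. v \<in> Q - B \<Longrightarrow> S v \<subseteq> F \<and> card (S v) \<le> k \<and> acyc E (insert v (F - S v))" by metis
  \<comment> \<open>The deleted forest vertices join \<open>W\<close> too. They also meet the
    requirement, since adding one of them back stays inside the forest \<open>F\<close>.\<close>
  define W where "W = (Q - B) \<union> (\<Union>v\<in>Q - B. S v)"
  have VBW: "V - B - W = F - (\<Union>v\<in>Q - B. S v)" using Q by (auto simp: W_def F_def B_def)
  have "card W \<le> card (Q - B) + card (\<Union>v\<in>Q - B. S v)" unfolding W_def by (rule card_Un_le)
  also have "card (\<Union>v\<in>Q - B. S v) \<le> (\<Sum>v\<in>Q - B. card (S v))" using finQ by (intro card_UN_le) auto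
  also have "\<dots> \<le> (\<Sum>v\<in>Q - B. k)" using S by (intro sum_mono) auto
  finally have "card W \<le> card (Q - B) * Suc k" by simp
  also have "\<dots> \<le> (surplus (Suc k) + k) * Suc k"
    using Q(2) card_mono[OF finQ, of "Q - B"] by (intro mult_le_mono1) auto
  finally have "card W \<le> minor_bound k" by (simp add: minor_bound_def)
  moreover have "acyc E (insert w (V - B - W))" if w: "w \<in> W" for w
  proof (cases "w \<in> Q")
    case True
    then have wB: "w \<in> Q - B" using w S Q by (auto simp: W_def F_def)
    then have "insert w (V - B - W) \<subseteq> insert w (F - S w)" unfolding VBW by auto
    then show ?thesis using S[OF wB] acyc_mono by blast
  next
    case False
    then have "insert w (V - B - W) \<subseteq> F" using w S unfolding VBW by (auto simp: W_def)
    then show ?thesis using Q(3) acyc_mono unfolding F_def by blast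
  qed
  moreover have "acyc E (V - B - W)" using Q(3) unfolding VBW F_def by (auto intro: acyc_mono)
  moreover have "B \<subseteq> V" "W \<subseteq> V" "B \<inter> W = {}" using Q S by (auto simp: B_def W_def F_def)
  ultimately show ?thesis using \<open>card B \<le> k\<close> by blast
qed

section \<open>Weighted parent functions\<close>

definition parents :: "'a set \<Rightarrow> ('a \<Rightarrow> 'a option) set" where
  "parents F = (\<Pi>\<^sub>E x\<in>F. insert None (Some ` F))"

definition root_weight :: "real \<Rightarrow> 'b option \<Rightarrow> real" where
  "root_weight K u = (case u of None \<Rightarrow> K | Some _ \<Rightarrow> 1)"

text \<open>The generating function of parent functions by the number of roots: a root counts as
  \<open>K\<close> possible parents.\<close>

definition wt :: "real \<Rightarrow> 'a set \<Rightarrow> ('a \<Rightarrow> 'a option) \<Rightarrow> real" where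
  "wt K F f = (\<Prod>x\<in>F. root_weight K (f x))"

lemma root_weight_nonneg: "0 \<le> K \<Longrightarrow> 0 \<le> root_weight K u"
  by (simp add: root_weight_def split: option.split)

lemma wt_nonneg: "0 \<le> K \<Longrightarrow> 0 \<le> wt K F f"
  unfolding wt_def by (intro prod_nonneg ballI root_weight_nonneg)

text \<open>The weight is a product over the vertices, so independent restrictions
  \<open>T x\<close> on the parents factorise. The estimates below only have to choose
  \<open>T\<close>.\<close>

lemma sum_wt_PiE:
  assumes "finite F" "\<And>x. x \<in> F \<Longrightarrow> finite (T x)"
  shows "(\<Sum>f\<in>PiE F T. wt K F f) = (\<Prod>x\<in>F. \<Sum>u\<in>T x. root_weight K u)"
  unfolding wt_def using prod_sum_PiE[of F T "\<lambda>_. root_weight K"] assms by simp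

lemma sum_root_weight: "finite X \<Longrightarrow> (\<Sum>u\<in>insert None (Some ` X). root_weight K u) = real (card X) + K"
  by (simp add: root_weight_def sum.reindex)

lemma finite_parents: "finite F \<Longrightarrow> finite (parents F)"
  unfolding parents_def by (intro finite_PiE) auto

lemma sum_wt_parents: "finite F \<Longrightarrow> (\<Sum>f\<in>parents F. wt K F f) = (real (card F) + K) ^ card F"
  unfolding parents_def by (simp add: sum_wt_PiE sum_root_weight del: sum.insert)

lemma wt_eq_power: "finite F \<Longrightarrow> wt K F f = K ^ card {x \<in> F. f x = None}"
proof -
  assume F: "finite F"
  have "wt K F f = (\<Prod>x\<in>F. if f x = None then K else 1)"
    unfolding wt_def root_weight_def by (intro prod.cong) (auto split: option.split)
  also have "\<dots> = K ^ card (F \<inter> {x. f x = None})" using F by (simp add: prod.If_cases)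
  also have "F \<inter> {x. f x = None} = {x \<in> F. f x = None}" by auto
  finally show ?thesis .
qed

text \<open>A directed substitute for a long path: the chain prescribes \<open>f\<close> at all of
  its vertices but the last.\<close>

definition long_chain :: "nat \<Rightarrow> 'a set \<Rightarrow> ('a \<Rightarrow> 'a option) \<Rightarrow> bool" where
  "long_chain t F f \<longleftrightarrow> (\<exists>zs. length zs = t \<and> distinct zs \<and> set zs \<subseteq> F \<and>
     (\<forall>i. Suc i < t \<longrightarrow> f (zs ! i) = Some (zs ! Suc i)))"

text \<open>\<open>X\<close> is a vertex cover of the forest whose edges join \<open>x\<close> to
  its parent.\<close>

definition small_cover :: "nat \<Rightarrow> 'a set \<Rightarrow> ('a \<Rightarrow> 'a option) \<Rightarrow> bool" where
  "small_cover c F f \<longleftrightarrow> (\<exists>X\<subseteq>F. card X \<le> c \<and> (\<forall>x\<in>F - X. \<forall>y. f x = Some y \<longrightarrow> y \<in> X))"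

lemma sum_UN_le:
  fixes g :: "'b \<Rightarrow> real"
  assumes "finite I" "\<And>i. i \<in> I \<Longrightarrow> finite (A i)" "\<And>x. 0 \<le> g x"
  shows "sum g (\<Union>i\<in>I. A i) \<le> (\<Sum>i\<in>I. sum g (A i))"
  using assms(1,2)
proof (induction I rule: finite_induct)
  case (insert i I)
  have "sum g (A i \<union> (\<Union>j\<in>I. A j)) \<le> sum g (A i) + sum g (\<Union>j\<in>I. A j)"
    using insert assms(3) sum.union_inter[of "A i" "\<Union>j\<in>I. A j" g]
      sum_nonneg[of "A i \<inter> (\<Union>j\<in>I. A j)" g] by simp
  then show ?case using insert by simp
qed simp

text \<open>The birthday bound: each factor is N - i \<le> N * exp (- i / N), and the i below t add
  up to t * (t - 1) / 2.\<close>

lemma falling_product_le: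
  assumes "t \<le> N" "0 < N"
  shows "real (\<Prod>{N - t + 1..N}) \<le> real N ^ t * exp (- (real t * (real t - 1) / (2 * real N)))"
  using assms(1)
proof (induction t)
  case (Suc t)
  let ?x = "exp (- (real t * (real t - 1) / (2 * real N)))"
  have eq: "\<Prod>{N - Suc t + 1..N} = (N - t) * \<Prod>{N - t + 1..N}"
    using Suc.prems by (simp add: Suc_diff_Suc atLeastAtMost_insertL[symmetric, of "N - t"] del:
        prod.atLeastAtMost_shift_bounds)
  have "real (N - t) = real N * (1 + - (real t / real N))" using Suc.prems assms(2) by (simp add: field_simps)
  also have "\<dots> \<le> real N * exp (- (real t / real N))" by (intro mult_left_mono exp_ge_add_one_self) auto
  finally have "real (\<Prod>{N - Suc t + 1..N}) \<le>
      (real N * exp (- (real t / real N))) * (real N ^ t * ?x)"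
    unfolding eq of_nat_mult using Suc by (intro mult_mono) (auto intro!: prod_nonneg)
  also have "\<dots> = real N ^ Suc t * (exp (- (real t / real N)) * ?x)"
    by simp
  also have "exp (- (real t / real N)) * ?x =
      exp (- (real (Suc t) * (real (Suc t) - 1) / (2 * real N)))"
    unfolding exp_add[symmetric] using assms(2) by (intro arg_cong[of _ _ exp]) (simp add: field_simps)
  finally show ?case .
qed simp

text \<open>Union bound over the lists that may form the chain. A list fixes \<open>t - 1\<close>
  parents but is itself chosen in at most \<open>t\<close> factors of N, which leaves one factor too
  many, hence \<open>Suc (card F)\<close>, while distinctness supplies the exponential.\<close>

lemma sum_wt_long_chain:
  assumes F: "finite F" and t: "0 < t" "t \<le> card F" and K: "1 \<le> K"
  shows "(\<Sum>f\<in>{f \<in> parents F. long_chain t F f}. wt K F f) \<le>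
    exp (- (real t * (real t - 1) / (2 * real (card F)))) * (real (card F) + K) ^ Suc (card F)"
proof -
  let ?N = "card F"
  let ?P = "{f \<in> parents F. long_chain t F f}"
  let ?x = "exp (- (real t * (real t - 1) / (2 * real ?N)))"
  define L where "L = {zs. length zs = t \<and> distinct zs \<and> set zs \<subseteq> F}"
  define T where "T zs x = {u \<in> insert None (Some ` F). \<forall>i. Suc i < t \<longrightarrow> zs ! i = x \<longrightarrow> u = Some (zs !
      Suc i)}" for zs x
  have finT: "finite (T zs x)" for zs x using F by (simp add: T_def)
  have finL: "finite L" unfolding L_def
    by (rule finite_subset[OF _ finite_lists_length_eq[OF F, of t]]) auto
  have sub: "?P \<subseteq> (\<Union>zs\<in>L. PiE F (T zs))"
  proof
    fix f assume "f \<in> ?P"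
    then have f: "f \<in> parents F" "long_chain t F f" by auto
    then obtain zs where "zs \<in> L" "\<forall>i. Suc i < t \<longrightarrow> f (zs ! i) = Some (zs ! Suc i)"
      by (auto simp: long_chain_def L_def)
    then have "f \<in> PiE F (T zs)" using f(1) by (auto simp: parents_def T_def PiE_iff)
    then show "f \<in> (\<Union>zs\<in>L. PiE F (T zs))" using \<open>zs \<in> L\<close> by blast
  qed
  have one: "(\<Sum>f\<in>PiE F (T zs). wt K F f) \<le> (real ?N + K) ^ (?N - t + 1)" if zs: "zs \<in> L" for zs
  proof -
    let ?I = "(!) zs ` {..<t - 1}"
    have I: "?I \<subseteq> F" "card ?I = t - 1"
    proof -
      show "?I \<subseteq> F" using zs by (auto simp: L_def)
      have "inj_on ((!) zs) {..<t - 1}" using zs by (auto simp: L_def intro!: inj_on_nth)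
      then show "card ?I = t - 1" by (simp add: card_image)
    qed
    have le1: "(\<Sum>u\<in>T zs x. root_weight K u) \<le> 1" if x: "x \<in> ?I" for x
    proof -
      obtain i where i: "i < t - 1" "x = zs ! i" using x by auto
      then have "Suc i < t" by simp
      then have "T zs x \<subseteq> {Some (zs ! Suc i)}" using i(2) unfolding T_def by blast
      then have "(\<Sum>u\<in>T zs x. root_weight K u) \<le> (\<Sum>u\<in>{Some (zs ! Suc i)}. root_weight K u)"
        using K by (intro sum_mono2 root_weight_nonneg) auto
      then show ?thesis by (simp add: root_weight_def)
    qed
    have leN: "(\<Sum>u\<in>T zs x. root_weight K u) \<le> real ?N + K" for x
      unfolding sum_root_weight[OF F, symmetric] using F K
      by (intro sum_mono2 root_weight_nonneg) (auto simp: T_def)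
    have nn: "0 \<le> (\<Sum>u\<in>T zs x. root_weight K u)" for x
      using K by (intro sum_nonneg root_weight_nonneg) auto
    have "(\<Sum>f\<in>PiE F (T zs). wt K F f) = (\<Prod>x\<in>F. \<Sum>u\<in>T zs x. root_weight K u)"
      using F finT by (rule sum_wt_PiE)
    also have "\<dots> = (\<Prod>x\<in>?I. \<Sum>u\<in>T zs x. root_weight K u) * (\<Prod>x\<in>F - ?I. \<Sum>u\<in>T zs x. root_weight K u)"
      using F I by (metis mult.commute prod.subset_diff)
    also have "\<dots> \<le> 1 * (\<Prod>x\<in>F - ?I. real ?N + K)"
      using le1 leN nn K by (intro mult_mono prod_le_1 prod_mono prod_nonneg) auto
    also have "card (F - ?I) = ?N - t + 1"
      using I F t card_Diff_subset[of ?I F] by simp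
    then have "(\<Prod>x\<in>F - ?I. real ?N + K) = (real ?N + K) ^ (?N - t + 1)" by simp
    finally show ?thesis by simp
  qed
  have "(\<Sum>f\<in>?P. wt K F f) \<le> (\<Sum>f\<in>(\<Union>zs\<in>L. PiE F (T zs)). wt K F f)"
    using sub finL F finT K by (intro sum_mono2 wt_nonneg) (auto intro!: finite_PiE)
  also have "\<dots> \<le> (\<Sum>zs\<in>L. \<Sum>f\<in>PiE F (T zs). wt K F f)"
    using finL F finT K by (intro sum_UN_le wt_nonneg finite_PiE) auto
  also have "\<dots> \<le> (\<Sum>zs\<in>L. (real ?N + K) ^ (?N - t + 1))" by (intro sum_mono one)
  also have "\<dots> = real (\<Prod>{?N - t + 1..?N}) * (real ?N + K) ^ (?N - t + 1)"
    using card_lists_distinct_length_eq[OF F t(2)] by (simp add: L_def)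
  also have "\<dots> \<le> (real ?N ^ t * ?x) * (real ?N + K) ^ (?N - t + 1)"
    using t K by (intro mult_right_mono falling_product_le) auto
  also have "\<dots> \<le> ((real ?N + K) ^ t * ?x) * (real ?N + K) ^ (?N - t + 1)"
    using K by (intro mult_right_mono power_mono) auto
  also have "\<dots> = ?x * (real ?N + K) ^ (t + (?N - t + 1))"
    by (simp only: power_add mult_ac)
  also have "t + (?N - t + 1) = Suc ?N" using t by simp
  finally show ?thesis .
qed

text \<open>The cover is chosen in at most 2 ^ \<open>card F\<close> ways, and the vertices outside
  it find their parents among at most \<open>c\<close> vertices.\<close>

lemma sum_wt_small_cover:
  assumes F: "finite F" and c: "c \<le> card F" and K: "1 \<le> K"
  shows "(\<Sum>f\<in>{f \<in> parents F. small_cover c F f}. wt K F f) \<le>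
    2 ^ card F * ((real (card F) + K) ^ c * (real c + K) ^ (card F - c))"
proof -
  let ?N = "card F"
  let ?P = "{f \<in> parents F. small_cover c F f}"
  define T where "T X x = (if x \<in> X then insert None (Some ` F) else insert None (Some ` X))" for X and x :: 'a
  define L where "L = {X. X \<subseteq> F \<and> card X \<le> c}"
  have finL: "finite L" "L \<subseteq> Pow F" using F by (auto simp: L_def)
  have finT: "finite (T X x)" if "X \<in> L" for X x
    using F that finite_subset by (auto simp: T_def L_def)
  have sub: "?P \<subseteq> (\<Union>X\<in>L. PiE F (T X))"
  proof
    fix f assume "f \<in> ?P"
    then have f: "f \<in> parents F" "small_cover c F f" by auto
    then obtain X where X: "X \<in> L" "\<forall>x\<in>F - X. \<forall>y. f x = Some y \<longrightarrow> y \<in> X"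
      by (auto simp: small_cover_def L_def)
    have "f x \<in> T X x" if "x \<in> F" for x
      using f(1) X(2) that by (cases "f x") (auto simp: T_def parents_def PiE_iff)
    then have "f \<in> PiE F (T X)" using f(1) by (auto simp: parents_def PiE_iff)
    then show "f \<in> (\<Union>X\<in>L. PiE F (T X))" using X by blast
  qed
  have one: "(\<Sum>f\<in>PiE F (T X). wt K F f) \<le> (real ?N + K) ^ c * (real c + K) ^ (?N - c)" if X: "X \<in> L" for X
  proof -
    have XF: "X \<subseteq> F" "card X \<le> c" "finite X" using X F finite_subset by (auto simp: L_def)
    have "(\<Sum>f\<in>PiE F (T X). wt K F f) = (\<Prod>x\<in>F. \<Sum>u\<in>T X x. root_weight K u)"
      using F finT[OF X] by (rule sum_wt_PiE)
    also have "\<dots> = (\<Prod>x\<in>F - X. \<Sum>u\<in>T X x. root_weight K u) * (\<Prod>x\<in>X. \<Sum>u\<in>T X x. root_weight K u)"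
      using F XF by (intro prod.subset_diff)
    also have "(\<Prod>x\<in>F - X. \<Sum>u\<in>T X x. root_weight K u) = (\<Prod>x\<in>F - X. real (card X) + K)"
      using XF by (intro prod.cong) (simp_all add: T_def sum_root_weight del: sum.insert)
    also have "(\<Prod>x\<in>X. \<Sum>u\<in>T X x. root_weight K u) = (\<Prod>x\<in>X. real ?N + K)"
      using F by (intro prod.cong) (simp_all add: T_def sum_root_weight del: sum.insert)
    \<comment> \<open>The exponent is split so that the \<open>c - card X\<close> factors by which
      the cover falls short can be raised to the size of \<open>F\<close>, giving a bound uniform in
      \<open>X\<close>.\<close>
    also have "(\<Prod>x\<in>F - X. real (card X) + K) * (\<Prod>x\<in>X. real ?N + K) =
        (real (card X) + K) ^ ((c - card X) + (?N - c)) * (real ?N + K) ^ card X"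
      using XF c by (simp add: card_Diff_subset)
    also have "\<dots> = (real (card X) + K) ^ (c - card X) * (real (card X) + K) ^ (?N - c) * (real ?N + K) ^ card X"
      by (simp only: power_add)
    also have "\<dots> \<le> (real ?N + K) ^ (c - card X) * (real c + K) ^ (?N - c) * (real ?N + K) ^ card X"
      using XF c K by (intro mult_mono power_mono) auto
    also have "\<dots> = (real ?N + K) ^ ((c - card X) + card X) * (real c + K) ^ (?N - c)"
      by (simp only: power_add mult_ac)
    finally show ?thesis using XF by simp
  qed
  have "(\<Sum>f\<in>?P. wt K F f) \<le> (\<Sum>f\<in>(\<Union>X\<in>L. PiE F (T X)). wt K F f)"
    using sub finL F finT K by (intro sum_mono2 wt_nonneg) (auto intro!: finite_PiE)
  also have "\<dots> \<le> (\<Sum>X\<in>L. \<Sum>f\<in>PiE F (T X). wt K F f)"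
    using finL F finT K by (intro sum_UN_le wt_nonneg finite_PiE) auto
  also have "\<dots> \<le> (\<Sum>X\<in>L. (real ?N + K) ^ c * (real c + K) ^ (?N - c))" by (intro sum_mono one)
  also have "\<dots> = real (card L) * ((real ?N + K) ^ c * (real c + K) ^ (?N - c))" by simp
  also have "\<dots> \<le> 2 ^ ?N * ((real ?N + K) ^ c * (real c + K) ^ (?N - c))"
  proof (rule mult_right_mono)
    have "card L \<le> card (Pow F)" using finL F by (intro card_mono) auto
    then show "real (card L) \<le> 2 ^ ?N" using F by (simp add: card_Pow)
  qed (use K in auto)
  finally show ?thesis .
qed

section \<open>Subsets that contain no matching edge, and attachments to trees\<close>

text \<open>On each of the disjoint pairs only 3 of the 4 traces of \<open>S\<close> are
  allowed.\<close>

lemma card_no_pair_subset: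
  assumes "finite M" "finite F" "\<And>e. e \<in> M \<Longrightarrow> e \<subseteq> F \<and> card e = 2" "\<And>e e'. e \<in> M \<Longrightarrow> e' \<in> M \<Longrightarrow> e \<noteq> e' \<Longrightarrow> e \<inter> e' = {}"
  shows "real (card {S \<in> Pow F. \<forall>e\<in>M. \<not> e \<subseteq> S}) \<le> 2 ^ card F * (3 / 4) ^ card M"
  using assms
proof (induction M arbitrary: F rule: finite_induct)
  case empty
  then show ?case by (simp add: card_Pow Pow_def[symmetric])
next
  case (insert e M)
  have e: "e \<subseteq> F" "card e = 2" "finite e"
    using insert.prems(2)[of e] finite_subset[OF _ insert.prems(1)] by simp_all
  let ?A = "\<lambda>F M. {S \<in> Pow F. \<forall>e\<in>M. \<not> e \<subseteq> S}"
  have fin: "finite (?A (F - e) M)" using insert.prems by simp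
  have inj: "inj_on (\<lambda>S. (S - e, S \<inter> e)) (?A F (insert e M))"
    by (rule inj_onI) (metis Un_Diff_Int prod.inject)
  have img: "(\<lambda>S. (S - e, S \<inter> e)) ` ?A F (insert e M) \<subseteq> ?A (F - e) M \<times> (Pow e - {e})"
    by auto
  have "card (?A F (insert e M)) \<le> card (?A (F - e) M \<times> (Pow e - {e}))"
    using fin e by (intro card_inj_on_le[OF inj img]) auto
  also have "\<dots> = card (?A (F - e) M) * 3" using e by (simp add: card_cartesian_product card_Pow)
  finally have "real (card (?A F (insert e M))) \<le> real (card (?A (F - e) M)) * 3" by (simp flip: of_nat_mult)
  also have "\<dots> \<le> (2 ^ card (F - e) * (3 / 4) ^ card M) * 3"
  proof (intro mult_right_mono insert.IH)
    fix e' assume "e' \<in> M"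
    then have "e' \<noteq> e" using insert.hyps by auto
    then show "e' \<subseteq> F - e \<and> card e' = 2"
      using insert.prems(2)[of e'] insert.prems(3)[of e' e] \<open>e' \<in> M\<close> by auto
  qed (use insert.prems in auto)
  also have "2 ^ card F = (2::real) ^ (card (F - e) + 2)"
    using e insert.prems(1) by (metis add.commute card_Diff_subset card_mono le_add_diff_inverse)
  then have "(2 ^ card (F - e) * (3 / 4) ^ card M) * 3 = (2::real) ^ card F * (3 / 4) ^ card (insert e M)"
    using insert.hyps by (simp add: power_add)
  finally show ?case .
qed

text \<open>All vertices of a tree except its root have a parent inside the tree, and each parent
  edge counts at both ends.\<close>

lemma vol_component:
  assumes F: "finite F" and r: "rooted E F f rt rk" and C: "C = {x \<in> F. rt x = \<rho>}"
  shows "2 * card C \<le> vol E C + 2"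
proof -
  note R = rootedD[OF r]
  have finC: "finite C" using F C by simp
  define ch where "ch x = {y \<in> C. f y = Some x}" for x
  have par: "y \<in> C" if "x \<in> C" "f x = Some y" for x y
    using that R(6,10) unfolding C by auto
  have one: "(if f x = None then 0 else 1) + card (ch x) \<le> card (nb E C x)" if x: "x \<in> C" for x
  proof -
    have xF: "x \<in> F" using x C by simp
    have "ch x \<subseteq> nb E C x"
    proof
      fix y assume "y \<in> ch x"
      then have "y \<in> C" "y \<in> F" "f y = Some x" using C by (auto simp: ch_def)
      then show "y \<in> nb E C x" using R(7,8)[of y x] by (auto simp: nb_def insert_commute)
    qed
    moreover have "set_option (f x) \<subseteq> nb E C x"
      using R(7,8)[OF xF] par[OF x] by (auto simp: nb_def)
    ultimately have sub: "set_option (f x) \<union> ch x \<subseteq> nb E C x" by simp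
    have "set_option (f x) \<inter> ch x = {}"
    proof (rule ccontr)
      assume "set_option (f x) \<inter> ch x \<noteq> {}"
      then obtain y where "f x = Some y" "y \<in> C" "f y = Some x" by (auto simp: ch_def)
      then show False using R(9)[of x y] R(9)[of y x] xF C by auto
    qed
    moreover have "finite (ch x)" using finC by (simp add: ch_def)
    moreover have "card (set_option (f x)) = (if f x = None then 0 else 1)" by (cases "f x") auto
    ultimately have "card (set_option (f x) \<union> ch x) = (if f x = None then 0 else 1) + card (ch x)"
      by (simp add: card_Un_disjoint)
    then show ?thesis using card_mono[OF finite_nb[OF finC] sub] by simp
  qed
  let ?s = "\<lambda>x. if f x = None then 0 else (1::nat)"
  have "(\<Sum>x\<in>C. card (ch x)) = (\<Sum>x\<in>C. \<Sum>y\<in>C. if f y = Some x then 1 else 0)"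
    using finC by (intro sum.cong) (simp_all add: ch_def sum.If_cases Int_def)
  also have "\<dots> = (\<Sum>y\<in>C. \<Sum>x\<in>C. if f y = Some x then 1 else 0)" by (rule sum.swap)
  also have "\<dots> = (\<Sum>y\<in>C. ?s y)"
  proof (rule sum.cong)
    fix y assume y: "y \<in> C"
    show "(\<Sum>x\<in>C. if f y = Some x then 1 else 0) = ?s y"
    proof (cases "f y")
      case (Some p)
      then have "(\<Sum>x\<in>C. if f y = Some x then 1 else 0) = (\<Sum>x\<in>C. if x = p then 1 else (0::nat))"
        by (intro sum.cong) auto
      then show ?thesis using par[OF y Some] finC Some by simp
    qed simp
  qed simp
  finally have ch: "(\<Sum>x\<in>C. card (ch x)) = (\<Sum>y\<in>C. ?s y)" .
  have "(\<Sum>x\<in>C. ?s x) + (\<Sum>x\<in>C. card (ch x)) \<le> vol E C"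
    unfolding vol_def sum.distrib[symmetric] by (intro sum_mono one)
  then have v: "2 * (\<Sum>x\<in>C. ?s x) \<le> vol E C" using ch by simp
  have "{x \<in> C. f x = None} \<subseteq> {\<rho>}" using R(5) by (auto simp: C)
  then have "card {x \<in> C. f x = None} \<le> 1" using card_mono[of "{\<rho>}"] by fastforce
  moreover have "card C = card {x \<in> C. f x = None} + card {x \<in> C. f x \<noteq> None}"
    using finC by (subst card_Un_disjoint[symmetric]) (auto intro: arg_cong[of _ _ card])
  moreover have "(\<Sum>x\<in>C. ?s x) = card {x \<in> C. f x \<noteq> None}"
    using finC by (simp add: sum.If_cases Int_def)
  ultimately show ?thesis using v by simp
qed

text \<open>Two edges from \<open>w\<close> to one tree would raise the volume beyond that of a
  forest.\<close>

lemma attached_at_most_once: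
  assumes F: "finite F" and r: "rooted E F f rt rk" and w: "w \<notin> F" "acyc E (insert w F)"
  shows "card (nb E F w \<inter> {x \<in> F. rt x = \<rho>}) \<le> 1"
proof (rule ccontr)
  define C where "C = {x \<in> F. rt x = \<rho>}"
  assume "\<not> card (nb E F w \<inter> {x \<in> F. rt x = \<rho>}) \<le> 1"
  moreover have "nb E F w \<inter> {x \<in> F. rt x = \<rho>} = nb E C w" by (auto simp: C_def nb_def)
  ultimately have two: "2 \<le> card (nb E C w)" by simp
  have finC: "finite C" "w \<notin> C" "C \<subseteq> F" using F w by (auto simp: C_def)
  have "vol E (insert w C) = vol E C + 2 * card (nb E C w)" using finC by (intro vol_insert)
  moreover have "2 * card C \<le> vol E C + 2" using F r C_def by (rule vol_component)
  moreover have "vol E (insert w C) + 2 \<le> 2 * card (insert w C)"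
    using finC w(2) by (intro vol_acyc) (auto intro: acyc_mono)
  ultimately show False using two finC by simp
qed

text \<open>\<open>M\<close> is determined by its traces on the trees, and each trace is empty or a
  single vertex.\<close>

lemma card_sparse_subsets:
  assumes F: "finite F" and rt: "\<And>x. x \<in> F \<Longrightarrow> rt x \<in> T" "T \<subseteq> F"
  shows "card {M. M \<subseteq> F \<and> (\<forall>\<rho>\<in>T. card (M \<inter> {x \<in> F. rt x = \<rho>}) \<le> 1)} \<le>
    (\<Prod>\<rho>\<in>T. 1 + card {x \<in> F. rt x = \<rho>})"
proof -
  let ?C = "\<lambda>\<rho>. {x \<in> F. rt x = \<rho>}"
  let ?S = "{M. M \<subseteq> F \<and> (\<forall>\<rho>\<in>T. card (M \<inter> ?C \<rho>) \<le> 1)}"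
  have finT: "finite T" using F rt(2) finite_subset by blast
  let ?B = "\<lambda>\<rho>. insert {} ((\<lambda>x. {x}) ` ?C \<rho>)"
  have "inj_on (\<lambda>M. \<lambda>\<rho>\<in>T. M \<inter> ?C \<rho>) ?S"
  proof (rule inj_onI)
    fix M M' assume M: "M \<in> ?S" "M' \<in> ?S" "(\<lambda>\<rho>\<in>T. M \<inter> ?C \<rho>) = (\<lambda>\<rho>\<in>T. M' \<inter> ?C \<rho>)"
    have eq: "M \<inter> ?C \<rho> = M' \<inter> ?C \<rho>" if "\<rho> \<in> T" for \<rho>
      using fun_cong[OF M(3), of \<rho>] that by (simp only: restrict_apply' )
    have "x \<in> M \<longleftrightarrow> x \<in> M'" if x: "x \<in> F" for x
      using eq[OF rt(1)[OF x]] x by blast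
    then show "M = M'" using M by blast
  qed
  moreover have "(\<lambda>M. \<lambda>\<rho>\<in>T. M \<inter> ?C \<rho>) ` ?S \<subseteq> PiE T ?B"
  proof (rule image_subsetI)
    fix M assume M: "M \<in> ?S"
    show "(\<lambda>\<rho>\<in>T. M \<inter> ?C \<rho>) \<in> PiE T ?B"
    proof (rule restrict_PiE_iff[THEN iffD2], rule ballI)
      fix \<rho> assume "\<rho> \<in> T"
      then have "card (M \<inter> ?C \<rho>) \<le> 1" using M by blast
      moreover have "finite (M \<inter> ?C \<rho>)" using F by simp
      ultimately have "M \<inter> ?C \<rho> = {} \<or> (\<exists>x. M \<inter> ?C \<rho> = {x})"
        by (metis One_nat_def card_0_eq card_1_singletonE le_Suc_eq le_zero_eq)
      then show "M \<inter> ?C \<rho> \<in> ?B \<rho>" by blast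
    qed
  qed
  moreover have "finite (PiE T ?B)" using finT F by (intro finite_PiE) auto
  ultimately have "card ?S \<le> card (PiE T ?B)" by (rule card_inj_on_le)
  also have "\<dots> = (\<Prod>\<rho>\<in>T. card (?B \<rho>))" using finT by (rule card_PiE)
  also have "\<dots> \<le> (\<Prod>\<rho>\<in>T. 1 + card (?C \<rho>))"
  proof (rule prod_mono, intro conjI)
    fix \<rho> assume "\<rho> \<in> T"
    have "card (?B \<rho>) \<le> Suc (card ((\<lambda>x. {x}) ` ?C \<rho>))" by (simp add: card_insert_le_m1)
    also have "card ((\<lambda>x. {x}) ` ?C \<rho>) \<le> card (?C \<rho>)" using F by (intro card_image_le) simp
    finally show "card (?B \<rho>) \<le> 1 + card (?C \<rho>)" by simp
  qed simp
  finally show ?thesis .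
qed

text \<open>Each tree contributes one factor \<open>K\<close> through its root, which makes up the
  weight, and an exponential in its size; the sizes add up to \<open>card F\<close>.\<close>

lemma prod_component_sizes_le:
  assumes F: "finite F" and r: "rooted E F f rt rk" and K: "\<And>x. (1 + real x) ^ s \<le> K * exp (\<eta> * real x)"
  shows "real ((\<Prod>\<rho>\<in>{x \<in> F. f x = None}. 1 + card {x \<in> F. rt x = \<rho>}) ^ s) \<le> exp (\<eta> * real (card F)) * wt K F f"
proof -
  note R = rootedD[OF r]
  let ?T = "{x \<in> F. f x = None}" and ?C = "\<lambda>\<rho>. {x \<in> F. rt x = \<rho>}"
  have "(\<Sum>\<rho>\<in>?T. sum (\<lambda>_. 1) (?C \<rho>)) = sum (\<lambda>_. 1::nat) F"
    using F R(3,4) by (intro sum.group) auto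
  then have tot: "(\<Sum>\<rho>\<in>?T. card (?C \<rho>)) = card F" by simp
  have "real ((\<Prod>\<rho>\<in>?T. 1 + card (?C \<rho>)) ^ s) = (\<Prod>\<rho>\<in>?T. (1 + real (card (?C \<rho>))) ^ s)"
    by (simp add: prod_power_distrib)
  also have "\<dots> \<le> (\<Prod>\<rho>\<in>?T. K * exp (\<eta> * real (card (?C \<rho>))))"
    using K by (intro prod_mono) auto
  also have "\<dots> = K ^ card ?T * exp (\<Sum>\<rho>\<in>?T. \<eta> * real (card (?C \<rho>)))"
    using F by (simp add: prod.distrib exp_sum)
  also have "(\<Sum>\<rho>\<in>?T. \<eta> * real (card (?C \<rho>))) = \<eta> * real (card F)"
    unfolding tot[symmetric] by (simp add: sum_distrib_left)
  finally show ?thesis using F by (simp add: wt_eq_power mult.commute)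
qed

section \<open>Graphs with a given decomposition\<close>

lemma rooted_restrict: "rooted (E \<inter> Pow F) F f rt rk \<Longrightarrow> rooted E F f rt rk"
  unfolding rooted_def by blast

text \<open>A path in a rooted forest first climbs and then descends, because no vertex has two
  parents. Depending on the direction of the middle edge, the first or the last \<open>t\<close> of
  the \<open>2 * t\<close> vertices form a chain.\<close>

lemma long_chain_of_path:
  assumes r: "rooted E F f rt rk" and t: "0 < t"
    and ys: "\<And>i. i < 2 * t \<Longrightarrow> ys i \<in> F" "inj_on ys {..<2 * t}"
    and e: "\<And>i. Suc i < 2 * t \<Longrightarrow> {ys i, ys (Suc i)} \<in> E"
  shows "long_chain t F f"
proof -
  have ne: "ys i \<noteq> ys j" if "i < 2 * t" "j < 2 * t" "i \<noteq> j" for i j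
    using ys(2) that by (auto simp: inj_on_def)
  have step: "f (ys i) = Some (ys (Suc i)) \<or> f (ys (Suc i)) = Some (ys i)" if "Suc i < 2 * t" for i
    using rootedD(11)[OF r ys(1) ys(1) _ e[OF that]] ne[of i "Suc i"] that by simp
  have turn: "f (ys i) = Some (ys (Suc i))" if "f (ys (Suc i)) = Some (ys (Suc (Suc i)))" "Suc (Suc
      i) < 2 * t" for i
    using step[of i] that ne[of i "Suc (Suc i)"] by auto
  show ?thesis
  proof (cases "f (ys (t - 1)) = Some (ys t)")
    case True
    have up: "f (ys (t - 1 - j)) = Some (ys (Suc (t - 1 - j)))" if "j \<le> t - 1" for j
      using that
    proof (induction j)
      case 0
      then show ?case using True t by simp
    next
      case (Suc j)
      then have "t - 1 - j = Suc (t - 1 - Suc j)" by simp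
      then show ?case using turn[of "t - 1 - Suc j"] Suc by simp
    qed
    have "f (ys i) = Some (ys (Suc i))" if "Suc i < t" for i
      using up[of "t - 1 - i"] that by simp
    then show ?thesis
      unfolding long_chain_def using ys
      by (intro exI[of _ "map ys [0..<t]"]) (auto simp: distinct_map intro: inj_on_subset)
  next
    case False
    have down: "f (ys (Suc (t - 1 + j))) = Some (ys (t - 1 + j))" if "j < t" for j
      using that
    proof (induction j)
      case 0
      then show ?case using False step[of "t - 1"] t by auto
    next
      case (Suc j)
      then show ?case using turn[of "t - 1 + j"] step[of "Suc (t - 1 + j)"] ne[of "t - 1 + j" "Suc
          (Suc (t - 1 + j))"]
        by auto
    qed
    let ?zs = "map (\<lambda>i. ys (2 * t - 1 - i)) [0..<t]"
    have "inj_on (\<lambda>i. ys (2 * t - 1 - i)) {0..<t}"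
    proof (rule inj_onI)
      fix i j assume ij: "i \<in> {0..<t}" "j \<in> {0..<t}" "ys (2 * t - 1 - i) = ys (2 * t - 1 - j)"
      then have "2 * t - 1 - i = 2 * t - 1 - j" by (intro inj_onD[OF ys(2)]) auto
      then show "i = j" using ij by simp
    qed
    moreover have "f (ys (2 * t - 1 - i)) = Some (ys (2 * t - 1 - Suc i))" if "Suc i < t" for i
    proof -
      have "Suc (t - 1 + (t - 1 - i)) = 2 * t - 1 - i" "t - 1 + (t - 1 - i) = 2 * t - 1 - Suc i"
        using that by simp_all
      then show ?thesis using down[of "t - 1 - i"] that by simp
    qed
    ultimately show ?thesis
      unfolding long_chain_def using ys(1)
      by (intro exI[of _ ?zs]) (auto simp: distinct_map)
  qed
qed

text \<open>The cycle has room for \<open>card W + 1\<close> disjoint blocks of \<open>2 * t\<close>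
  consecutive vertices, and by pigeonhole one of them avoids \<open>W\<close>.\<close>

lemma long_chain_of_cycle:
  assumes xs: "is_cycle G xs" "set xs \<subseteq> F \<union> W" and W: "finite W"
    and r: "rooted (edges G) F f rt rk" and t: "0 < t" and len: "Suc (card W) * (2 * t) \<le> length xs"
  shows "long_chain t F f"
proof -
  have d: "distinct xs" and e: "\<And>i. i < length xs \<Longrightarrow> {xs ! i, xs ! (Suc i mod length xs)} \<in> edges G"
    using xs(1) by (auto simp: is_cycle_def)
  have block: "j * (2 * t) + i < length xs" if "j \<le> card W" "i < 2 * t" for i j
  proof -
    have "j * (2 * t) + i < Suc j * (2 * t)" using that by simp
    also have "\<dots> \<le> Suc (card W) * (2 * t)" using that by (intro mult_le_mono1) simp
    finally show ?thesis using len by simp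
  qed
  have "\<exists>j\<le>card W. \<forall>i<2 * t. xs ! (j * (2 * t) + i) \<notin> W"
  proof (rule ccontr)
    assume "\<not> ?thesis"
    then have "\<forall>j\<in>{..card W}. \<exists>i. i < 2 * t \<and> xs ! (j * (2 * t) + i) \<in> W" by auto
    then obtain i where i: "\<And>j. j \<le> card W \<Longrightarrow> i j < 2 * t" "\<And>j. j \<le> card W \<Longrightarrow> xs ! (j * (2 * t) + i j) \<in> W"
      by (auto dest!: bchoice)
    have "inj_on (\<lambda>j. xs ! (j * (2 * t) + i j)) {..card W}"
    proof (rule inj_onI)
      fix j l assume jl: "j \<in> {..card W}" "l \<in> {..card W}" "xs ! (j * (2 * t) + i j) = xs ! (l * (2 * t) + i l)"
      then have "j * (2 * t) + i j = l * (2 * t) + i l"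
        using d block i(1) by (simp add: nth_eq_iff_index_eq)
      then have "(j * (2 * t) + i j) div (2 * t) = (l * (2 * t) + i l) div (2 * t)" by simp
      then show "j = l" using i(1)[of j] i(1)[of l] jl by simp
    qed
    then have "card {..card W} \<le> card W"
      using i(2) W by (intro card_inj_on_le) auto
    then show False by simp
  qed
  then obtain j where j: "j \<le> card W" "\<And>i. i < 2 * t \<Longrightarrow> xs ! (j * (2 * t) + i) \<notin> W" by auto
  show ?thesis
  proof (rule long_chain_of_path[OF r t, of "\<lambda>i. xs ! (j * (2 * t) + i)"])
    fix i assume i: "i < 2 * t"
    then have "xs ! (j * (2 * t) + i) \<in> set xs" using block[OF j(1)] by simp
    then show "xs ! (j * (2 * t) + i) \<in> F" using xs(2) j(2)[OF i] by auto
  next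
    show "inj_on (\<lambda>i. xs ! (j * (2 * t) + i)) {..<2 * t}"
      using d block[OF j(1)] by (auto intro!: inj_onI simp: nth_eq_iff_index_eq)
  next
    fix i assume "Suc i < 2 * t"
    then have "j * (2 * t) + Suc i < length xs" using block[OF j(1)] by blast
    then show "{xs ! (j * (2 * t) + i), xs ! (j * (2 * t) + Suc i)} \<in> edges G"
      using e[of "j * (2 * t) + i"] by simp
  qed
qed

text \<open>The ends of a maximal matching off \<open>P\<close>, together with \<open>P\<close>,
  cover all forest edges. With fewer than \<open>m\<close> matching edges this cover would have at
  most \<open>c\<close> vertices.\<close>

lemma matching_of_no_cover:
  assumes F: "finite F" and r: "rooted E F f rt rk" and P: "P \<subseteq> F" "card P + 2 * m \<le> c"
    and nc: "\<not> small_cover c F f"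
  shows "\<exists>M\<subseteq>E. card M = m \<and> finite M \<and> (\<forall>e\<in>M. e \<subseteq> F - P \<and> card e = 2) \<and>
    (\<forall>e\<in>M. \<forall>e'\<in>M. e \<noteq> e' \<longrightarrow> e \<inter> e' = {})"
proof -
  define Q where "Q M \<longleftrightarrow> M \<subseteq> {e \<in> E. e \<subseteq> F - P \<and> card e = 2} \<and> (\<forall>e\<in>M. \<forall>e'\<in>M. e \<noteq> e' \<longrightarrow> e \<inter> e' = {})" for M
  have fin: "finite M" "card M \<le> card (Pow F)" if "Q M" for M
  proof -
    have "M \<subseteq> Pow F" using that by (auto simp: Q_def)
    then show "finite M" "card M \<le> card (Pow F)"
      using F by (auto intro: finite_subset[of M "Pow F"] card_mono)
  qed
  have "\<exists>M. Q M \<and> m \<le> card M"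
  proof (rule ccontr)
    assume no: "\<not> (\<exists>M. Q M \<and> m \<le> card M)"
    have "Q {}" by (simp add: Q_def)
    moreover have "\<forall>M. Q M \<longrightarrow> card M < Suc (card (Pow F))" using fin(2) by (simp add: less_Suc_eq_le)
    ultimately have "\<exists>M. Q M \<and> (\<forall>M'. Q M' \<longrightarrow> card M' \<le> card M)" by (rule ex_has_greatest_nat)
    then obtain M where M: "Q M" "\<And>M'. Q M' \<Longrightarrow> card M' \<le> card M" by auto
    have "small_cover c F f"
      unfolding small_cover_def
    proof (intro exI[of _ "P \<union> \<Union>M"] conjI ballI allI impI)
      show "P \<union> \<Union>M \<subseteq> F" using P M(1) by (auto simp: Q_def)
      have "card (P \<union> \<Union>M) \<le> card P + card (\<Union>M)" by (rule card_Un_le)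
      also have "card (\<Union>M) \<le> (\<Sum>e\<in>M. card e)" by (rule card_Union_le_sum_card)
      also have "\<dots> = (\<Sum>e\<in>M. 2)" using M(1) by (intro sum.cong) (auto simp: Q_def)
      also have "\<dots> = 2 * card M" by simp
      also have "card P + 2 * card M \<le> c" using no M(1) P(2) by force
      finally show "card (P \<union> \<Union>M) \<le> c" by simp
    next
      fix x y assume x: "x \<in> F - (P \<union> \<Union>M)" and y: "f x = Some y"
      then have xy: "y \<in> F" "x \<noteq> y" "{x, y} \<in> E" using rootedD(6-8)[OF r, of x y] by auto
      show "y \<in> P \<union> \<Union>M"
      proof (rule ccontr)
        assume ny: "y \<notin> P \<union> \<Union>M"
        have "Q (insert {x, y} M)" using M(1) x ny xy by (auto simp: Q_def)
        then have "card (insert {x, y} M) \<le> card M" by (rule M(2))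
        moreover have "{x, y} \<notin> M" using x by auto
        ultimately show False using fin(1)[OF M(1)] by simp
      qed
    qed
    with nc show False by contradiction
  qed
  then obtain M where "Q M" "m \<le> card M" by blast
  then obtain M' where M': "M' \<subseteq> M" "card M' = m" by (meson obtain_subset_with_card_n)
  then have "Q M'" using \<open>Q M\<close> unfolding Q_def by (meson subset_eq)
  then show ?thesis
    using M' fin(1)[OF \<open>Q M'\<close>] unfolding Q_def by (intro exI[of _ M']) blast
qed

text \<open>The graphs in \<open>Ex (k + 1) C\<close> for which \<open>B\<close> and \<open>W\<close> are the major and minor parts of a blocker,
  but \<open>B\<close> alone is not a blocker.\<close>

definition bad_graphs :: "'a set \<Rightarrow> 'a set \<Rightarrow> 'a set \<Rightarrow> nat \<Rightarrow> 'a set set set" where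
  "bad_graphs V B W k = {E. E \<subseteq> {e. e \<subseteq> V \<and> card e = 2} \<and> acyc E (V - B - W) \<and>
     (\<forall>w\<in>W. acyc E (insert w (V - B - W))) \<and> \<not> pack E V (Suc k) \<and> \<not> acyc E (V - B)}"

lemma bad_graphs_edge:
  assumes "E \<in> bad_graphs V B W k" "e \<in> E"
  obtains x y where "e = {x, y}" "x \<noteq> y" "x \<in> V" "y \<in> V"
proof -
  have "e \<subseteq> V" "card e = 2" using assms by (auto simp: bad_graphs_def)
  then show ?thesis using that by (auto simp: card_2_iff)
qed

text \<open>An edge lies in \<open>V - B\<close>, lies in \<open>B \<union> W\<close>, or joins
  \<open>B\<close> to the forest. The hypotheses fix the first two kinds.\<close>

lemma inj_on_attachments:
  assumes "\<G> \<subseteq> bad_graphs V B W k"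
    "\<And>E E'. E \<in> \<G> \<Longrightarrow> E' \<in> \<G> \<Longrightarrow> E \<inter> Pow (V - B) = E' \<inter> Pow (V - B)"
    "\<And>E E'. E \<in> \<G> \<Longrightarrow> E' \<in> \<G> \<Longrightarrow> E \<inter> Pow (B \<union> W) = E' \<inter> Pow (B \<union> W)"
  shows "inj_on (\<lambda>E. \<lambda>b\<in>B. nb E (V - B - W) b) \<G>"
proof (rule inj_onI)
  let ?F = "V - B - W"
  fix E1 E2 assume E12: "E1 \<in> \<G>" "E2 \<in> \<G>" "(\<lambda>b\<in>B. nb E1 ?F b) = (\<lambda>b\<in>B. nb E2 ?F b)"
  have sub: "E \<subseteq> E'" if E: "E \<in> \<G>" "E' \<in> \<G>" "(\<lambda>b\<in>B. nb E ?F b) = (\<lambda>b\<in>B. nb E' ?F b)" for E E'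
  proof
    fix e assume e: "e \<in> E"
    have eq: "nb E ?F b = nb E' ?F b" if "b \<in> B" for b
      using fun_cong[OF E(3), of b] that by (simp only: restrict_apply')
    have "E \<in> bad_graphs V B W k" using E(1) assms(1) by blast
    then obtain x y where xy: "e = {x, y}" "x \<noteq> y" "x \<in> V" "y \<in> V"
      using e by (rule bad_graphs_edge)
    have mixed: "{b, z} \<in> E'" if "b \<in> B" "z \<in> ?F" "{b, z} \<in> E" for b z
    proof -
      have "z \<in> nb E ?F b" using that by (auto simp: nb_def)
      then show ?thesis unfolding eq[OF that(1)] by (simp add: nb_def)
    qed
    consider "e \<in> Pow (V - B)" | "e \<in> Pow (B \<union> W)" | "x \<in> B" "y \<in> ?F" | "y \<in> B" "x \<in> ?F"
      using xy by auto
    then show "e \<in> E'"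
    proof cases
      case 1 then show ?thesis using assms(2)[OF E(1,2)] e by blast
    next
      case 2 then show ?thesis using assms(3)[OF E(1,2)] e by blast
    next
      case 3 then show ?thesis using mixed[of x y] e xy by simp
    next
      case 4 then show ?thesis using mixed[of y x] e xy by (simp add: insert_commute)
    qed
  qed
  show "E1 = E2" using sub[OF E12] sub[OF E12(2,1) E12(3)[symmetric]] by (rule equalityI)
qed

text \<open>The trivial bound, which suffices for the exceptional parent functions because these are
  rare themselves.\<close>

lemma card_fibre_le:
  assumes V: "finite V" "B \<subseteq> V" "card B \<le> k" and G: "\<G> \<subseteq> bad_graphs V B W k"
    "\<And>E E'. E \<in> \<G> \<Longrightarrow> E' \<in> \<G> \<Longrightarrow> E \<inter> Pow (V - B) = E' \<inter> Pow (V - B)"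
    "\<And>E E'. E \<in> \<G> \<Longrightarrow> E' \<in> \<G> \<Longrightarrow> E \<inter> Pow (B \<union> W) = E' \<inter> Pow (B \<union> W)"
  shows "real (card \<G>) \<le> 2 ^ (k * card (V - B - W))"
proof -
  let ?F = "V - B - W"
  have finB: "finite B" using V finite_subset by blast
  have "card \<G> \<le> card (\<Pi>\<^sub>E b\<in>B. Pow ?F)"
    using finB V by (intro card_inj_on_le[OF inj_on_attachments[OF G]] finite_PiE) (auto simp: nb_def)
  also have "\<dots> = (2 ^ card ?F) ^ card B" using finB V by (simp add: card_PiE card_Pow)
  also have "\<dots> \<le> (2 ^ card ?F) ^ k" using V by (intro power_increasing) auto
  finally have "real (card \<G>) \<le> real ((2 ^ card ?F) ^ k)" by (rule of_nat_mono)
  then show ?thesis by (simp add: power_mult[symmetric] mult.commute)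
qed

text \<open>The graph without \<open>B\<close> has a cycle \<open>xs\<close>. When the forest has neither a long chain nor a small
  cover, it contains \<open>k\<close> disjoint matchings of size \<open>t\<close> off \<open>xs\<close>. If every \<open>b \<in> B\<close> were joined to both ends
  of an edge of its matching, there would be \<open>k\<close> triangles disjoint from each other and from \<open>xs\<close>.\<close>

lemma card_fibre_good_le:
  assumes V: "finite V" "B \<subseteq> V" "W \<subseteq> V" "B \<inter> W = {}" "card B \<le> k" "0 < k" and G: "\<G> \<subseteq> bad_graphs V B W k"
    "\<And>E E'. E \<in> \<G> \<Longrightarrow> E' \<in> \<G> \<Longrightarrow> E \<inter> Pow (V - B) = E' \<inter> Pow (V - B)"
    "\<And>E E'. E \<in> \<G> \<Longrightarrow> E' \<in> \<G> \<Longrightarrow> E \<inter> Pow (B \<union> W) = E' \<inter> Pow (B \<union> W)"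
    and E0: "E0 \<in> \<G>" and r: "rooted E0 (V - B - W) f rt rk"
    and t: "0 < t" "t \<le> card (V - B - W)"
    and good: "\<not> long_chain t (V - B - W) f" "\<not> small_cover (Suc w * (2 * t) + 2 * (k * t)) (V - B - W) f"
    and w: "card W \<le> w"
  shows "real (card \<G>) \<le> real k * 2 ^ (k * card (V - B - W)) * (3 / 4) ^ t"
proof -
  define F where "F = V - B - W"
  let ?N = "card F"
  have finB: "finite B" and finF: "finite F" and finW: "finite W" using V finite_subset by (auto simp: F_def)
  let ?h = "\<lambda>E. \<lambda>b\<in>B. nb E F b"
  have inj: "inj_on ?h \<G>" unfolding F_def by (rule inj_on_attachments[OF G])
  have VB: "V - B = F \<union> W" using V by (auto simp: F_def)
  have E0bad: "E0 \<in> bad_graphs V B W k" using E0 G(1) by blast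
  show ?thesis
  proof (cases "card B = k")
    \<comment> \<open>One missing vertex of \<open>B\<close> saves a factor 2 ^
      \<open>card F\<close>, more than is needed.\<close>
    case False
    have "card \<G> \<le> card (\<Pi>\<^sub>E b\<in>B. Pow F)"
      using finB finF by (intro card_inj_on_le[OF inj] finite_PiE) (auto simp: nb_def)
    also have "\<dots> = (2 ^ ?N) ^ card B" using finB finF by (simp add: card_PiE card_Pow)
    also have "\<dots> \<le> (2 ^ ?N) ^ (k - 1)" using V False by (intro power_increasing) auto
    finally have "real (card \<G>) \<le> real ((2 ^ ?N) ^ (k - 1))" by (rule of_nat_mono)
    also have "\<dots> = 2 ^ (?N * (k - 1))" by (simp add: power_mult)
    also have "\<dots> = 2 ^ (?N * (k - 1)) * (2 ^ ?N * (1 / 2) ^ ?N)" by (simp add: power_mult_distrib[symmetric])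
    also have "\<dots> = 2 ^ (k * ?N) * (1 / 2) ^ ?N"
      using V(6) by (cases k) (simp_all add: power_add mult_ac)
    also have "\<dots> \<le> 2 ^ (k * ?N) * (3 / 4) ^ t"
    proof (rule mult_left_mono)
      have "(1 / 2 :: real) ^ ?N \<le> (1 / 2) ^ t" using t(2) by (intro power_decreasing) (auto simp: F_def)
      also have "\<dots> \<le> (3 / 4) ^ t" by (intro power_mono) auto
      finally show "(1 / 2 :: real) ^ ?N \<le> (3 / 4) ^ t" .
    qed simp
    also have "\<dots> \<le> real k * (2 ^ (k * ?N) * (3 / 4) ^ t)"
      using V(6) mult_right_mono[of 1 "real k" "2 ^ (k * ?N) * (3 / 4) ^ t"] by simp
    finally show ?thesis by (simp add: F_def mult.assoc)
  next
    case True
    obtain Y where Y: "Y \<subseteq> V - B" "core E0 Y" using E0bad by (auto simp: bad_graphs_def acyc_def)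
    obtain xs where xs: "is_cycle (V - B, E0) xs" "set xs \<subseteq> Y" using is_cycle_of_core[OF Y(2,1)] by blast
    have xsVB: "set xs \<subseteq> V - B" using xs(2) Y(1) by blast
    have "length xs < Suc (card W) * (2 * t)"
    proof (rule ccontr)
      assume "\<not> length xs < Suc (card W) * (2 * t)"
      then have "Suc (card W) * (2 * t) \<le> length xs" by (rule leI)
      moreover have "is_cycle (F \<union> W, E0) xs" "set xs \<subseteq> F \<union> W" using xs(1) xsVB VB by simp_all
      ultimately have "long_chain t F f"
        using finW r[folded F_def] t(1) by (intro long_chain_of_cycle[of "(F \<union> W, E0)"]) simp_all
      then show False using good(1) by (simp add: F_def)
    qed
    moreover have "Suc (card W) * (2 * t) \<le> Suc w * (2 * t)" using w by (intro mult_le_mono1) simp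
    moreover have "card (set xs \<inter> F) \<le> length xs"
      by (meson List.finite_set Int_lower1 card_length card_mono le_trans)
    ultimately have "card (set xs \<inter> F) + 2 * (k * t) \<le> Suc w * (2 * t) + 2 * (k * t)" by linarith
    then obtain M where M: "M \<subseteq> E0" "card M = k * t" "finite M" "\<And>e. e \<in> M \<Longrightarrow> e \<subseteq> F - (set xs \<inter> F)"
      "\<And>e. e \<in> M \<Longrightarrow> card e = 2" "\<And>e e'. e \<in> M \<Longrightarrow> e' \<in> M \<Longrightarrow> e \<noteq> e' \<Longrightarrow> e \<inter> e' = {}"
      using matching_of_no_cover[OF finF r[folded F_def] Int_lower2 _ good(2)[folded F_def]] by metis
    \<comment> \<open>The bijection deals the \<open>k * t\<close> matching edges out to the
      vertices of \<open>B\<close>, so that \<open>Mb b\<close> consists of \<open>t\<close> edges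
      reserved for \<open>b\<close>.\<close>
    have "card (B \<times> {..<t}) = card M" using True M finB by (simp add: card_cartesian_product)
    then obtain g where g: "bij_betw g (B \<times> {..<t}) M"
      using finB M(3) finite_same_card_bij by (metis finite_cartesian_product finite_lessThan)
    define Mb where "Mb b = g ` ({b} \<times> {..<t})" for b
    have ginj: "inj_on g (B \<times> {..<t})" and gM: "g ` (B \<times> {..<t}) = M" using g by (auto simp: bij_betw_def)
    have Mb: "Mb b \<subseteq> M" "card (Mb b) = t" "finite (Mb b)" if "b \<in> B" for b
    proof -
      show "Mb b \<subseteq> M" unfolding Mb_def gM[symmetric] using that by (intro image_mono) auto
      have "inj_on g ({b} \<times> {..<t})" using ginj that by (auto intro: inj_on_subset)
      then show "card (Mb b) = t" by (simp add: Mb_def card_image card_cartesian_product)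
    qed (simp add: Mb_def)
    have Mb_disj: "Mb b \<inter> Mb b' = {}" if b: "b \<in> B" "b' \<in> B" "b \<noteq> b'" for b b'
    proof (rule ccontr)
      assume "Mb b \<inter> Mb b' \<noteq> {}"
      then obtain i j where "i < t" "j < t" "g (b, i) = g (b', j)" by (auto simp: Mb_def)
      then have "(b, i) = (b', j)" using b by (intro inj_onD[OF ginj]) auto
      then show False using b by simp
    qed
    let ?free = "\<lambda>b. {S \<in> Pow F. \<forall>e\<in>Mb b. \<not> e \<subseteq> S}"
    define T where "T b b' = (if b' = b then ?free b else Pow F)" for b b'
    have sub: "?h ` \<G> \<subseteq> (\<Union>b\<in>B. PiE B (T b))"
    proof (rule image_subsetI)
      fix E assume E: "E \<in> \<G>"
      have EE0: "e \<in> E \<longleftrightarrow> e \<in> E0" if "e \<subseteq> V - B" for e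
        using G(2)[OF E E0] that by blast
      have "\<exists>b\<in>B. \<forall>e\<in>Mb b. \<not> e \<subseteq> nb E F b"
      proof (rule ccontr)
        assume "\<not> ?thesis"
        then have "\<forall>b\<in>B. \<exists>e. e \<in> Mb b \<and> e \<subseteq> nb E F b" by blast
        then obtain e where e: "\<And>b. b \<in> B \<Longrightarrow> e b \<in> Mb b" "\<And>b. b \<in> B \<Longrightarrow> e b \<subseteq> nb E F b"
          by (auto dest!: bchoice)
        \<comment> \<open>\<open>None\<close> indexes the fixed cycle and \<open>Some b\<close> the
          triangle at \<open>b\<close>, which makes \<open>k + 1\<close> cores.\<close>
        define C where "C u = (case u of None \<Rightarrow> set xs | Some b \<Rightarrow> insert b (e b))" for u
        have "pack E V (card (insert None (Some ` B)))"
        proof (rule pack_family)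
          show "finite (insert None (Some ` B))" using finB by simp
        next
          fix u assume u: "u \<in> insert None (Some ` B)"
          have "insert b (e b) \<subseteq> V" if "b \<in> B" for b
            using e(2)[OF that] nb_subset[of E F b] V(2) that unfolding F_def by blast
          moreover have "set xs \<subseteq> V" using xsVB by blast
          ultimately show "C u \<subseteq> V" using u unfolding C_def by (elim insertE imageE) simp_all
        next
          fix u assume u: "u \<in> insert None (Some ` B)"
          show "core E (C u)"
          proof (cases u)
            case None
            have "core E0 (set xs)" using core_of_is_cycle[OF xs(1)] by simp
            moreover have "nb E (set xs) x = nb E0 (set xs) x" if "x \<in> set xs" for x
            proof -
              have "{x, y} \<subseteq> V - B" if "y \<in> set xs" for y using \<open>x \<in> set xs\<close> that xsVB by auto
              then show ?thesis using EE0 by (auto simp: nb_def)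
            qed
            ultimately show ?thesis using None by (simp add: C_def core_def)
          next
            case (Some b)
            then have b: "b \<in> B" using u by auto
            have eM: "e b \<in> M" using e(1)[OF b] Mb(1)[OF b] by blast
            then obtain p q where pq: "e b = {p, q}" "p \<noteq> q" using M(5)[OF eM] by (auto simp: card_2_iff)
            have "e b \<subseteq> V - B" using M(4)[OF eM] by (auto simp: F_def)
            then have "{p, q} \<in> E" using EE0 eM M(1) pq by auto
            moreover have "{b, p} \<in> E" "{b, q} \<in> E" "p \<noteq> b" "q \<noteq> b" using e(2)[OF b] pq by (auto simp: nb_def)
            ultimately have "core E {b, p, q}" using pq(2) by (intro core_triangle) auto
            then show ?thesis using Some pq by (simp add: C_def)
          qed
        next
          fix u u' assume u: "u \<in> insert None (Some ` B)" "u' \<in> insert None (Some ` B)" "u \<noteq> u'"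
          have eF: "e b \<subseteq> F" "e b \<inter> set xs = {}" if "b \<in> B" for b
          proof -
            have "e b \<in> M" using e(1)[OF that] Mb(1)[OF that] by blast
            then have "e b \<subseteq> F - (set xs \<inter> F)" by (rule M(4))
            then show "e b \<subseteq> F" "e b \<inter> set xs = {}" by auto
          qed
          have ee: "e b \<inter> e b' = {}" if "b \<in> B" "b' \<in> B" "b \<noteq> b'" for b b'
          proof (rule M(6))
            show "e b \<in> M" "e b' \<in> M" using e(1) Mb(1) that by blast+
            show "e b \<noteq> e b'" using e(1)[OF that(1)] e(1)[OF that(2)] Mb_disj[OF that] by auto
          qed
          have BF: "b \<notin> F" "b \<notin> set xs" if "b \<in> B" for b using that xsVB by (auto simp: F_def)
          have none: "set xs \<inter> insert b (e b) = {}" if "b \<in> B" for b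
            using eF[OF that] BF[OF that] by auto
          have some: "insert b (e b) \<inter> insert b' (e b') = {}" if "b \<in> B" "b' \<in> B" "b \<noteq> b'" for b b'
            using ee[OF that] eF(1)[OF that(1)] eF(1)[OF that(2)] BF(1)[OF that(1)] BF(1)[OF that(2)] that(3)
            by blast
          show "C u \<inter> C u' = {}"
          proof (cases u; cases u')
            fix b assume "u = None" "u' = Some b"
            then show ?thesis using none[of b] u unfolding C_def by auto
          next
            fix b assume "u = Some b" "u' = None"
            then show ?thesis using none[of b] u unfolding C_def by auto
          next
            fix b b' assume "u = Some b" "u' = Some b'"
            then show ?thesis using some[of b b'] u unfolding C_def by auto
          qed (use u in simp)
        qed
        moreover have "card (insert None (Some ` B)) = Suc k" using finB True by (simp add: card_image)
        moreover have "\<not> pack E V (Suc k)" using E G(1) by (auto simp: bad_graphs_def)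
        ultimately show False by simp
      qed
      then obtain b where b: "b \<in> B" "\<forall>e\<in>Mb b. \<not> e \<subseteq> nb E F b" by blast
      then have "?h E \<in> PiE B (T b)" by (auto simp: T_def nb_def)
      then show "?h E \<in> (\<Union>b\<in>B. PiE B (T b))" using b(1) by blast
    qed
    have finT: "finite (T b b')" for b b' using finF by (simp add: T_def)
    have "card \<G> \<le> card (\<Union>b\<in>B. PiE B (T b))"
      using sub finB finT by (intro card_inj_on_le[OF inj]) (auto intro!: finite_PiE)
    also have "\<dots> \<le> (\<Sum>b\<in>B. card (PiE B (T b)))" using finB by (rule card_UN_le)
    finally have "real (card \<G>) \<le> (\<Sum>b\<in>B. real (card (PiE B (T b))))" by (simp flip: of_nat_sum)
    also have "\<dots> \<le> (\<Sum>b\<in>B. 2 ^ (k * ?N) * (3 / 4) ^ t)"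
    proof (rule sum_mono)
      fix b assume b: "b \<in> B"
      \<comment> \<open>Only the failing vertex \<open>b\<close> is restricted; the other
        \<open>k - 1\<close> neighbourhoods are arbitrary.\<close>
      have "card (PiE B (T b)) = card (?free b) * (\<Prod>b'\<in>B - {b}. 2 ^ ?N)"
        using finB finF b by (simp add: card_PiE prod.remove[OF finB b] T_def card_Pow)
      also have "\<dots> = card (?free b) * (2 ^ ?N) ^ (k - 1)" using finB b True by simp
      finally have "real (card (PiE B (T b))) = real (card (?free b)) * (2 ^ ?N) ^ (k - 1)" by simp
      also have "\<dots> \<le> (2 ^ ?N * (3 / 4) ^ card (Mb b)) * (2 ^ ?N) ^ (k - 1)"
      proof (intro mult_right_mono card_no_pair_subset)
        fix e assume "e \<in> Mb b"
        then have "e \<in> M" using Mb(1)[OF b] by blast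
        then show "e \<subseteq> F \<and> card e = 2" using M(4,5) by blast
      next
        fix e e' assume "e \<in> Mb b" "e' \<in> Mb b" "e \<noteq> e'"
        then show "e \<inter> e' = {}" using M(6) Mb(1)[OF b] by blast
      qed (use Mb(3)[OF b] finF in auto)
      also have "\<dots> = (2 ^ ?N) ^ Suc (k - 1) * (3 / 4) ^ t" using Mb(2)[OF b] by simp
      also have "(2 ^ ?N) ^ Suc (k - 1) = (2::real) ^ (k * ?N)"
        using V(6) by (simp add: power_mult[symmetric] mult.commute)
      finally show "real (card (PiE B (T b))) \<le> 2 ^ (k * ?N) * (3 / 4) ^ t" .
    qed
    finally show ?thesis using True by (simp add: F_def)
  qed
qed

section \<open>Summing the fibre bounds over all forests\<close>

definition forest_sets :: "'a set \<Rightarrow> 'a set set set" where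
  "forest_sets F = {A. A \<subseteq> {e. e \<subseteq> F \<and> card e = 2} \<and> acyc A F}"

lemma finite_forest_sets: "finite F \<Longrightarrow> finite (forest_sets F)"
  by (rule finite_subset[of _ "Pow (Pow F)"]) (auto simp: forest_sets_def)

lemma rooted_cong:
  assumes "rooted E F f rt rk" "\<And>x. x \<in> F \<Longrightarrow> f x = g x"
  shows "rooted E F g rt rk"
proof -
  note R = rootedD[OF assms(1)]
  show ?thesis
    unfolding rooted_def
  proof (intro conjI ballI allI impI)
    show "inj_on rk F" by (rule R(1))
    fix x assume x: "x \<in> F"
    note g = assms(2)[OF x]
    show "rk x < card F" "rt x \<in> F" using R(2,3) x by blast+
    show "g (rt x) = None" using R(4)[OF x] assms(2)[OF R(3)[OF x]] by simp
    show "rt x = x" if "g x = None" using R(5)[OF x] g that by simp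
    show "y \<in> F" "y \<noteq> x" "{x, y} \<in> E" "rk y < rk x" "rt y = rt x" if "g x = Some y" for y
      using R(6-10)[OF x, of y] g that by simp_all
    show "g x = Some y \<or> g y = Some x" if "y \<in> F" "x \<noteq> y" "{x, y} \<in> E" for y
      using R(11)[OF x that] g assms(2)[OF that(1)] by simp
  qed
qed

text \<open>The parent map must be a function of the edge set alone, so one rooting is chosen for
  every forest. Restricting it to \<open>F\<close> makes it extensional, as membership in
  \<open>parents F\<close> requires.\<close>

lemma exists_rootings:
  assumes F: "finite F"
  shows "\<exists>P RT. (\<forall>A\<in>forest_sets F. P A \<in> parents F \<and> (\<exists>rk. rooted A F (P A) (RT A) rk))"
proof -
  have "\<exists>p. fst p \<in> parents F \<and> (\<exists>rk. rooted A F (fst p) (snd p) rk)" if A: "A \<in> forest_sets F" for A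
  proof -
    have "acyc A F" using A by (simp add: forest_sets_def)
    from exists_rooted[OF F this] obtain f rt rk where r: "rooted A F f rt rk"
      by (elim exE)
    have "f x \<in> insert None (Some ` F)" if "x \<in> F" for x
      using rootedD(6)[OF r that] by (cases "f x") auto
    then have "restrict f F \<in> parents F" by (auto simp: parents_def)
    moreover have "rooted A F (restrict f F) rt rk" by (rule rooted_cong[OF r]) simp
    ultimately show ?thesis by (intro exI[of _ "(restrict f F, rt)"]) auto
  qed
  then have "\<forall>A\<in>forest_sets F. \<exists>p. fst p \<in> parents F \<and> (\<exists>rk. rooted A F (fst p) (snd p) rk)"
    by (rule ballI)
  from bchoice[OF this] obtain p where
    "\<forall>A\<in>forest_sets F. fst (p A) \<in> parents F \<and> (\<exists>rk. rooted A F (fst (p A)) (snd (p A)) rk)"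
    by (elim exE)
  then show ?thesis by (intro exI[of _ "\<lambda>A. fst (p A)"] exI[of _ "\<lambda>A. snd (p A)"]) blast
qed

text \<open>Every edge is a parent edge. Applied in both directions this makes the chosen map from
  forests to parent functions injective.\<close>

lemma rooted_determines:
  assumes "A \<in> forest_sets F" "rooted A F f rt rk" "rooted A' F f rt' rk'"
  shows "A \<subseteq> A'"
proof
  fix e assume e: "e \<in> A"
  then have "e \<subseteq> F" "card e = 2" using assms(1) by (auto simp: forest_sets_def)
  then obtain x y where xy: "e = {x, y}" "x \<noteq> y" "x \<in> F" "y \<in> F" by (auto simp: card_2_iff)
  then have "f x = Some y \<or> f y = Some x" using rootedD(11)[OF assms(2), of x y] e by simp
  then show "e \<in> A'"
    using rootedD(8)[OF assms(3), of x y] rootedD(8)[OF assms(3), of y x] xy by (auto simp: insert_commute)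
qed

text \<open>A bad graph is determined by its edges inside \<open>B \<union> W\<close>, the forest on \<open>F = V - B - W\<close>, and the
  neighbourhoods in \<open>F\<close> of the vertices of \<open>W\<close> (these three make up \<open>\<tau>\<close>) and of \<open>B\<close>. As \<open>v \<in> W\<close> has at most
  one neighbour in each tree, its neighbourhoods are paid for by the weight \<open>K\<close> of the roots.\<close>

lemma card_bad_graphs_le:
  fixes \<eta> K :: real
  assumes V: "finite V" "B \<subseteq> V" "W \<subseteq> V" "B \<inter> W = {}" "card B \<le> k" "0 < k" and w: "card W \<le> w"
    and t: "0 < t" "t \<le> card (V - B - W)"
    and K: "1 \<le> K" "\<And>x. (1 + real x) ^ w \<le> K * exp (\<eta> * real x)"
  shows "real (card (bad_graphs V B W k)) \<le> 2 ^ 2 ^ (k + w) * (exp (\<eta> * real (card (V - B - W))) *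
    (2 ^ (k * card (V - B - W)) *
      ((real k * (3 / 4) ^ t) * (\<Sum>f\<in>parents (V - B - W). wt K (V - B - W) f) +
       ((\<Sum>f\<in>{f \<in> parents (V - B - W). long_chain t (V - B - W) f}. wt K (V - B - W) f) +
        (\<Sum>f\<in>{f \<in> parents (V - B - W). small_cover (Suc w * (2 * t) + 2 * (k * t)) (V - B - W) f}. wt
            K (V - B - W) f)))))"
proof -
  define F where "F = V - B - W"
  let ?N = "card F"
  let ?lc = "long_chain t F" and ?sc = "small_cover (Suc w * (2 * t) + 2 * (k * t)) F"
  define c :: "('a \<Rightarrow> 'a option) \<Rightarrow> real" where
    \<comment> \<open>The fibre bound: trivial for the two exceptional types of forest, and with the
      matching saving otherwise.\<close>
    "c f = (if ?lc f \<or> ?sc f then 2 ^ (k * ?N) else real k * 2 ^ (k * ?N) * (3 / 4) ^ t)" for f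
  have finF: "finite F" and finB: "finite B" and finW: "finite W"
    using V finite_subset by (auto simp: F_def)
  obtain P RT where PRT: "\<And>A. A \<in> forest_sets F \<Longrightarrow> P A \<in> parents F \<and> (\<exists>rk. rooted A F (P A) (RT A) rk)"
    using exists_rootings[OF finF] by blast
  define \<D> where "\<D> = bad_graphs V B W k"
  have fin\<D>: "finite \<D>"
    by (rule finite_subset[of _ "Pow (Pow V)"]) (use V in \<open>auto simp: \<D>_def bad_graphs_def\<close>)
  have forest: "E \<inter> Pow F \<in> forest_sets F" if "E \<in> \<D>" for E
  proof -
    have "acyc E F" using that by (simp add: \<D>_def bad_graphs_def F_def)
    then have "acyc (E \<inter> Pow F) F" unfolding acyc_def using core_edge_mono[of "E \<inter> Pow F" _ E] by blast
    then show ?thesis using that by (auto simp: forest_sets_def \<D>_def bad_graphs_def)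
  qed
  \<comment> \<open>Everything about a graph except the edges between \<open>B\<close> and
    \<open>F\<close>.\<close>
  define \<tau> where "\<tau> E = (E \<inter> Pow (B \<union> W), E \<inter> Pow F, \<lambda>v\<in>W. nb E F v)" for E
  define Att where "Att A = (\<Pi>\<^sub>E v\<in>W. {M. M \<subseteq> F \<and> (\<forall>\<rho>\<in>{x \<in> F. P A x = None}. card (M \<inter> {x \<in> F. RT A
      x = \<rho>}) \<le> 1)})" for A
  have finAtt: "finite (Att A)" for A unfolding Att_def using finW finF by (intro finite_PiE) auto
  define Z where "Z = Pow (Pow (B \<union> W)) \<times> (SIGMA A:forest_sets F. Att A)"
  have finZ: "finite Z"
    unfolding Z_def using finB finW
    by (intro finite_cartesian_product finite_SigmaI finAtt finite_forest_sets[OF finF]) simp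
  have \<tau>Z: "\<tau> ` \<D> \<subseteq> Z"
  proof (rule image_subsetI)
    fix E assume E: "E \<in> \<D>"
    let ?A = "E \<inter> Pow F"
    obtain rk where "rooted ?A F (P ?A) (RT ?A) rk" using PRT[OF forest[OF E]] by blast
    then have r: "rooted E F (P ?A) (RT ?A) rk" by (rule rooted_restrict)
    have "card (nb E F v \<inter> {x \<in> F. RT ?A x = \<rho>}) \<le> 1" if "v \<in> W" for v \<rho>
      using E that by (intro attached_at_most_once[OF finF r]) (auto simp: F_def \<D>_def bad_graphs_def)
    then have "(\<lambda>v\<in>W. nb E F v) \<in> Att ?A" unfolding Att_def by (auto simp: nb_def)
    then show "\<tau> E \<in> Z" using forest[OF E] by (auto simp: \<tau>_def Z_def)
  qed
  have fibre: "real (card {E \<in> \<D>. \<tau> E = z}) \<le> c (P (fst (snd z)))" if z: "z \<in> \<tau> ` \<D>" for z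
  proof -
    let ?\<G> = "{E \<in> \<D>. \<tau> E = z}"
    have sub: "?\<G> \<subseteq> bad_graphs V B W k" by (auto simp: \<D>_def)
    have VB: "V - B = F \<union> W" using V by (auto simp: F_def)
    have eq2: "E \<inter> Pow (B \<union> W) = E' \<inter> Pow (B \<union> W)" if "E \<in> ?\<G>" "E' \<in> ?\<G>" for E E'
      using that by (auto simp: \<tau>_def)
    have sub1: "E \<inter> Pow (V - B) \<subseteq> E'" if EE': "E \<in> ?\<G>" "E' \<in> ?\<G>" for E E'
    proof
      fix e assume e: "e \<in> E \<inter> Pow (V - B)"
      have "\<tau> E = \<tau> E'" using EE' by auto
      then have t1: "E \<inter> Pow (B \<union> W) = E' \<inter> Pow (B \<union> W)" and t2: "E \<inter> Pow F = E' \<inter> Pow F"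
        and t3: "(\<lambda>v\<in>W. nb E F v) = (\<lambda>v\<in>W. nb E' F v)" by (auto simp: \<tau>_def)
      have eq: "nb E F v = nb E' F v" if "v \<in> W" for v
        using fun_cong[OF t3, of v] that by (simp only: restrict_apply')
      have mixed: "{v, x} \<in> E'" if "v \<in> W" "x \<in> F" "{v, x} \<in> E" for v x
      proof -
        have "x \<in> nb E F v" using that by (auto simp: nb_def F_def)
        then show ?thesis unfolding eq[OF that(1)] by (simp add: nb_def)
      qed
      have "E \<in> bad_graphs V B W k" "e \<in> E" using EE'(1) e sub by auto
      then obtain x y where xy: "e = {x, y}" "x \<noteq> y" "x \<in> V" "y \<in> V" by (rule bad_graphs_edge)
      consider "e \<in> Pow F" | "e \<in> Pow (B \<union> W)" | "x \<in> W" "y \<in> F" | "y \<in> W" "x \<in> F"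
        using xy e unfolding VB by auto
      then show "e \<in> E'"
      proof cases
        case 1 then show ?thesis using t2 e by blast
      next
        case 2 then show ?thesis using t1 e by blast
      next
        case 3 then show ?thesis using mixed[of x y] e xy by simp
      next
        case 4 then show ?thesis using mixed[of y x] e xy by (simp add: insert_commute)
      qed
    qed
    have eq1: "E \<inter> Pow (V - B) = E' \<inter> Pow (V - B)" if "E \<in> ?\<G>" "E' \<in> ?\<G>" for E E'
      using sub1[OF that] sub1[OF that(2,1)] by blast
    obtain E0 where E0: "E0 \<in> ?\<G>" using z by auto
    have A0: "fst (snd z) = E0 \<inter> Pow F" using E0 by (auto simp: \<tau>_def)
    show ?thesis
    proof (cases "?lc (P (fst (snd z))) \<or> ?sc (P (fst (snd z)))")
      case True
      then show ?thesis
        using card_fibre_le[OF V(1,2,5) sub eq1 eq2] by (simp add: c_def F_def)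
    next
      case False
      obtain rk where "rooted (E0 \<inter> Pow F) F (P (fst (snd z))) (RT (fst (snd z))) rk"
        using PRT[OF forest] E0 unfolding A0 by blast
      then have "rooted E0 F (P (fst (snd z))) (RT (fst (snd z))) rk" by (rule rooted_restrict)
      then have "real (card ?\<G>) \<le> real k * 2 ^ (k * ?N) * (3 / 4) ^ t"
        unfolding F_def using False
        by (intro card_fibre_good_le[OF V sub eq1 eq2 E0 _ t _ _ w]) (auto simp: F_def)
      then show ?thesis using False by (simp add: c_def)
    qed
  qed
  have c0: "0 \<le> c f" for f by (simp add: c_def)
  have att: "real (card (Att A)) \<le> exp (\<eta> * real ?N) * wt K F (P A)" if A: "A \<in> forest_sets F" for A
  proof -
    obtain rk where r: "rooted A F (P A) (RT A) rk" using PRT[OF A] by blast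
    let ?T = "{x \<in> F. P A x = None}"
    let ?p = "\<Prod>\<rho>\<in>?T. 1 + card {x \<in> F. RT A x = \<rho>}"
    have "card (Att A) = card {M. M \<subseteq> F \<and> (\<forall>\<rho>\<in>?T. card (M \<inter> {x \<in> F. RT A x = \<rho>}) \<le> 1)} ^ card W"
      using finW by (simp add: Att_def card_PiE)
    also have "\<dots> \<le> ?p ^ card W"
      using rootedD(3,4)[OF r] by (intro power_mono card_sparse_subsets[OF finF]) auto
    also have "\<dots> \<le> ?p ^ w" using w by (intro power_increasing prod_ge_1) simp_all
    finally have "real (card (Att A)) \<le> real (?p ^ w)" by (rule of_nat_mono)
    also have "\<dots> \<le> exp (\<eta> * real ?N) * wt K F (P A)"
      using finF r K(2) by (rule prod_component_sizes_le)
    finally show ?thesis .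
  qed
  have injP: "inj_on P (forest_sets F)"
  proof (rule inj_onI)
    fix A A' assume A: "A \<in> forest_sets F" "A' \<in> forest_sets F" "P A = P A'"
    then obtain rk rk' where "rooted A F (P A) (RT A) rk" "rooted A' F (P A) (RT A') rk'"
      using PRT by metis
    then show "A = A'" using A rooted_determines by blast
  qed
  have K0: "0 \<le> K" using K by simp
  have cardBW: "card (B \<union> W) \<le> k + w" using V(5) w card_Un_le[of B W] by linarith
  have "real (card \<D>) = (\<Sum>E\<in>\<D>. 1)" by simp
  also have "\<dots> = (\<Sum>z\<in>\<tau> ` \<D>. \<Sum>E\<in>{E \<in> \<D>. \<tau> E = z}. 1)" using fin\<D> by (rule sum.image_gen)
  also have "\<dots> = (\<Sum>z\<in>\<tau> ` \<D>. real (card {E \<in> \<D>. \<tau> E = z}))" by simp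
  also have "\<dots> \<le> (\<Sum>z\<in>\<tau> ` \<D>. c (P (fst (snd z))))" by (intro sum_mono fibre)
  also have "\<dots> \<le> (\<Sum>z\<in>Z. c (P (fst (snd z))))" using finZ \<tau>Z c0 by (intro sum_mono2) auto
  also have "\<dots> = real (card (Pow (Pow (B \<union> W)))) * (\<Sum>p\<in>(SIGMA A:forest_sets F. Att A). c (P (fst p)))"
    unfolding Z_def sum.cartesian_product[symmetric, of "\<lambda>_ p. c (P (fst p))", unfolded case_prod_beta]
    by (simp add: sum.cartesian_product[symmetric] case_prod_beta[symmetric])
  also have "(\<Sum>p\<in>(SIGMA A:forest_sets F. Att A). c (P (fst p))) = (\<Sum>A\<in>forest_sets F. \<Sum>M\<in>Att A. c (P A))"
    using finF finAtt finite_forest_sets by (subst sum.Sigma) (auto simp: case_prod_beta)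
  also have "\<dots> = (\<Sum>A\<in>forest_sets F. real (card (Att A)) * c (P A))" by simp
  also have "real (card (Pow (Pow (B \<union> W)))) * (\<Sum>A\<in>forest_sets F. real (card (Att A)) * c (P A)) \<le>
      2 ^ 2 ^ (k + w) * (exp (\<eta> * real ?N) * (\<Sum>f\<in>parents F. wt K F f * c f))"
  proof (rule mult_mono)
    have "(2::nat) ^ card (B \<union> W) \<le> 2 ^ (k + w)" using cardBW by (intro power_increasing) auto
    then have "(2::real) ^ 2 ^ card (B \<union> W) \<le> 2 ^ 2 ^ (k + w)" by (intro power_increasing) auto
    then show "real (card (Pow (Pow (B \<union> W)))) \<le> 2 ^ 2 ^ (k + w)"
      using finB finW by (simp add: card_Pow)
    have "(\<Sum>A\<in>forest_sets F. real (card (Att A)) * c (P A)) \<le>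
        (\<Sum>A\<in>forest_sets F. (exp (\<eta> * real ?N) * wt K F (P A)) * c (P A))"
      by (intro sum_mono mult_right_mono att c0)
    \<comment> \<open>Injectivity of \<open>P\<close> turns the sum over forests into one over some
      parent functions, which may then be enlarged to all of them.\<close>
    also have "\<dots> = exp (\<eta> * real ?N) * (\<Sum>f\<in>P ` forest_sets F. wt K F f * c f)"
      by (simp add: sum.reindex[OF injP] sum_distrib_left mult.assoc)
    also have "\<dots> \<le> exp (\<eta> * real ?N) * (\<Sum>f\<in>parents F. wt K F f * c f)"
      using PRT finite_parents[OF finF] c0 wt_nonneg[OF K0]
      by (intro mult_left_mono sum_mono2 mult_nonneg_nonneg) auto
    finally show "(\<Sum>A\<in>forest_sets F. real (card (Att A)) * c (P A)) \<le> exp (\<eta> * real ?N) *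
        (\<Sum>f\<in>parents F. wt K F f * c f)" .
  qed (auto intro!: sum_nonneg mult_nonneg_nonneg c0)
  also have "(\<Sum>f\<in>parents F. wt K F f * c f) \<le> (\<Sum>f\<in>parents F. 2 ^ (k * ?N) * ((real k * (3 / 4) ^ t) * wt K F f +
      ((if ?lc f then wt K F f else 0) + (if ?sc f then wt K F f else 0))))"
  proof (rule sum_mono)
    fix f
    show "wt K F f * c f \<le> 2 ^ (k * ?N) * ((real k * (3 / 4) ^ t) * wt K F f +
        ((if ?lc f then wt K F f else 0) + (if ?sc f then wt K F f else 0)))"
      using wt_nonneg[OF K0, of F f] by (simp add: c_def algebra_simps)
  qed
  also have "\<dots> = 2 ^ (k * ?N) * ((real k * (3 / 4) ^ t) * (\<Sum>f\<in>parents F. wt K F f) +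
      ((\<Sum>f\<in>{f \<in> parents F. ?lc f}. wt K F f) + (\<Sum>f\<in>{f \<in> parents F. ?sc f}. wt K F f)))"
    using finite_parents[OF finF]
    by (simp add: sum_distrib_left[symmetric] sum.distrib sum.inter_filter[symmetric])
  finally show ?thesis unfolding \<D>_def F_def by simp
qed

section \<open>Lower bound and comparison\<close>

text \<open>Forests on \<open>A \<union> R\<close> rooted at \<open>R\<close>, given by parents \<open>f\<close> of smaller depth \<open>lvl\<close>.\<close>

definition layered :: "'a set \<Rightarrow> 'a set \<Rightarrow> 'a set set set" where
  "layered A R = {E. \<exists>f (lvl :: 'a \<Rightarrow> nat).
     (\<forall>x\<in>A. f x \<in> A \<union> R \<and> lvl (f x) < lvl x) \<and> E = (\<lambda>x. {x, f x}) ` A}"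

lemma layered_edge:
  assumes "E \<in> layered A R" "e \<in> E"
  shows "e \<subseteq> A \<union> R" "card e = 2"
proof -
  obtain f and lvl :: "'a \<Rightarrow> nat" where f: "\<And>x. x \<in> A \<Longrightarrow> f x \<in> A \<union> R \<and> lvl (f x) < lvl x" "E = (\<lambda>x. {x, f x}) ` A"
    using assms(1) by (auto simp: layered_def)
  obtain x where x: "x \<in> A" "e = {x, f x}" using assms(2) f(2) by auto
  moreover have "x \<noteq> f x" using f(1)[OF x(1)] by (metis less_irrefl)
  ultimately show "e \<subseteq> A \<union> R" "card e = 2" using f(1)[OF x(1)] by auto
qed

text \<open>A vertex of maximal level in a core could have only its parent as a neighbour
  there.\<close>

lemma layered_acyc:
  assumes "E \<in> layered A R"
  shows "acyc E X"
  unfolding acyc_def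
proof (intro allI impI notI)
  fix Y assume Y: "Y \<subseteq> X" "core E Y"
  obtain f and lvl :: "'a \<Rightarrow> nat" where f: "\<And>x. x \<in> A \<Longrightarrow> f x \<in> A \<union> R \<and> lvl (f x) < lvl x" "E = (\<lambda>x. {x, f x}) ` A"
    using assms(1) by (auto simp: layered_def)
  have finY: "finite Y" "Y \<noteq> {}" using Y(2) coreD by blast+
  have "Max (lvl ` Y) \<in> lvl ` Y" using finY by (intro Max_in) auto
  then obtain y where y: "y \<in> Y" "lvl y = Max (lvl ` Y)" by auto
  have max: "lvl z \<le> lvl y" if "z \<in> Y" for z using y finY that by simp
  have "nb E Y y \<subseteq> {f y}"
  proof
    fix z assume z: "z \<in> nb E Y y"
    then obtain x where x: "x \<in> A" "{y, z} = {x, f x}" "z \<in> Y" using f(2) by (auto simp: nb_def)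
    then show "z \<in> {f y}" using f(1)[OF x(1)] max[OF x(3)] by (auto simp: doubleton_eq_iff)
  qed
  then have "card (nb E Y y) \<le> card {f y}" by (intro card_mono) auto
  then show False using coreD(3)[OF Y(2) y(1)] by simp
qed

lemma sum_Pow_card:
  fixes h :: "nat \<Rightarrow> nat"
  assumes "finite A"
  shows "(\<Sum>S\<in>Pow A. h (card S)) = (\<Sum>s\<le>card A. (card A choose s) * h s)"
proof -
  have "(\<Sum>S\<in>Pow A. h (card S)) = (\<Sum>s\<in>{..card A}. \<Sum>S\<in>{S \<in> Pow A. card S = s}. h (card S))"
    using assms by (intro sum.group[symmetric]) (auto intro: card_mono)
  also have "\<dots> = (\<Sum>s\<le>card A. (card A choose s) * h s)"
  proof (rule sum.cong)
    fix s
    have "(\<Sum>S\<in>{S \<in> Pow A. card S = s}. h (card S)) = (\<Sum>S\<in>{S \<in> Pow A. card S = s}. h s)"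
      by (intro sum.cong) auto
    then show "(\<Sum>S\<in>{S \<in> Pow A. card S = s}. h (card S)) = (card A choose s) * h s"
      using n_subsets[OF assms, of s] by (simp add: Pow_def)
  qed simp
  finally show ?thesis .
qed

text \<open>Peeling off the set \<open>S\<close> of the vertices attached directly to \<open>R\<close>.\<close>

lemma card_layered_ge:
  assumes "finite A" "finite R" "A \<inter> R = {}"
  shows "card R * (card A + card R) ^ card A \<le> card (layered A R) * (card A + card R)"
  using assms
proof (induction "card A" arbitrary: A R rule: less_induct)
  case less
  show ?case
  \<comment> \<open>The count aimed at is r * (m + r) ^ (m - 1) with m = \<open>card A\<close> and r
    = \<open>card R\<close>, Cayley's formula for forests with prescribed roots. The extra factor on
    the right avoids the exponent m - 1 when m = 0.\<close>
  proof (cases "A = {}")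
    case True
    then have "layered A R = {{}}" by (auto simp: layered_def)
    then show ?thesis using True by simp
  next
    case False
    note finA = less.prems(1) and finR = less.prems(2) and AR = less.prems(3)
    let ?m = "card A" and ?r = "card R"
    define I where "I = Pow A - {{}}"
    define X where "X = (SIGMA S:I. (S \<rightarrow>\<^sub>E R) \<times> layered (A - S) S)"
    define \<phi> where "\<phi> p = (\<lambda>x. {x, fst (snd p) x}) ` fst p \<union> snd (snd p)" for p :: "'a set \<times> ('a \<Rightarrow>
        'a) \<times> 'a set set"
    have finL: "finite (layered A' R')" if "finite A'" "finite R'" for A' R' :: "'a set"
      by (rule finite_subset[of _ "Pow (Pow (A' \<union> R'))"]) (use layered_edge(1) that in \<open>blast, simp\<close>)
    have data: "S \<subseteq> A" "g x \<in> R" "E' \<in> layered (A - S) S"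
      if "(S, g, E') \<in> X" "x \<in> S" for S g E' x
      using that by (auto simp: X_def I_def)
    have inE': "e \<subseteq> A" if "(S, g, E') \<in> X" "e \<in> E'" for S g E' e
    proof -
      have "E' \<in> layered (A - S) S" "S \<subseteq> A" using that(1) by (auto simp: X_def I_def)
      then show ?thesis using layered_edge(1)[of E' "A - S" S e] that(2) by auto
    qed
    \<comment> \<open>The edges between \<open>A\<close> and \<open>R\<close> reveal
      \<open>S\<close> and \<open>g\<close>; the edges avoiding \<open>R\<close> reveal
      \<open>E'\<close>.\<close>
    have link: "{x, y} \<in> \<phi> (S, g, E') \<longleftrightarrow> x \<in> S \<and> y = g x"
      if p: "(S, g, E') \<in> X" and xy: "x \<in> A" "y \<in> R" for S g E' x y
    proof
      assume "{x, y} \<in> \<phi> (S, g, E')"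
      moreover have "{x, y} \<notin> E'" using inE'[OF p] xy AR by auto
      ultimately obtain z where z: "z \<in> S" "{x, y} = {z, g z}" by (auto simp: \<phi>_def)
      moreover have "z \<in> A" using data(1)[OF p z(1)] z(1) by auto
      ultimately show "x \<in> S \<and> y = g x" using xy AR by (auto simp: doubleton_eq_iff)
    qed (auto simp: \<phi>_def)
    have rest: "E' = {e \<in> \<phi> (S, g, E'). e \<inter> R = {}}" if p: "(S, g, E') \<in> X" for S g E'
    proof -
      have "{x, g x} \<inter> R \<noteq> {}" if "x \<in> S" for x using data(2)[OF p that] by auto
      moreover have "e \<inter> R = {}" if "e \<in> E'" for e using inE'[OF p that] AR by auto
      ultimately show ?thesis by (auto simp: \<phi>_def)
    qed
    have inj: "inj_on \<phi> X"
    proof (rule inj_onI)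
      fix p p' assume p: "p \<in> X" "p' \<in> X" "\<phi> p = \<phi> p'"
      obtain S g E' where 1: "p = (S, g, E')" by (cases p)
      obtain T h D' where 2: "p' = (T, h, D')" by (cases p')
      have SA: "S \<subseteq> A" "g \<in> S \<rightarrow>\<^sub>E R" "T \<subseteq> A" "h \<in> T \<rightarrow>\<^sub>E R" using p 1 2 by (auto simp: X_def I_def)
      have iff: "x \<in> S \<and> y = g x \<longleftrightarrow> x \<in> T \<and> y = h x" if "x \<in> A" "y \<in> R" for x y
        using link[OF p(1)[unfolded 1] that] link[OF p(2)[unfolded 2] that] p(3) 1 2 by simp
      have "S \<subseteq> T"
      proof
        fix x assume x: "x \<in> S"
        then show "x \<in> T" using iff[of x "g x"] SA by blast
      qed
      moreover have "T \<subseteq> S"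
      proof
        fix x assume x: "x \<in> T"
        then show "x \<in> S" using iff[of x "h x"] SA by blast
      qed
      ultimately have ST: "S = T" by simp
      moreover have "g = h"
      proof (rule PiE_ext[OF SA(2)])
        show "h \<in> S \<rightarrow>\<^sub>E R" using SA ST by simp
        fix x assume "x \<in> S"
        then show "g x = h x" using iff[of x "g x"] SA by blast
      qed
      moreover have "E' = D'" using rest[OF p(1)[unfolded 1]] rest[OF p(2)[unfolded 2]] p(3) 1 2 by simp
      ultimately show "p = p'" using 1 2 by simp
    qed
    have img: "\<phi> ` X \<subseteq> layered A R"
    proof (rule image_subsetI)
      fix p assume p: "p \<in> X"
      obtain S g E' where 1: "p = (S, g, E')" by (cases p)
      have S: "S \<subseteq> A" "\<And>x. x \<in> S \<Longrightarrow> g x \<in> R" "E' \<in> layered (A - S) S" using p 1 by (auto simp: X_def I_def)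
      obtain f and lvl :: "'a \<Rightarrow> nat" where f: "\<And>x. x \<in> A - S \<Longrightarrow> f x \<in> (A - S) \<union> S \<and> lvl (f x) < lvl x"
        "E' = (\<lambda>x. {x, f x}) ` (A - S)"
        using S(3) by (auto simp: layered_def)
      define f' where "f' x = (if x \<in> S then g x else f x)" for x
      \<comment> \<open>Levels are shifted up by one to make room for \<open>R\<close> at level
        0.\<close>
      define lvl' where "lvl' x = (if x \<in> R then 0 else Suc (lvl x))" for x
      have "f' x \<in> A \<union> R \<and> lvl' (f' x) < lvl' x" if x: "x \<in> A" for x
      proof (cases "x \<in> S")
        case True
        then show ?thesis using S(2)[OF True] x AR by (auto simp: f'_def lvl'_def)
      next
        case False
        then have "f x \<in> A" "lvl (f x) < lvl x" using f(1)[of x] x S(1) by auto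
        then show ?thesis using False x AR by (auto simp: f'_def lvl'_def)
      qed
      moreover have "\<phi> p = (\<lambda>x. {x, f' x}) ` A"
      proof -
        have "(\<lambda>x. {x, f' x}) ` A = (\<lambda>x. {x, f' x}) ` S \<union> (\<lambda>x. {x, f' x}) ` (A - S)" using S(1) by blast
        also have "(\<lambda>x. {x, f' x}) ` S = (\<lambda>x. {x, g x}) ` S" by (intro image_cong) (auto simp: f'_def)
        also have "(\<lambda>x. {x, f' x}) ` (A - S) = E'" unfolding f(2) by (intro image_cong) (auto simp: f'_def)
        finally show ?thesis by (simp add: \<phi>_def 1)
      qed
      ultimately show "\<phi> p \<in> layered A R" unfolding layered_def by blast
    qed
    have finI: "finite I" "\<And>S. S \<in> I \<Longrightarrow> finite S" using finA finite_subset by (auto simp: I_def)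
    have "card X = (\<Sum>S\<in>I. card ((S \<rightarrow>\<^sub>E R) \<times> layered (A - S) S))"
      unfolding X_def using finI finA finR
      by (intro card_SigmaI ballI finite_cartesian_product finite_PiE finL) auto
    also have "\<dots> = (\<Sum>S\<in>I. ?r ^ card S * card (layered (A - S) S))"
      using finI by (intro sum.cong) (simp_all add: card_cartesian_product card_funcsetE)
    finally have cX: "card X = (\<Sum>S\<in>I. ?r ^ card S * card (layered (A - S) S))" .
    have XL: "card X \<le> card (layered A R)" using inj img finL[OF finA finR] by (rule card_inj_on_le)
    obtain m' where m': "?m = Suc m'" using False finA by (metis card_0_eq not0_implies_Suc)
    \<comment> \<open>Binomial theorem, then absorption: m * (m - 1 choose s) = (s + 1) * (m choose
      s + 1). The factor s + 1 becomes \<open>card S\<close>, which is the number of roots in the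
      induction hypothesis for \<open>A - S\<close>.\<close>
    have "?m * (?r * (?r + ?m) ^ m') = (\<Sum>s\<le>m'. ?m * (?r * ((m' choose s) * ?r ^ s * ?m ^ (m' - s))))"
      by (simp add: binomial sum_distrib_left)
    also have "\<dots> = (\<Sum>s\<le>m'. (?m choose Suc s) * (?r ^ Suc s * (Suc s * ?m ^ (?m - Suc s))))"
    proof (rule sum.cong)
      fix s
      have "Suc s * (?m choose Suc s) = ?m * (m' choose s)"
        using m' Suc_times_binomial_eq[of m' s] by (simp add: mult.commute)
      then have eq: "(?m choose Suc s) * (?r ^ Suc s * (Suc s * ?m ^ (?m - Suc s))) = ?m * (m'
          choose s) * (?r ^ Suc s * ?m ^ (m' - s))"
        using m' by (metis diff_Suc_Suc mult.assoc mult.left_commute)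
      then show "?m * (?r * ((m' choose s) * ?r ^ s * ?m ^ (m' - s))) = (?m choose Suc s) * (?r ^
          Suc s * (Suc s * ?m ^ (?m - Suc s)))"
        unfolding eq by (simp only: mult_ac power_Suc)
    qed simp
    also have "\<dots> = (\<Sum>s\<le>?m. (?m choose s) * (?r ^ s * (s * ?m ^ (?m - s))))"
      unfolding m' by (subst sum.atMost_Suc_shift) simp
    also have "\<dots> = (\<Sum>S\<in>Pow A. ?r ^ card S * (card S * ?m ^ (?m - card S)))"
      using sum_Pow_card[OF finA, of "\<lambda>s. ?r ^ s * (s * ?m ^ (?m - s))"] by simp
    also have "\<dots> = (\<Sum>S\<in>I. ?r ^ card S * (card S * ?m ^ (?m - card S)))"
      unfolding I_def using finA by (intro sum.mono_neutral_right) auto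
    also have "\<dots> \<le> (\<Sum>S\<in>I. ?r ^ card S * (card (layered (A - S) S) * ?m))"
    proof (intro sum_mono mult_left_mono)
      fix S assume S: "S \<in> I"
      then have SA: "S \<subseteq> A" "S \<noteq> {}" "finite S" using finI by (auto simp: I_def)
      have c: "card (A - S) = ?m - card S" "card S \<le> ?m" "0 < card S"
        using SA finA by (auto simp: card_Diff_subset card_mono card_gt_0_iff)
      have "card S * (card (A - S) + card S) ^ card (A - S) \<le> card (layered (A - S) S) * (card (A -
          S) + card S)"
        using SA finA c by (intro less.hyps) auto
      then show "card S * ?m ^ (?m - card S) \<le> card (layered (A - S) S) * ?m" using c by simp
    qed simp
    also have "\<dots> = ?m * card X" by (simp add: cX sum_distrib_left mult_ac)
    also have "\<dots> \<le> ?m * card (layered A R)" using XL by simp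
    finally have "?r * (?r + ?m) ^ m' \<le> card (layered A R)"
      unfolding mult_le_cancel1 using m' zero_less_Suc[of m'] by (metis (no_types))
    then have "?r * (?r + ?m) ^ m' * (?m + ?r) \<le> card (layered A R) * (?m + ?r)" by (rule mult_le_mono1)
    then show ?thesis by (simp add: m' add.commute mult_ac)
  qed
qed

text \<open>The trees rooted at \<open>m\<close> alone number at least m ^ (m - 2); the factor on
  the right avoids the subtraction.\<close>

lemma card_forest_sets_ge:
  fixes m :: nat
  assumes "0 < m"
  shows "m ^ m \<le> card (forest_sets {1..m}) * m\<^sup>2"
proof -
  have "layered {1..<m} {m} \<subseteq> forest_sets {1..m}"
  proof
    fix E assume E: "E \<in> layered {1..<m} {m}"
    have "{1..<m} \<union> {m} = {1..m}" using assms by auto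
    then show "E \<in> forest_sets {1..m}"
      using layered_edge[OF E] layered_acyc[OF E] by (auto simp: forest_sets_def)
  qed
  then have "card (layered {1..<m} {m}) \<le> card (forest_sets {1..m})"
    by (intro card_mono finite_forest_sets) auto
  moreover have "m ^ (m - 1) \<le> card (layered {1..<m} {m}) * m"
    using card_layered_ge[of "{1..<m}" "{m}"] assms by simp
  ultimately have "m ^ (m - 1) \<le> card (forest_sets {1..m}) * m"
    by (meson le_trans mult_le_mono1)
  then have "m ^ (m - 1) * m \<le> card (forest_sets {1..m}) * m * m" by (rule mult_le_mono1)
  moreover have "m ^ (m - 1) * m = m ^ m" using assms by (metis Suc_diff_1 power_Suc2)
  ultimately show ?thesis by (metis mult.assoc power2_eq_square)
qed

section \<open>Both graph classes on n labelled vertices\<close>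

lemma finite_labelled_apex: "finite (labelled (apex_forests k) n)"
  by (rule finite_labelled) (simp add: apex_forests_def)

lemma finite_labelled_ex: "finite (labelled (ex_disjoint_cycles k) n)"
  by (rule finite_labelled) (simp add: ex_disjoint_cycles_def)

text \<open>The last \<open>k\<close> vertices form an independent blocker with arbitrary
  neighbourhoods in a forest on the others. Fixing the blocker lets both ingredients be read off the
  graph.\<close>

lemma card_apex_ge:
  assumes "k < n"
  shows "2 ^ (k * (n - k)) * card (forest_sets {1..n - k}) \<le> card (labelled (apex_forests k) n)"
proof -
  define m where "m = n - k"
  let ?F = "{1..m}" and ?B = "{m + 1..n}"
  define X where "X = forest_sets ?F \<times> (?B \<rightarrow>\<^sub>E Pow ?F)"
  define \<phi> where "\<phi> p = ({1..n}, fst p \<union> {{b, x} | b x. b \<in> ?B \<and> x \<in> snd p b})" for p :: "nat set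
      set \<times> (nat \<Rightarrow> nat set)"
  have mn: "m \<le> n" "n - m = k" "0 < m" using assms by (auto simp: m_def)
  have sub: "h b \<subseteq> ?F" if "(A, h) \<in> X" "b \<in> ?B" for A h b using that by (auto simp: X_def)
  have A: "e \<subseteq> ?F" "card e = 2" if "(A, h) \<in> X" "e \<in> A" for A h e
    using that by (auto simp: X_def forest_sets_def)
  have part: "A = snd (\<phi> (A, h)) \<inter> Pow ?F" if p: "(A, h) \<in> X" for A h
    using A(1)[OF p] by (auto simp: \<phi>_def)
  have nbh: "x \<in> h b \<longleftrightarrow> {b, x} \<in> snd (\<phi> (A, h)) \<and> x \<in> ?F" if p: "(A, h) \<in> X" and b: "b \<in> ?B" for A h b x
  proof
    assume "x \<in> h b"
    then show "{b, x} \<in> snd (\<phi> (A, h)) \<and> x \<in> ?F" using sub[OF p b] b by (auto simp: \<phi>_def)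
  next
    assume *: "{b, x} \<in> snd (\<phi> (A, h)) \<and> x \<in> ?F"
    moreover have "{b, x} \<notin> A" using A(1)[OF p] b by fastforce
    ultimately obtain b' x' where "{b, x} = {b', x'}" "b' \<in> ?B" "x' \<in> h b'" by (auto simp: \<phi>_def)
    moreover have "x \<notin> ?B" using * by auto
    ultimately show "x \<in> h b" by (auto simp: doubleton_eq_iff)
  qed
  have inj: "inj_on \<phi> X"
  proof (rule inj_onI)
    fix p p' assume p: "p \<in> X" "p' \<in> X" "\<phi> p = \<phi> p'"
    obtain A h where 1: "p = (A, h)" by (cases p)
    obtain A' h' where 2: "p' = (A', h')" by (cases p')
    have "A = A'" using part[OF p(1)[unfolded 1]] part[OF p(2)[unfolded 2]] p(3) 1 2 by simp
    moreover have "h = h'"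
    proof (rule PiE_ext[of _ ?B "\<lambda>_. Pow ?F"])
      fix b assume b: "b \<in> ?B"
      show "h b = h' b"
        using nbh[OF p(1)[unfolded 1] b] nbh[OF p(2)[unfolded 2] b] p(3) 1 2 by auto
    qed (use p 1 2 in \<open>auto simp: X_def\<close>)
    ultimately show "p = p'" using 1 2 by simp
  qed
  have img: "\<phi> ` X \<subseteq> labelled (apex_forests k) n"
  proof (rule image_subsetI)
    fix p assume p: "p \<in> X"
    obtain A h where 1: "p = (A, h)" by (cases p)
    let ?G = "\<phi> (A, h)"
    have V: "verts ?G = {1..n}" by (simp add: \<phi>_def)
    have simple: "simple_graph ?G"
      unfolding simple_graph_def
    proof (intro conjI ballI)
      show "finite (verts ?G)" by (simp add: V)
      fix e assume "e \<in> edges ?G"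
      then consider "e \<in> A" | b x where "e = {b, x}" "b \<in> ?B" "x \<in> h b" by (auto simp: \<phi>_def)
      then have "e \<subseteq> verts ?G \<and> card e = 2"
      proof cases
        case 1
        with A[OF p[unfolded \<open>p = (A, h)\<close>] 1] mn show ?thesis by (auto simp: V)
      next
        case 2
        then have "x \<in> ?F" using sub[of A h b] p \<open>p = (A, h)\<close> by auto
        then show ?thesis using 2 mn by (auto simp: V card_insert_if)
      qed
      then show "e \<subseteq> verts ?G" "card e = 2" by simp_all
    qed
    have VB: "{1..n} - ?B = ?F" using mn by auto
    have "acyc A ?F" using p 1 by (auto simp: X_def forest_sets_def)
    moreover have "core A Y" if "core (edges ?G) Y" "Y \<subseteq> ?F" for Y
    proof -
      have "nb (edges ?G) Y y = nb A Y y" if "y \<in> Y" for y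
        using part[OF p[unfolded 1]] \<open>Y \<subseteq> ?F\<close> that by (auto simp: nb_def)
      then show ?thesis using that(1) by (simp add: core_def)
    qed
    ultimately have "acyc (edges ?G) ?F" by (auto simp: acyc_def)
    then have "blocker ?G ?B"
      unfolding blocker_iff[OF simple] V VB by auto
    moreover have "card ?B \<le> k" using mn by simp
    ultimately show "\<phi> p \<in> labelled (apex_forests k) n"
      using simple V 1 by (auto simp: labelled_def apex_forests_def)
  qed
  have "card X = card (forest_sets ?F) * (2 ^ m) ^ k"
    using mn by (simp add: X_def card_cartesian_product card_funcsetE card_Pow)
  moreover have "card X \<le> card (labelled (apex_forests k) n)"
    using inj img finite_labelled_apex by (rule card_inj_on_le)
  ultimately show ?thesis by (simp add: m_def[symmetric] power_mult[symmetric] mult.commute)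
qed

text \<open>Disjoint cycles need distinct blocker vertices.\<close>

lemma apex_subset_ex: "labelled (apex_forests k) n \<subseteq> labelled (ex_disjoint_cycles (k + 1)) n"
proof
  fix G assume G: "G \<in> labelled (apex_forests k) n"
  then have s: "simple_graph G" by (simp add: labelled_def apex_forests_def)
  obtain B where B: "blocker G B" "card B \<le> k" using G by (auto simp: labelled_def apex_forests_def)
  have B': "B \<subseteq> verts G" "acyc (edges G) (verts G - B)" using B(1) s by (simp_all add: blocker_iff)
  have finB: "finite B" using B' s finite_subset by (auto simp: simple_graph_def)
  have "\<not> pack (edges G) (verts G) (k + 1)"
  proof
    assume pk: "pack (edges G) (verts G) (k + 1)"
    obtain C where C: "\<And>i. i < k + 1 \<Longrightarrow> C i \<subseteq> verts G" "\<And>i. i < k + 1 \<Longrightarrow> core (edges G) (C i)"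
      "\<And>i j. i < k + 1 \<Longrightarrow> j < k + 1 \<Longrightarrow> i \<noteq> j \<Longrightarrow> C i \<inter> C j = {}"
      by (rule packE[OF pk], rule that)
    have "\<exists>b. b \<in> C i \<inter> B" if "i < k + 1" for i
    proof (rule ccontr)
      assume "\<nexists>b. b \<in> C i \<inter> B"
      then have "C i \<subseteq> verts G - B" using C(1)[OF that] by blast
      then show False using B'(2) C(2)[OF that] by (auto simp: acyc_def)
    qed
    then obtain b where b: "\<And>i. i < k + 1 \<Longrightarrow> b i \<in> C i \<inter> B" by metis
    have "inj_on b {..<k + 1}"
    proof (rule inj_onI)
      fix i j assume ij: "i \<in> {..<k + 1}" "j \<in> {..<k + 1}" "b i = b j"
      show "i = j"
      proof (rule ccontr)
        assume "i \<noteq> j"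
        then have "C i \<inter> C j = {}" using C(3) ij by simp
        then show False using b[of i] b[of j] ij by auto
      qed
    qed
    then have "card {..<k + 1} \<le> card B" using b finB by (intro card_inj_on_le[of b]) auto
    then show False using B(2) by simp
  qed
  then show "G \<in> labelled (ex_disjoint_cycles (k + 1)) n"
    using G s by (simp add: labelled_def ex_disjoint_cycles_def has_disjoint_cycles_iff)
qed

text \<open>The set is listed in \<open>k\<close> places, with 0, which is not a vertex, as
  padding.\<close>

lemma card_subsets_le:
  "card {B. B \<subseteq> {1..n::nat} \<and> card B \<le> k} \<le> (n + 1) ^ k"
proof -
  let ?S = "{B. B \<subseteq> {1..n} \<and> card B \<le> k}"
  let ?h = "\<lambda>f :: nat \<Rightarrow> nat. f ` {..<k} - {0}"
  have "?S \<subseteq> ?h ` ({..<k} \<rightarrow>\<^sub>E {0..n})"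
  proof
    fix B assume "B \<in> ?S"
    then have B: "B \<subseteq> {1..n}" "card B \<le> k" "finite B" using finite_subset by auto
    obtain g where g: "bij_betw g {0..<card B} B" using ex_bij_betw_nat_finite[OF B(3)] by blast
    define f where "f = (\<lambda>i\<in>{..<k}. if i < card B then g i else 0)"
    have gB: "g ` {0..<card B} = B" using g by (simp add: bij_betw_def)
    have gi: "g i \<in> B" if "i < card B" for i using g that by (auto simp: bij_betw_def)
    have "g i \<le> n" if "i < card B" for i using gi[OF that] B(1) by auto
    then have "f \<in> {..<k} \<rightarrow>\<^sub>E {0..n}" by (auto simp: f_def)
    moreover have "?h f = B"
    proof
      show "?h f \<subseteq> B" using gi by (auto simp: f_def)
      show "B \<subseteq> ?h f"
      proof
        fix x assume x: "x \<in> B"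
        then have "x \<in> g ` {0..<card B}" using gB by simp
        then obtain i where "i < card B" "x = g i" by auto
        then have "i < k" "f i = x" using B(2) by (auto simp: f_def)
        then show "x \<in> ?h f" using x B(1) by auto
      qed
    qed
    ultimately show "B \<in> ?h ` ({..<k} \<rightarrow>\<^sub>E {0..n})" by blast
  qed
  then have "card ?S \<le> card ({..<k} \<rightarrow>\<^sub>E {0..n})"
    by (meson card_image_le card_mono finite_PiE finite_atLeastAtMost finite_imageI finite_lessThan le_trans)
  then show ?thesis by (simp add: card_funcsetE)
qed

text \<open>Union bound over the decompositions. If the part \<open>B\<close> were a blocker, the
  graph would be in the apex class, so the graph is bad for its pair.\<close>

lemma card_difference_le:
  "card (labelled (ex_disjoint_cycles (k + 1)) n - labelled (apex_forests k) n) \<le>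
    (\<Sum>(B, W)\<in>{(B, W). B \<subseteq> {1..n} \<and> W \<subseteq> {1..n} \<and> B \<inter> W = {} \<and> card B \<le> k \<and> card W \<le> minor_bound k}.
      card (bad_graphs {1..n} B W k))"
proof -
  let ?I = "{(B, W). B \<subseteq> {1..n} \<and> W \<subseteq> {1..n} \<and> B \<inter> W = {} \<and> card B \<le> k \<and> card W \<le> minor_bound k}"
  let ?D = "labelled (ex_disjoint_cycles (k + 1)) n - labelled (apex_forests k) n"
  have finI: "finite ?I" by (rule finite_subset[of _ "Pow {1..n} \<times> Pow {1..n}"]) auto
  have finb: "finite (bad_graphs {1..n} B W k)" for B W
    by (rule finite_subset[of _ "Pow (Pow {1..n})"]) (auto simp: bad_graphs_def)
  have "snd ` ?D \<subseteq> (\<Union>p\<in>?I. bad_graphs {1..n} (fst p) (snd p) k)"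
  proof (rule image_subsetI)
    fix G assume G: "G \<in> ?D"
    then have s: "simple_graph G" "verts G = {1..n}" by (auto simp: labelled_def ex_disjoint_cycles_def)
    have np: "\<not> pack (edges G) {1..n} (Suc k)"
      using G s by (simp add: labelled_def ex_disjoint_cycles_def has_disjoint_cycles_iff)
    obtain B W where BW: "B \<subseteq> {1..n}" "W \<subseteq> {1..n}" "B \<inter> W = {}" "card B \<le> k" "card W \<le> minor_bound k"
      "acyc (edges G) ({1..n} - B - W)" "\<forall>w\<in>W. acyc (edges G) (insert w ({1..n} - B - W))"
      using decomposition[OF _ np] by auto
    have "\<not> acyc (edges G) ({1..n} - B)"
    proof
      assume "acyc (edges G) ({1..n} - B)"
      then have "blocker G B" using s BW by (simp add: blocker_iff)
      then have "G \<in> labelled (apex_forests k) n" using s BW(4) by (auto simp: labelled_def apex_forests_def)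
      then show False using G by simp
    qed
    then have "edges G \<in> bad_graphs {1..n} B W k"
      using s np BW by (auto simp: bad_graphs_def simple_graph_def)
    then show "edges G \<in> (\<Union>p\<in>?I. bad_graphs {1..n} (fst p) (snd p) k)"
      using BW(1-5) by (intro UN_I[of "(B, W)"]) simp_all
  qed
  moreover have "inj_on snd ?D" by (rule inj_onI) (auto simp: labelled_def prod_eq_iff)
  ultimately have "card ?D \<le> card (\<Union>p\<in>?I. bad_graphs {1..n} (fst p) (snd p) k)"
    using finI finb by (intro card_inj_on_le[of snd]) auto
  also have "\<dots> \<le> (\<Sum>p\<in>?I. card (bad_graphs {1..n} (fst p) (snd p) k))" using finI by (rule card_UN_le)
  finally show ?thesis by (simp add: case_prod_beta)
qed

section \<open>Choice of constants and asymptotics\<close>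

text \<open>With a = \<eta> / w and c = max 1 (1 / a), 1 + x \<le> c * (1 + a * x) \<le> c * exp (a
  * x); the w-th power gives \<open>K\<close> = c ^ w.\<close>

lemma exists_exp_dominating_power:
  fixes \<eta> :: real
  assumes "0 < \<eta>"
  shows "\<exists>K\<ge>1. \<forall>x::nat. (1 + real x) ^ w \<le> K * exp (\<eta> * real x)"
proof (cases "w = 0")
  case True
  then show ?thesis using assms by (intro exI[of _ 1]) auto
next
  case False
  define a where "a = \<eta> / real w"
  have a: "0 < a" "real w * a = \<eta>" using False assms by (auto simp: a_def)
  define c where "c = max 1 (1 / a)"
  have c: "1 \<le> c" "1 \<le> c * a" using a by (auto simp: c_def field_simps max_def)
  have "(1 + real x) ^ w \<le> c ^ w * exp (\<eta> * real x)" for x :: nat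
  proof -
    have "1 + real x \<le> c + (c * a) * real x" using c mult_right_mono[of 1 "c * a" "real x"] by simp
    also have "\<dots> = c * (1 + a * real x)" by (simp add: algebra_simps)
    also have "\<dots> \<le> c * exp (a * real x)" using c by (intro mult_left_mono exp_ge_add_one_self) auto
    finally have "(1 + real x) ^ w \<le> (c * exp (a * real x)) ^ w" by (intro power_mono) auto
    also have "\<dots> = c ^ w * exp (real w * (a * real x))" by (simp add: power_mult_distrib exp_of_nat_mult)
    also have "real w * (a * real x) = \<eta> * real x" using a(2) by (metis mult.assoc)
    finally show ?thesis .
  qed
  moreover have "1 \<le> c ^ w" using c(1) by (rule one_le_power)
  ultimately show ?thesis by blast
qed

text \<open>With t = N div \<open>D\<close> the cover bound satisfies 64 * c = t * \<open>D\<close>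
  \<le> N. Both t and t - 1 are at least N / (2 * \<open>D\<close>), so chains save exp (- N / (8 *
  \<open>D\<close> ^ 2)), and \<open>a\<close> is half of that rate. All three terms save exp (-
  \<open>a\<close> * N), and attaching \<open>W\<close> spends half of it.\<close>

lemma card_bad_graphs_exp_small:
  fixes K :: real
  assumes V: "finite V" "B \<subseteq> V" "W \<subseteq> V" "B \<inter> W = {}" "card B \<le> k" "0 < k" and w: "card W \<le> w"
    and D: "D = 128 * (w + k + 1)" and a: "a = 1 / (16 * (real D)\<^sup>2)"
    and K: "1 \<le> K" "\<And>x. (1 + real x) ^ w \<le> K * exp (a / 2 * real x)"
    and N: "N = card (V - B - W)" "8 * D \<le> N" "64 * K \<le> real N"
  shows "real (card (bad_graphs V B W k)) \<le>
    2 ^ 2 ^ (k + w) * (real k + 2) * 2 ^ (k * N) * exp (- (a / 2) * real N) * (real N + K) ^ Suc N"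
proof -
  define F where "F = V - B - W"
  have finF: "finite F" and NF: "card F = N" using V N by (auto simp: F_def)
  define t where "t = N div D"
  have D0: "0 < D" using D by simp
  have tD: "t * D \<le> N" "N < D + t * D"
    using D0 dividend_less_div_times[of D N] by (auto simp: t_def)
  have t0: "0 < t" using N(2) D0 by (simp add: t_def div_greater_zero_iff)
  have tN: "t \<le> N" by (simp add: t_def)
  define c where "c = Suc w * (2 * t) + 2 * (k * t)"
  have "64 * c = t * D" by (simp add: c_def D algebra_simps)
  then have c: "64 * c \<le> N" using tD by simp
  have N0: "0 < real N" using N(2) D0 by (simp add: less_le_trans[of 0 "8 * D" N])
  have rD: "0 < real D" using D0 by simp
  have rN: "real N < real D + real t * real D" "8 * real D \<le> real N"
    using tD(2) N(2) by (metis of_nat_add of_nat_less_iff of_nat_mult, metis of_nat_le_iff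
        of_nat_mult of_nat_numeral)
  have t1: "real N / (2 * real D) \<le> real t" using rN rD by (simp add: field_simps)
  have t2: "real N / (2 * real D) \<le> real t - 1" using rN rD by (simp add: field_simps)
  have D1: "1 \<le> real D" using D0 by simp
  have aN: "a * real N = real N / (16 * (real D)\<^sup>2)" by (simp add: a)
  let ?S = "real N + K"
  let ?P = "\<Sum>f\<in>parents F. wt K F f"
  let ?L = "\<Sum>f\<in>{f \<in> parents F. long_chain t F f}. wt K F f"
  let ?C = "\<Sum>f\<in>{f \<in> parents F. small_cover c F f}. wt K F f"
  let ?e = "exp (- (a * real N))"
  have S1: "1 \<le> ?S" using K by simp
  have e1: "(3 / 4) ^ t \<le> ?e"
  proof -
    have "(3 / 4 :: real) \<le> exp (- (1 / 4))" using exp_ge_add_one_self[of "- (1 / 4) :: real"] by simp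
    then have "(3 / 4 :: real) ^ t \<le> exp (- (1 / 4)) ^ t" by (intro power_mono) auto
    also have "\<dots> = exp (- (real t / 4))" by (simp add: exp_of_nat_mult[symmetric])
    also have "\<dots> \<le> ?e"
    proof -
      have "a * real N \<le> real N / (2 * real D) / 4"
        unfolding aN using D1 N0 rD by (simp add: field_simps power2_eq_square)
      then show ?thesis using t1 by simp
    qed
    finally show ?thesis .
  qed
  have e2: "exp (- (real t * (real t - 1) / (2 * real N))) \<le> ?e"
  proof -
    have "(real N / (2 * real D)) * (real N / (2 * real D)) \<le> real t * (real t - 1)"
      using t1 t2 N0 rD by (intro mult_mono) auto
    then have "(real N / (2 * real D)) * (real N / (2 * real D)) / (2 * real N) \<le> real t * (real t -
        1) / (2 * real N)"
      using N0 by (intro divide_right_mono) auto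
    moreover have "a * real N \<le> (real N / (2 * real D)) * (real N / (2 * real D)) / (2 * real N)"
      unfolding aN using N0 rD by (simp add: field_simps power2_eq_square)
    ultimately show ?thesis by simp
  qed
  have e3: "(1 / 2) ^ N \<le> ?e"
  proof -
    have "(1 / 2 :: real) \<le> exp (- (1 / 2))" using exp_ge_add_one_self[of "- (1 / 2) :: real"] by simp
    then have "(1 / 2 :: real) ^ N \<le> exp (- (1 / 2)) ^ N" by (intro power_mono) auto
    also have "\<dots> = exp (- (real N / 2))" by (simp add: exp_of_nat_mult[symmetric])
    also have "\<dots> \<le> ?e"
    proof -
      have "1 \<le> (real D)\<^sup>2" using D1 by simp
      then have "a \<le> 1 / 2" unfolding a by (intro frac_le) auto
      then have "a * real N \<le> 1 / 2 * real N" using N0 by (intro mult_right_mono) auto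
      then show ?thesis by simp
    qed
    finally show ?thesis .
  qed
  have T1: "(real k * (3 / 4) ^ t) * ?P \<le> (real k * ?e) * ?S ^ Suc N"
  proof (rule mult_mono)
    show "?P \<le> ?S ^ Suc N"
      using S1 by (simp only: sum_wt_parents[OF finF] NF) (intro power_increasing, auto)
  qed (use e1 K in \<open>auto intro!: mult_left_mono sum_nonneg wt_nonneg\<close>)
  have T2: "?L \<le> ?e * ?S ^ Suc N"
  proof -
    have "?L \<le>
        exp (- (real t * (real t - 1) / (2 * real N))) * ?S ^ Suc N"
      using sum_wt_long_chain[OF finF t0 _ K(1)] tN NF by simp
    also have "\<dots> \<le> ?e * ?S ^ Suc N" using e2 S1 by (intro mult_right_mono) auto
    finally show ?thesis .
  qed
  have T3: "?C \<le> ?e * ?S ^ Suc N"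
  proof -
    have "c \<le> N" using c by simp
    have "?C \<le>
        2 ^ N * (?S ^ c * (real c + K) ^ (N - c))"
      using sum_wt_small_cover[OF finF _ K(1), of c] \<open>c \<le> N\<close> NF by simp
    \<comment> \<open>Both c and \<open>K\<close> are at most N / 64, so each vertex off the cover
      saves 2 ^ 5. At least 2 * N factors 1 / 2 arise, of which N pay for choosing the
      cover.\<close>
    also have "\<dots> \<le> 2 ^ N * (?S ^ c * (?S * (1 / 2) ^ 5) ^ (N - c))"
    proof (intro mult_left_mono power_mono)
      have "64 * real c \<le> real N" using c by (metis of_nat_le_iff of_nat_mult of_nat_numeral)
      then have "real c + K \<le> ?S / 32" using N(3) K(1) by simp
      also have "?S / 32 = ?S * (1 / 2) ^ 5" by (simp add: power_divide)
      finally show "real c + K \<le> ?S * (1 / 2) ^ 5" .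
    qed (use K in auto)
    also have "\<dots> = 2 ^ N * (1 / 2) ^ (5 * (N - c)) * (?S ^ c * ?S ^ (N - c))"
      by (simp only: power_mult_distrib power_mult[symmetric] mult_ac)
    also have "?S ^ c * ?S ^ (N - c) = ?S ^ N" using \<open>c \<le> N\<close> by (simp add: power_add[symmetric])
    also have "2 ^ N * (1 / 2) ^ (5 * (N - c)) * ?S ^ N \<le> ?e * ?S ^ Suc N"
    proof (rule mult_mono)
      have "2 * N \<le> 5 * (N - c)" using c by simp
      then have "(1 / 2 :: real) ^ (5 * (N - c)) \<le> (1 / 2) ^ (2 * N)" by (intro power_decreasing) auto
      then have "2 ^ N * (1 / 2 :: real) ^ (5 * (N - c)) \<le> 2 ^ N * (1 / 2) ^ (2 * N)" by (intro
          mult_left_mono) auto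
      also have "\<dots> = (1 / 2) ^ N" by (simp add: mult_2 power_add power_one_over)
      also have "\<dots> \<le> ?e" by (rule e3)
      finally show "2 ^ N * (1 / 2) ^ (5 * (N - c)) \<le> ?e" .
    qed (use S1 in \<open>auto intro!: power_increasing simp del: power_Suc\<close>)
    finally show ?thesis .
  qed
  have "real (card (bad_graphs V B W k)) \<le> 2 ^ 2 ^ (k + w) * (exp (a / 2 * real N) * (2 ^ (k * N) *
      ((real k * (3 / 4) ^ t) * ?P +
       (?L + ?C))))"
    using card_bad_graphs_le[OF V w t0 _ K] tN NF unfolding c_def F_def by simp
  also have "\<dots> \<le> 2 ^ 2 ^ (k + w) * (exp (a / 2 * real N) * (2 ^ (k * N) *
      ((real k * ?e) * ?S ^ Suc N + (?e * ?S ^ Suc N + ?e * ?S ^ Suc N))))"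
    using T1 T2 T3 by (intro mult_left_mono add_mono) auto
  also have "\<dots> = 2 ^ 2 ^ (k + w) * (real k + 2) * 2 ^ (k * N) * (exp (a / 2 * real N) * ?e) * ?S ^ Suc N"
    by (simp only: distrib_right distrib_left mult_2 mult_ac)
  also have "exp (a / 2 * real N) * ?e = exp (- (a / 2) * real N)"
    unfolding exp_add[symmetric] by (intro arg_cong[of _ _ exp]) (simp add: field_simps)
  finally show ?thesis .
qed

lemma eventually_polynomial_le_exp:
  fixes C a :: real
  assumes "0 < a"
  shows "\<forall>\<^sub>F n in sequentially. C * (real n + 1) ^ p \<le> exp (a * real n)"
proof -
  let ?x = "\<lambda>n. a * (real n + 1)"
  define \<epsilon> where "\<epsilon> = a ^ p / ((\<bar>C\<bar> + 1) * exp a)"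
  have \<epsilon>: "0 < \<epsilon>" using assms by (simp add: \<epsilon>_def)
  have "filterlim (\<lambda>n. real n + 1) at_top sequentially"
    by (rule filterlim_tendsto_add_at_top[of "\<lambda>_. 1" 1, unfolded add.commute[of 1]])
      (auto simp: filterlim_real_sequentially)
  then have x: "filterlim ?x at_top sequentially"
    using assms by (intro filterlim_tendsto_pos_mult_at_top[OF tendsto_const]) auto
  have "(\<lambda>n. ?x n ^ p / exp (?x n)) \<longlonglongrightarrow> 0"
    using filterlim_compose[OF tendsto_power_div_exp_0[of p] x] .
  then have "\<forall>\<^sub>F n in sequentially. ?x n ^ p / exp (?x n) < \<epsilon>" using \<epsilon> by (rule order_tendstoD(2))
  then show ?thesis
  proof eventually_elim
    case (elim n)
    then have "?x n ^ p < \<epsilon> * exp (?x n)" by (subst (asm) pos_divide_less_eq) auto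
    then have "a ^ p * (real n + 1) ^ p < \<epsilon> * exp (?x n)" by (simp only: power_mult_distrib)
    also have "\<dots> = a ^ p * (exp (a * real n) / (\<bar>C\<bar> + 1))"
      by (simp add: \<epsilon>_def distrib_left exp_add)
    finally have "(real n + 1) ^ p < exp (a * real n) / (\<bar>C\<bar> + 1)"
      using assms by (simp only: mult_less_cancel_left_pos[OF zero_less_power])
    then have "(\<bar>C\<bar> + 1) * (real n + 1) ^ p < exp (a * real n)"
      by (subst (asm) pos_less_divide_eq) (auto simp: mult.commute)
    moreover have "C * (real n + 1) ^ p \<le> (\<bar>C\<bar> + 1) * (real n + 1) ^ p" by (intro mult_right_mono) auto
    ultimately show ?case by (rule order_trans[OF _ less_imp_le, rotated])
  qed
qed

text \<open>With m = n - k, the upper bound 2 ^ (k * n) * (n + K) ^ (n + 1) and the lower bound 2 ^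
  (k * m) * m ^ (m - 2) differ only by a constant and a polynomial factor, so the exponential saving
  decides.\<close>

lemma card_difference_exp_small:
  assumes "0 < k"
  shows "\<exists>c>0. \<forall>\<^sub>F n in sequentially.
    real (card (labelled (ex_disjoint_cycles (k + 1)) n - labelled (apex_forests k) n)) \<le>
    exp (- c * real n) * real (card (labelled (apex_forests k) n))"
proof -
  let ?A = "\<lambda>n. real (card (labelled (apex_forests k) n))"
  let ?d = "\<lambda>n. real (card (labelled (ex_disjoint_cycles (k + 1)) n - labelled (apex_forests k) n))"
  define w where "w = minor_bound k"
  define D where "D = 128 * (w + k + 1)"
  define a where "a = 1 / (16 * (real D)\<^sup>2)"
  have a: "0 < a" by (simp add: a_def D_def)
  obtain K where K: "1 \<le> K" "\<And>x::nat. (1 + real x) ^ w \<le> K * exp (a / 2 * real x)"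
    using exists_exp_dominating_power[of "a / 2" w] a by auto
  define C where "C = 2 ^ 2 ^ (k + w) * (real k + 2) * exp (a / 2 * real (k + w))"
  define C' where "C' = C * 2 ^ (k * k) * exp (2 * (real k + K))"
  \<comment> \<open>k + w for the choice of the pair, k + 1 for the passage from exponent n + 1 to
    m, and 2 from the lower bound on forests.\<close>
  define p where "p = 2 * k + w + 3"
  have C0: "0 \<le> C" by (simp add: C_def)
  have pair: "real (card (bad_graphs {1..n} B W k)) \<le> C * 2 ^ (k * n) * exp (- (a / 2) * real n) *
      (real n + K) ^ Suc n"
    if BW: "B \<subseteq> {1..n}" "W \<subseteq> {1..n}" "B \<inter> W = {}" "card B \<le> k" "card W \<le> w"
      and n: "8 * D + k + w \<le> n" "64 * K + real (k + w) \<le> real n" for n B W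
  proof -
    define N where "N = card ({1..n} - B - W)"
    have "card (B \<union> W) \<le> k + w" using BW(4,5) card_Un_le[of B W] by linarith
    moreover have "{1..n} - B - W = {1..n} - (B \<union> W)" by auto
    moreover have "finite (B \<union> W)" using BW finite_subset by blast
    ultimately have N: "n \<le> N + (k + w)" "N \<le> n"
      using BW card_Diff_subset[of "B \<union> W" "{1..n}"] by (auto simp: N_def)
    have rN: "real n \<le> real N + real (k + w)" using N(1) by (metis of_nat_add of_nat_le_iff)
    have "real (card (bad_graphs {1..n} B W k)) \<le>
        2 ^ 2 ^ (k + w) * (real k + 2) * 2 ^ (k * N) * exp (- (a / 2) * real N) * (real N + K) ^ Suc N"
      using BW assms K N n rN
      by (intro card_bad_graphs_exp_small[of _ _ _ _ _ D a]) (auto simp: N_def D_def a_def)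
    also have "\<dots> \<le> 2 ^ 2 ^ (k + w) * (real k + 2) * 2 ^ (k * n) *
        (exp (a / 2 * real (k + w)) * exp (- (a / 2) * real n)) * (real n + K) ^ Suc n"
    proof (intro mult_mono)
      show "(2::real) ^ (k * N) \<le> 2 ^ (k * n)" using N by (intro power_increasing) auto
      have "- (a / 2) * real N \<le> a / 2 * real (k + w) + - (a / 2) * real n"
        using mult_left_mono[OF rN, of "a / 2"] a by (simp only: distrib_left mult_minus_left) linarith
      then show "exp (- (a / 2) * real N) \<le> exp (a / 2 * real (k + w)) * exp (- (a / 2) * real n)"
        unfolding exp_add[symmetric] by simp
      have "(real N + K) ^ Suc N \<le> (real n + K) ^ Suc N" using N K by (intro power_mono) auto
      also have "\<dots> \<le> (real n + K) ^ Suc n" using N K by (intro power_increasing) auto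
      finally show "(real N + K) ^ Suc N \<le> (real n + K) ^ Suc n" .
    qed (use K in auto)
    finally show ?thesis by (simp add: C_def mult_ac)
  qed
  have main: "?d n \<le>
      C' * (real n + 1) ^ p * exp (- (a / 2) * real n) * ?A n"
    if n: "8 * D + k + w \<le> n" "64 * K + real (k + w) \<le> real n" "2 * k + 1 \<le> n" for n
  proof -
    let ?I = "{(B, W). B \<subseteq> {1..n} \<and> W \<subseteq> {1..n} \<and> B \<inter> W = {} \<and> card B \<le> k \<and> card W \<le> minor_bound k}"
    let ?b = "C * 2 ^ (k * n) * exp (- (a / 2) * real n) * (real n + K) ^ Suc n"
    define m where "m = n - k"
    have m: "0 < m" "n = m + k" "n + 1 \<le> 2 * m" "m \<le> n + 1" using n by (auto simp: m_def)
    have "card ?I \<le> card ({B. B \<subseteq> {1..n} \<and> card B \<le> k} \<times> {W. W \<subseteq> {1..n} \<and> card W \<le> w})"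
      by (rule card_mono) (auto simp: w_def)
    also have "\<dots> \<le> (n + 1) ^ k * (n + 1) ^ w"
      unfolding card_cartesian_product by (intro mult_le_mono card_subsets_le)
    finally have "real (card ?I) \<le> real ((n + 1) ^ k * (n + 1) ^ w)" by (rule of_nat_mono)
    then have cI: "real (card ?I) \<le> (real n + 1) ^ (k + w)" by (simp add: power_add add.commute)
    have "?d n \<le>
        real (\<Sum>(B, W)\<in>?I. card (bad_graphs {1..n} B W k))"
      by (intro of_nat_mono card_difference_le)
    also have "\<dots> = (\<Sum>(B, W)\<in>?I. real (card (bad_graphs {1..n} B W k)))" by (simp add: case_prod_beta)
    also have "\<dots> \<le> (\<Sum>_\<in>?I. ?b)"
      using pair[OF _ _ _ _ _ n(1,2)] by (intro sum_mono) (auto simp: w_def)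
    also have "\<dots> = real (card ?I) * ?b" by simp
    also have "\<dots> \<le> (real n + 1) ^ (k + w) * ?b"
      using C0 K by (intro mult_right_mono cI mult_nonneg_nonneg) auto
    \<comment> \<open>n + K = m * (1 + (k + K) / m), and n + 1 \<le> 2 * m keeps the resulting
      exponent below 2 * (k + K).\<close>
    also have "(real n + K) ^ Suc n \<le> (real m ^ m * real m ^ (k + 1)) * exp (2 * (real k + K))"
    proof -
      have "real n + K = real m * (1 + (real k + K) / real m)" using m by (simp add: field_simps)
      also have "\<dots> \<le> real m * exp ((real k + K) / real m)" by (intro mult_left_mono exp_ge_add_one_self) auto
      finally have "(real n + K) ^ Suc n \<le> (real m * exp ((real k + K) / real m)) ^ Suc n"
        using K by (intro power_mono) auto
      also have "\<dots> = real m ^ Suc n * exp (real (Suc n) * ((real k + K) / real m))"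
        by (simp only: power_mult_distrib exp_of_nat_mult)
      also have "\<dots> \<le> real m ^ Suc n * exp (2 * (real k + K))"
      proof -
        have "real (Suc n) \<le> 2 * real m" using m(3) by simp
        then have "real (Suc n) * ((real k + K) / real m) \<le> (2 * real m) * ((real k + K) / real m)"
          using K by (intro mult_right_mono) auto
        also have "\<dots> = 2 * (real k + K)" using m(1) by simp
        finally show ?thesis by (intro mult_left_mono) auto
      qed
      also have "real m ^ Suc n = real m ^ m * real m ^ (k + 1)"
        unfolding power_add[symmetric] using m(2) by (intro arg_cong[of _ _ "power _"]) simp
      finally show ?thesis .
    qed
    then have "(real n + 1) ^ (k + w) * ?b \<le> (real n + 1) ^ (k + w) *
        (C * 2 ^ (k * n) * exp (- (a / 2) * real n) * ((real m ^ m * real m ^ (k + 1)) * exp (2 *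
            (real k + K))))"
      using C0 by (intro mult_left_mono) auto
    also have "(2::real) ^ (k * n) = 2 ^ (k * m) * 2 ^ (k * k)" by (simp add: m(2) distrib_left power_add)
    also have "(real n + 1) ^ (k + w) * (C * (2 ^ (k * m) * 2 ^ (k * k)) * exp (- (a / 2) * real n) *
        ((real m ^ m * real m ^ (k + 1)) * exp (2 * (real k + K)))) =
        (C' * exp (- (a / 2) * real n)) * ((real n + 1) ^ (k + w) * real m ^ (k + 1)) * (2 ^ (k * m)
            * real m ^ m)"
      unfolding C'_def by (simp only: mult_ac)
    also have "\<dots> \<le> (C' * exp (- (a / 2) * real n)) * ((real n + 1) ^ (k + w) * real m ^ (k + 1)) *
        (?A n * (real m)\<^sup>2)"
    proof (rule mult_left_mono)
      have "2 ^ (k * m) * m ^ m \<le> 2 ^ (k * m) * (card (forest_sets {1..m}) * m\<^sup>2)"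
        using card_forest_sets_ge[OF m(1)] by simp
      also have "\<dots> = 2 ^ (k * m) * card (forest_sets {1..m}) * m\<^sup>2" by (rule mult.assoc[symmetric])
      also have "\<dots> \<le> card (labelled (apex_forests k) n) * m\<^sup>2"
        using card_apex_ge[of k n] m(1) unfolding m_def by (intro mult_le_mono1) simp
      finally have "real (2 ^ (k * m) * m ^ m) \<le> real (card (labelled (apex_forests k) n) * m\<^sup>2)" by
          (rule of_nat_mono)
      then show "2 ^ (k * m) * real m ^ m \<le> ?A n * (real m)\<^sup>2" by simp
    qed (use C0 in \<open>auto simp: C'_def\<close>)
    also have "\<dots> = (C' * exp (- (a / 2) * real n) * ?A n) * ((real n + 1) ^ (k + w) * real m ^ (k + 3))"
      by (simp add: power_add power2_eq_square power3_eq_cube mult_ac)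
    also have "\<dots> \<le> (C' * exp (- (a / 2) * real n) * ?A n) * ((real n + 1) ^ (k + w) * (real n + 1) ^ (k + 3))"
      using C0 m(4) by (intro mult_left_mono power_mono) (auto simp: C'_def)
    also have "(real n + 1) ^ (k + w) * (real n + 1) ^ (k + 3) = (real n + 1) ^ p"
      unfolding power_add[symmetric] p_def by (intro arg_cong[of _ _ "power _"]) simp
    finally show ?thesis by (simp only: mult_ac)
  qed
  \<comment> \<open>Half of the remaining rate a / 2 is given up to absorb the polynomial.\<close>
  have a4: "0 < a / 4" using a by simp
  have "\<forall>\<^sub>F n in sequentially. ?d n \<le>
      exp (- (a / 4) * real n) * ?A n"
    using eventually_polynomial_le_exp[OF a4, of C' p] eventually_ge_at_top[of "8 * D + k + w"]
      eventually_ge_at_top[of "nat \<lceil>64 * K + real (k + w)\<rceil>"] eventually_ge_at_top[of "2 * k + 1"]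
  proof eventually_elim
    case (elim n)
    have "64 * K + real (k + w) \<le> real n" using elim(3) by linarith
    then have "?d n \<le>
        C' * (real n + 1) ^ p * exp (- (a / 2) * real n) * ?A n"
      using elim by (intro main) auto
    also have "\<dots> \<le> exp (a / 4 * real n) * exp (- (a / 2) * real n) * ?A n"
      using elim a by (intro mult_right_mono) auto
    also have "exp (a / 4 * real n) * exp (- (a / 2) * real n) = exp (- (a / 4) * real n)"
      unfolding exp_add[symmetric] by (intro arg_cong[of _ _ exp]) (simp add: field_simps)
    finally show ?case .
  qed
  with a4 show ?thesis by blast
qed

theorem theorem1p1:
  fixes k :: nat
  assumes "0 < k"
  shows "\<exists>\<delta> :: nat \<Rightarrow> real. exp_minus_Omega \<delta> \<and>
    (\<forall>n. real (card (labelled (ex_disjoint_cycles (k + 1)) n)) =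
         (1 + \<delta> n) * real (card (labelled (apex_forests k) n)))"
proof -
  let ?A = "\<lambda>n. labelled (apex_forests k) n" and ?E = "\<lambda>n. labelled (ex_disjoint_cycles (k + 1)) n"
  \<comment> \<open>The edgeless graph keeps the denominator of \<delta> positive for every n, so
    the equation holds for all n and not only eventually.\<close>
  have pos: "0 < card (?A n)" for n
  proof -
    have "simple_graph ({1..n}, {})" by (simp add: simple_graph_def)
    moreover from this have "blocker ({1..n}, {}) {}" by (simp add: blocker_iff acyc_def core_def nb_def)
    ultimately have "({1..n}, {}) \<in> ?A n" by (force simp: labelled_def apex_forests_def)
    then show ?thesis using finite_labelled_apex card_gt_0_iff by blast
  qed
  define \<delta> where "\<delta> n = real (card (?E n - ?A n)) / real (card (?A n))" for n
  have "card (?E n) = card (?A n) + card (?E n - ?A n)" for n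
    using card_Diff_subset[OF finite_labelled_apex apex_subset_ex]
      card_mono[OF finite_labelled_ex apex_subset_ex] by simp
  then have "real (card (?E n)) = (1 + \<delta> n) * real (card (?A n))" for n
    using pos[of n] by (simp add: \<delta>_def field_simps)
  moreover have "exp_minus_Omega \<delta>"
  proof -
    obtain c where c: "0 < c" "\<forall>\<^sub>F n in sequentially. real (card (?E n - ?A n)) \<le> exp (- c * real n)
        * real (card (?A n))"
      using card_difference_exp_small[OF assms] by blast
    from c(2) have "\<forall>\<^sub>F n in sequentially. \<delta> n \<le> exp (- c * real n)"
    proof eventually_elim
      case (elim n)
      then show ?case using pos[of n] by (simp add: \<delta>_def divide_le_eq)
    qed
    then show ?thesis using c(1) by (auto simp: exp_minus_Omega_def \<delta>_def)
  qed
  ultimately show ?thesis by blast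
qed

end
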